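(* Let $r\ge2$ be a prime, $d\ge1$, $\ell\ge0$, and $k\ge0$ be integers. Let the vertices of $\Delta_N$ be colored by $\ell+k$ colors, i.e. partitioned into color classes $C_{0}, \dots, C_{\ell+k-1}$, with $|C_0|\le r-1,\ldots,|C_{\ell-1}|\le r-1$ and $|C_{\ell}|\ge 2r-1,\ldots,|C_{\ell+k-1}|\ge 2r-1$, where $|C_0|+\dots+ |C_{\ell-1}| > (r-1)(d-k+1)-k$. Then for every continuous map $f:\Delta_N\to\mathbb{R}^d$ there are $r$ pairwise disjoint rainbow faces $\sigma_1, \dots, \sigma_r$ of $\Delta_N$ such that $f(\sigma_1) \cap \dots \cap f(\sigma_r) \neq \emptyset$.
   Context: $\Delta_N$ denotes the $N$-dimensional simplex with $N+1$ vertices; faces are disjoint if they share no vertex. A face is a rainbow face if it has at most one vertex in each color class. *)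

theory Defs
  imports
    "HOL-Homology.Homology"
    "HOL-Computational_Algebra.Primes"
begin

text \<open>
  The simplex \<open>\<Delta>\<^sub>N\<close> is the library's \<^const>\<open>standard_simplex\<close> \<open>N\<close>, whose points are given by
  barycentric coordinates, so its vertices are indexed by \<open>{..N}\<close>. A face is represented by
  its vertex set \<open>S \<subseteq> {..N}\<close>; \<open>simplex_face N S\<close> is the set of points of that face,
  and it is empty for \<open>S = {}\<close>.
\<close>

definition simplex_face :: "nat \<Rightarrow> nat set \<Rightarrow> (nat \<Rightarrow> real) set" where
  "simplex_face N S = {x \<in> standard_simplex N. \<forall>i. i \<notin> S \<longrightarrow> x i = 0}"

definition simplex_space :: "nat \<Rightarrow> (nat \<Rightarrow> real) topology" where
  "simplex_space N = subtopology (powertop_real UNIV) (standard_simplex N)"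

text \<open>The vertices of \<open>\<Delta>\<^sub>N\<close> are partitioned into the color classes \<open>C 0, \<dots>, C (m - 1)\<close>;
  a color may be unused, so a class may be empty.\<close>

definition vertex_coloring :: "nat \<Rightarrow> nat \<Rightarrow> (nat \<Rightarrow> nat set) \<Rightarrow> bool" where
  "vertex_coloring N m C \<longleftrightarrow> (\<Union>j<m. C j) = {..N} \<and> disjoint_family_on C {..<m}"

definition rainbow_face :: "nat \<Rightarrow> nat \<Rightarrow> (nat \<Rightarrow> nat set) \<Rightarrow> nat set \<Rightarrow> bool" where
  "rainbow_face N m C S \<longleftrightarrow> S \<subseteq> {..N} \<and> (\<forall>j<m. card (S \<inter> C j) \<le> 1)"

end

theory Submission
  imports Defs "HOL-Combinatorics.Permutations"
begin

text \<open>
  A point of the rainbow \<open>r\<close>-fold deleted join consists of \<open>r\<close> points of the cone over \<open>\<Delta>\<^sub>N\<close>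
  with disjoint rainbow supports. If \<open>f\<close> had no Tverberg point, then at every point of this complex
  some coordinate would distinguish the \<open>r\<close> rows. Recording a coordinate of maximal
  spread and a row where the maximum is attained gives an equivariant labelling, and on a fine
  subdivision this labelling induces a \<open>\<int>/r\<close>-equivariant chain map into the join of \<open>m\<close> boundaries of
  \<open>(r - 1)\<close>-simplices, a sphere.

  Such a map cannot exist on the join of \<open>m\<close> chessboard complexes \<open>r \<times> (r - 1)\<close> and one copy of \<open>r\<close>
  points. The join of chessboards is a pseudomanifold whose fundamental cycle has degree
  \<open>((r - 1)!)\<^sup>m\<close> under the obvious map to the sphere. For prime \<open>r\<close> the degree of an equivariant map
  is determined modulo \<open>r\<close>, so it is nonzero, although the cycle bounds in the cone over one of the
  \<open>r\<close> points.

  The given color classes are brought into this shape in two ways. New vertices fill the small classes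
  up to size \<open>r - 1\<close>; they come in groups of \<open>r - 1\<close>, and an extra coordinate for each group prevents
  them from occurring in a coincidence. A class with at least \<open>2r - 1\<close> vertices
  gives an \<open>(r - 2)\<close>-connected chessboard complex, which receives an equivariant chain map from the
  join of \<open>r\<close> copies of \<open>r\<close> points, so it can replace \<open>r\<close> classes of size \<open>1\<close>.
\<close>


section \<open>Chains of vertex lists\<close>

text \<open>Working with chains avoids degrees of continuous maps. What matters about the sphere is
  that it is acyclic below its dimension, that the facet coefficients of a top-dimensional cycle
  agree up to fixed signs, and that rotation has order \<open>r\<close>. Lists with repetitions
  serve as simplices because vertex maps then act on chains without sign conventions, and the empty
  list supplies the augmentation.

  The numbers fit as follows. A coincidence is wanted in \<open>m = d + 1 + l\<close> coordinates:
  the mass of a row, the \<open>d\<close> coordinates of \<open>f\<close>, and one sum for each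
  group of new columns. The obstruction asks for \<open>m * (r - 1) + 1\<close> columns. A group for
  a small class \<open>C g\<close> consists of \<open>r - 1 - card (C g)\<close> fillers and
  \<open>card (C g)\<close> one-element classes. So the filled classes give
  \<open>l * (r - 1)\<close> columns, the one-element classes give \<open>s\<close>, the number of
  vertices in small classes, and the large classes stand for \<open>k * r\<close> more. What is
  required is thus \<open>s + k * r \<ge> (d + 1) * (r - 1) + 1\<close>, which is the numerical
  hypothesis. The size \<open>2 * r - 1\<close> is the least number \<open>q\<close> of columns with
  \<open>2 * r \<le> q + 1\<close>, the bound for acyclicity of a chessboard below
  \<open>r\<close>.\<close>

lemma frag_extend_extend:
  "frag_extend f (frag_extend g c) = frag_extend (\<lambda>x. frag_extend f (g x)) c"
  by (rule frag_induction [of c UNIV]) (auto simp: frag_extend_diff)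

lemma frag_extend_fun_diff:
  "frag_extend (\<lambda>x. f x - g x) c = frag_extend f c - frag_extend g c"
  by (rule frag_induction [of c UNIV]) (auto simp: frag_extend_diff)

lemma frag_extend_fun_add:
  "frag_extend (\<lambda>x. f x + g x) c = frag_extend f c + frag_extend g c"
  by (rule frag_induction [of c UNIV]) (auto simp: frag_extend_diff)

lemma frag_cmul_diff: "frag_cmul k (a - b) = frag_cmul k a - frag_cmul k b"
  by (metis frag_cmul_distrib2 diff_add_cancel add_diff_cancel)

lemma frag_extend_fun_cmul:
  "frag_extend (\<lambda>x. frag_cmul k (f x)) c = frag_cmul k (frag_extend f c)"
  by (rule frag_induction [of c UNIV]) (auto simp: frag_extend_diff frag_cmul_diff)

lemma keys_frag_extend_subset:
  assumes "\<And>x. x \<in> Poly_Mapping.keys c \<Longrightarrow> Poly_Mapping.keys (f x) \<subseteq> A"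
  shows "Poly_Mapping.keys (frag_extend f c) \<subseteq> A"
  using keys_frag_extend [of f c] assms by blast

lemma keys_diff_subset:
  "Poly_Mapping.keys a \<subseteq> A \<Longrightarrow> Poly_Mapping.keys b \<subseteq> A \<Longrightarrow> Poly_Mapping.keys (a - b) \<subseteq> A"
  using keys_diff [of a b] by blast

lemma keys_add_subset:
  "Poly_Mapping.keys a \<subseteq> A \<Longrightarrow> Poly_Mapping.keys b \<subseteq> A \<Longrightarrow> Poly_Mapping.keys (a + b) \<subseteq> A"
  using Poly_Mapping.keys_add [of a b] by blast

definition cone :: "'a \<Rightarrow> ('a list \<Rightarrow>\<^sub>0 int) \<Rightarrow> ('a list \<Rightarrow>\<^sub>0 int)" where
  "cone v = frag_extend (\<lambda>w. frag_of (v # w))"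

text \<open>The alternating sum of deletions (\<open>bdl_eq_sum\<close>), in a recursive form that
  makes the homotopy identity \<open>bd_cone\<close> a matter of rewriting. Since
  \<open>bdl [v] = frag_of []\<close>, the complex is augmented.\<close>

primrec bdl :: "'a list \<Rightarrow> ('a list \<Rightarrow>\<^sub>0 int)" where
  "bdl [] = 0"
| "bdl (v # w) = frag_of w - cone v (bdl w)"

definition bd :: "('a list \<Rightarrow>\<^sub>0 int) \<Rightarrow> ('a list \<Rightarrow>\<^sub>0 int)" where
  "bd = frag_extend bdl"

lemma cone_simps [simp]:
  "cone v 0 = 0" "cone v (frag_of w) = frag_of (v # w)"
  "cone v (a - b) = cone v a - cone v b" "cone v (a + b) = cone v a + cone v b"
  "cone v (- a) = - cone v a" "cone v (frag_cmul k a) = frag_cmul k (cone v a)"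
  by (auto simp: cone_def frag_extend_diff frag_extend_add frag_extend_minus frag_extend_cmul)

lemma bd_simps [simp]:
  "bd 0 = 0" "bd (frag_of w) = bdl w"
  "bd (a - b) = bd a - bd b" "bd (a + b) = bd a + bd b"
  "bd (- a) = - bd a" "bd (frag_cmul k a) = frag_cmul k (bd a)"
  by (auto simp: bd_def frag_extend_diff frag_extend_add frag_extend_minus frag_extend_cmul)

lemma bd_cone [simp]: "bd (cone v c) = c - cone v (bd c)"
  by (rule frag_induction [of c UNIV]) (auto simp: algebra_simps)

lemma bd_bdl [simp]: "bd (bdl w) = 0"
  by (induction w) auto

lemma bd_bd [simp]: "bd (bd c) = 0"
  by (rule frag_induction [of c UNIV]) auto

text \<open>The Leibniz rule for a join: moving the boundary past each entry of \<open>xs\<close>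
  costs one sign.\<close>

lemma bdl_append_frag:
  "bdl (xs @ ys) = frag_extend (\<lambda>u. frag_of (u @ ys)) (bdl xs)
     + frag_cmul ((-1) ^ length xs) (frag_extend (\<lambda>u. frag_of (xs @ u)) (bdl ys))"
proof (induction xs)
  case Nil
  then show ?case by (simp flip: frag_expansion)
next
  case (Cons v xs)
  have "cone v (frag_extend (\<lambda>u. frag_of (u @ ys)) (bdl xs))
      = frag_extend (\<lambda>u. frag_of (u @ ys)) (cone v (bdl xs))"
    "cone v (frag_extend (\<lambda>u. frag_of (xs @ u)) (bdl ys)) = frag_extend (\<lambda>u. frag_of ((v # xs) @ u)) (bdl ys)"
    by (simp_all add: cone_def frag_extend_extend)
  then show ?case
    by (simp add: Cons.IH frag_extend_diff flip: minus_frag_cmul)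
qed

lemma cone_sum: "finite I \<Longrightarrow> cone v (sum g I) = (\<Sum>i\<in>I. cone v (g i))"
  by (induction I rule: finite_induct) auto

lemma bdl_eq_sum:
  "bdl w = (\<Sum>i<length w. frag_cmul ((-1) ^ i) (frag_of (take i w @ drop (Suc i) w)))"
proof (induction w)
  case (Cons v w)
  have "(\<Sum>i<length (v # w). frag_cmul ((-1) ^ i) (frag_of (take i (v # w) @ drop (Suc i) (v # w))))
     = frag_of w + (\<Sum>i<length w. frag_cmul ((-1) ^ Suc i) (frag_of (v # take i w @ drop (Suc i) w)))"
    unfolding list.size(4) add_Suc_right add_0_right sum.lessThan_Suc_shift by simp
  also have "(\<Sum>i<length w. frag_cmul ((-1) ^ Suc i) (frag_of (v # take i w @ drop (Suc i) w)))
     = - (\<Sum>i<length w. frag_cmul ((-1) ^ i) (frag_of (v # take i w @ drop (Suc i) w)))"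
    unfolding sum_negf [symmetric] by (rule sum.cong) simp_all
  also have "(\<Sum>i<length w. frag_cmul ((-1) ^ i) (frag_of (v # take i w @ drop (Suc i) w))) = cone v (bdl w)"
    by (subst Cons.IH) (simp add: cone_sum)
  finally show ?case by (simp only: bdl.simps diff_conv_add_uminus)
qed simp

lemma keys_bdl:
  assumes "u \<in> Poly_Mapping.keys (bdl w)"
  shows "\<exists>i<length w. u = take i w @ drop (Suc i) w"
proof -
  have "u \<in> (\<Union>i<length w. Poly_Mapping.keys (frag_cmul ((-1) ^ i) (frag_of (take i w @ drop (Suc i) w))))"
    using assms keys_sum [of "\<lambda>i. frag_cmul ((-1) ^ i) (frag_of (take i w @ drop (Suc i) w))" "{..<length w}"]
    unfolding bdl_eq_sum [of w] by (rule rev_subsetD)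
  then show ?thesis by (auto simp: keys_cmul_iff)
qed

lemma keys_bdl_length: "u \<in> Poly_Mapping.keys (bdl w) \<Longrightarrow> length w = Suc (length u)"
  by (drule keys_bdl) auto

lemma keys_bdl_set: "u \<in> Poly_Mapping.keys (bdl w) \<Longrightarrow> set u \<subseteq> set w"
  by (drule keys_bdl) (auto dest: in_set_takeD in_set_dropD)

section \<open>Down-closed set families as simplicial complexes, and their acyclicity\<close>

definition simps :: "'a set set \<Rightarrow> nat \<Rightarrow> 'a list set" where
  "simps P n = {w. length w = n \<and> set w \<in> P}"

definition down_closed :: "'a set set \<Rightarrow> bool" where
  "down_closed P \<longleftrightarrow> (\<forall>A\<in>P. \<forall>B\<subseteq>A. B \<in> P)"

lemma down_closedD: "down_closed P \<Longrightarrow> A \<in> P \<Longrightarrow> B \<subseteq> A \<Longrightarrow> B \<in> P"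
  unfolding down_closed_def by blast

lemma keys_bd:
  assumes "down_closed P" "Poly_Mapping.keys c \<subseteq> simps P (Suc n)"
  shows "Poly_Mapping.keys (bd c) \<subseteq> simps P n"
  unfolding bd_def
proof (rule keys_frag_extend_subset)
  fix w assume "w \<in> Poly_Mapping.keys c"
  then have "length w = Suc n" "set w \<in> P" using assms by (auto simp: simps_def)
  then show "Poly_Mapping.keys (bdl w) \<subseteq> simps P n"
    using keys_bdl_length keys_bdl_set down_closedD [OF assms(1)] by (fastforce simp: simps_def)
qed

lemma bd_eq_0_Nil:
  assumes "Poly_Mapping.keys c \<subseteq> simps P 0" shows "bd c = 0"
  unfolding bd_def by (rule frag_extend_eq_0) (use assms in \<open>auto simp: simps_def\<close>)

text \<open>A cycle of lists of length \<open>q\<close> has dimension \<open>q - 1\<close>, and the empty list is the augmentation;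
  so this is vanishing of reduced homology below dimension \<open>n - 1\<close>.\<close>

definition acyc :: "'a set set \<Rightarrow> nat \<Rightarrow> bool" where
  "acyc P n \<longleftrightarrow> (\<forall>q<n. \<forall>c. Poly_Mapping.keys c \<subseteq> simps P q \<longrightarrow> bd c = 0 \<longrightarrow>
     (\<exists>w. Poly_Mapping.keys w \<subseteq> simps P (Suc q) \<and> bd w = c))"

lemma acycD:
  assumes "acyc P n" "q < n" "Poly_Mapping.keys c \<subseteq> simps P q" "bd c = 0"
  obtains w where "Poly_Mapping.keys w \<subseteq> simps P (Suc q)" "bd w = c"
  using assms unfolding acyc_def by blast

lemma acyc_0 [simp]: "acyc P 0"
  by (simp add: acyc_def)

lemma acyc_mono: "acyc P n \<Longrightarrow> m \<le> n \<Longrightarrow> acyc P m"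
  by (auto simp: acyc_def)

text \<open>Putting \<open>v\<close> in front is a contracting homotopy, so by
  \<open>bd_cone\<close> every cycle is bounded by its cone.\<close>

lemma acyc_cone:
  assumes "\<And>A. A \<in> P \<Longrightarrow> insert v A \<in> P"
  shows "acyc P n"
  unfolding acyc_def
proof (intro allI impI)
  fix q and c :: "'a list \<Rightarrow>\<^sub>0 int"
  assume c: "Poly_Mapping.keys c \<subseteq> simps P q" "bd c = 0"
  have "Poly_Mapping.keys (cone v c) \<subseteq> simps P (Suc q)"
    unfolding cone_def
    by (rule keys_frag_extend_subset) (use c assms in \<open>auto simp: simps_def\<close>)
  moreover have "bd (cone v c) = c" by (simp add: c)
  ultimately show "\<exists>w. Poly_Mapping.keys w \<subseteq> simps P (Suc q) \<and> bd w = c" by blast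
qed

lemma simps_mono: "P \<subseteq> Q \<Longrightarrow> simps P n \<subseteq> simps Q n"
  by (auto simp: simps_def)

text \<open>Split a cycle as \<open>c1 + c2\<close>. The boundaries of the two parts are opposite,
  hence lie in the intersection; a chain \<open>e\<close> there with the boundary of
  \<open>c1\<close> turns \<open>c1 - e\<close> and \<open>c2 + e\<close> into cycles of the two
  pieces. Finding \<open>e\<close> is a problem one dimension lower, whence
  \<open>n - 1\<close>.\<close>

lemma acyc_Mayer_Vietoris:
  assumes "down_closed P1" "down_closed P2"
    and "acyc P1 n" "acyc P2 n" "acyc (P1 \<inter> P2) (n - 1)"
  shows "acyc (P1 \<union> P2) n"
  unfolding acyc_def
proof (intro allI impI)
  fix q and c :: "'a list \<Rightarrow>\<^sub>0 int"
  assume q: "q < n" and c: "Poly_Mapping.keys c \<subseteq> simps (P1 \<union> P2) q" "bd c = 0"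
  have "Poly_Mapping.keys c \<subseteq> simps P1 q \<union> simps P2 q"
    using c by (auto simp: simps_def)
  then obtain c1 c2 where c12: "Poly_Mapping.keys c1 \<subseteq> simps P1 q" "Poly_Mapping.keys c2 \<subseteq> simps P2 q" "c1 + c2 = c"
    using frag_split by metis
  have "bd c1 = - bd c2" using c c12 by (metis add_eq_0_iff2 bd_simps(4))
  obtain e where e: "Poly_Mapping.keys e \<subseteq> simps (P1 \<inter> P2) q" "bd e = bd c1"
  proof (cases q)
    case 0
    then show ?thesis using that [of 0] bd_eq_0_Nil [of c1 P1] c12 by auto
  next
    case (Suc q')
    have "Poly_Mapping.keys (bd c1) \<subseteq> simps P1 q'" "Poly_Mapping.keys (bd c2) \<subseteq> simps P2 q'"
      using keys_bd assms c12 Suc by metis+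
    then have "Poly_Mapping.keys (bd c1) \<subseteq> simps (P1 \<inter> P2) q'"
      using \<open>bd c1 = - bd c2\<close> by (auto simp: simps_def)
    moreover have "q' < n - 1" using q Suc by simp
    ultimately show ?thesis
      using acycD [OF assms(5), of q' "bd c1"] that Suc by (metis bd_bd)
  qed
  have e12: "Poly_Mapping.keys e \<subseteq> simps P1 q" "Poly_Mapping.keys e \<subseteq> simps P2 q"
    using e simps_mono [of "P1 \<inter> P2"] by blast+
  obtain w1 where w1: "Poly_Mapping.keys w1 \<subseteq> simps P1 (Suc q)" "bd w1 = c1 - e"
    using acycD [OF assms(3) q, of "c1 - e"] keys_diff_subset c12 e12 e by (metis bd_simps(3) diff_self)
  obtain w2 where w2: "Poly_Mapping.keys w2 \<subseteq> simps P2 (Suc q)" "bd w2 = c2 + e"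
    using acycD [OF assms(4) q, of "c2 + e"] keys_add_subset c12 e12 e \<open>bd c1 = - bd c2\<close>
    by (metis add.right_inverse bd_simps(4))
  have "Poly_Mapping.keys (w1 + w2) \<subseteq> simps (P1 \<union> P2) (Suc q)"
    using w1 w2 simps_mono [of P1 "P1 \<union> P2"] simps_mono [of P2 "P1 \<union> P2"] by (intro keys_add_subset) blast+
  moreover have "bd (w1 + w2) = c" using w1 w2 c12 by simp
  ultimately show "\<exists>w. Poly_Mapping.keys w \<subseteq> simps (P1 \<union> P2) (Suc q) \<and> bd w = c" by blast
qed

section \<open>Acyclicity of joins of boundaries of simplices\<close>

text \<open>For pairwise disjoint \<open>A j\<close> this is the join of the boundaries of the simplices \<open>A j\<close>,
  joined with the full simplex on the remaining vertices of \<open>V\<close>.\<close>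

definition avoiding :: "'a set \<Rightarrow> 'i set \<Rightarrow> ('i \<Rightarrow> 'a set) \<Rightarrow> 'a set set" where
  "avoiding V J A = {\<sigma>. \<sigma> \<subseteq> V \<and> (\<forall>j\<in>J. \<not> A j \<subseteq> \<sigma>)}"

lemma down_closed_avoiding: "down_closed (avoiding V J A)"
  unfolding down_closed_def avoiding_def by blast

text \<open>Split at a vertex \<open>v\<close> of a set \<open>A j\<close> with at least two
  elements. The star of \<open>v\<close> is a cone. The simplices without \<open>v\<close> form a
  cone over any other \<open>u\<close> of \<open>A j\<close>, because without \<open>v\<close> they
  never contain all of \<open>A j\<close>. The two pieces meet in a complex of the same kind with
  \<open>v\<close> removed, where the sum has dropped by one.\<close>

lemma acyc_avoiding:
  assumes "finite J" "disjoint_family_on A J" "\<And>j. j \<in> J \<Longrightarrow> finite (A j) \<and> A j \<noteq> {} \<and> A j \<subseteq> V"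
    and "(\<Sum>j\<in>J. card (A j) - 1) = n"
  shows "acyc (avoiding V J A) n"
  using assms
proof (induction n arbitrary: V A)
  case (Suc n)
  have "\<exists>j\<in>J. card (A j) - 1 > 0"
  proof (rule ccontr)
    assume "\<not> (\<exists>j\<in>J. card (A j) - 1 > 0)"
    then have "(\<Sum>j\<in>J. card (A j) - 1) = 0" by (intro sum.neutral ballI) force
    then show False using Suc.prems(4) by simp
  qed
  then obtain j where j: "j \<in> J" "card (A j) - 1 > 0" by blast
  obtain v where v: "v \<in> A j" using Suc.prems(3) j(1) by blast
  have "card (A j - {v}) > 0" using j v by (simp add: card_Diff_singleton)
  then have "A j - {v} \<noteq> {}" by (metis card.empty less_irrefl)
  then obtain u where u: "u \<in> A j" "u \<noteq> v" by blast
  define P1 where "P1 = {\<sigma>. insert v \<sigma> \<in> avoiding V J A}"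
  define P2 where "P2 = {\<sigma> \<in> avoiding V J A. v \<notin> \<sigma>}"
  define A' where "A' = A(j := A j - {v})"
  have vV: "v \<in> V" using Suc j v by blast
  have un: "P1 \<union> P2 = avoiding V J A"
  proof -
    have "\<sigma> \<in> P1" if "\<sigma> \<in> avoiding V J A" "v \<in> \<sigma>" for \<sigma>
      using that by (simp add: P1_def insert_absorb)
    moreover have "\<sigma> \<in> avoiding V J A" if "\<sigma> \<in> P1" for \<sigma>
      using that by (auto simp: P1_def avoiding_def)
    ultimately show ?thesis by (auto simp: P2_def)
  qed
  have other: "v \<notin> A i" "u \<notin> A i" if "i \<in> J" "i \<noteq> j" for i
    using Suc.prems(2) that j(1) v u unfolding disjoint_family_on_def by blast+
  have inter: "P1 \<inter> P2 = avoiding (V - {v}) J A'"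
  proof -
    have "\<sigma> \<in> P1 \<inter> P2 \<longleftrightarrow> \<sigma> \<in> avoiding (V - {v}) J A'" for \<sigma>
      using vV other v j(1) unfolding P1_def P2_def avoiding_def A'_def
      by (auto simp: subset_insert_iff split: if_splits; metis)
    then show ?thesis by blast
  qed
  have "acyc (P1 \<union> P2) (Suc n)"
  proof (rule acyc_Mayer_Vietoris)
    show "down_closed P1"
      using down_closedD [OF down_closed_avoiding] unfolding P1_def down_closed_def
      by (metis (mono_tags, lifting) insert_mono mem_Collect_eq)
    show "down_closed P2"
      using down_closedD [OF down_closed_avoiding] unfolding P2_def down_closed_def by blast
    show "acyc P1 (Suc n)"
      by (rule acyc_cone [of _ v]) (simp add: P1_def)
    show "acyc P2 (Suc n)"
    proof (rule acyc_cone [of _ u])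
      fix \<sigma> assume \<sigma>: "\<sigma> \<in> P2"
      have "\<not> A i \<subseteq> insert u \<sigma>" if "i \<in> J" for i
        using \<sigma> that other v u by (cases "i = j") (auto simp: P2_def avoiding_def subset_insert_iff)
      moreover have "u \<in> V" using Suc.prems(3) j u by blast
      ultimately show "insert u \<sigma> \<in> P2" using \<sigma> u by (auto simp: P2_def avoiding_def)
    qed
    have "acyc (avoiding (V - {v}) J A') n"
    proof (rule Suc.IH)
      show "disjoint_family_on A' J"
        using Suc.prems(2) unfolding A'_def disjoint_family_on_def by (auto split: if_splits)
      show "finite (A' i) \<and> A' i \<noteq> {} \<and> A' i \<subseteq> V - {v}" if "i \<in> J" for i
        using Suc.prems(3) [OF that] other [OF that] u by (auto simp: A'_def)
      have "(\<Sum>i\<in>J. card (A i) - 1) = card (A j) - 1 + (\<Sum>i\<in>J-{j}. card (A i) - 1)"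
        by (rule sum.remove) (use Suc j in auto)
      moreover have "(\<Sum>i\<in>J. card (A' i) - 1) = card (A' j) - 1 + (\<Sum>i\<in>J-{j}. card (A' i) - 1)"
        by (rule sum.remove) (use Suc j in auto)
      moreover have "(\<Sum>i\<in>J-{j}. card (A' i) - 1) = (\<Sum>i\<in>J-{j}. card (A i) - 1)"
        by (rule sum.cong) (auto simp: A'_def)
      moreover have "card (A' j) = card (A j) - 1" using v by (simp add: A'_def card_Diff_singleton)
      ultimately show "(\<Sum>i\<in>J. card (A' i) - 1) = n"
        using Suc.prems(4) j by linarith
    qed (use Suc in auto)
    then show "acyc (P1 \<inter> P2) (Suc n - 1)" by (simp add: inter)
  qed
  then show ?case by (simp add: un)
qed simp

section \<open>Connectivity of joins of chessboard complexes\<close>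

text \<open>A vertex \<open>(i, c)\<close> is the square in row \<open>i\<close> and column \<open>c\<close>; the columns of color \<open>b\<close> form the
  \<open>b\<close>-th chessboard, whose rows are \<open>R b\<close>.\<close>

definition rook :: "('c \<Rightarrow> 'b) \<Rightarrow> ('b \<Rightarrow> 'i set) \<Rightarrow> 'c set \<Rightarrow> ('i \<times> 'c) set set" where
  "rook \<kappa> R S = {\<sigma>. (\<forall>p\<in>\<sigma>. snd p \<in> S \<and> fst p \<in> R (\<kappa> (snd p))) \<and>
     (\<forall>p\<in>\<sigma>. \<forall>q\<in>\<sigma>. snd p = snd q \<or> fst p = fst q \<and> \<kappa> (snd p) = \<kappa> (snd q) \<longrightarrow> p = q)}"

definition board :: "('c \<Rightarrow> 'b) \<Rightarrow> 'c set \<Rightarrow> 'b \<Rightarrow> 'c set" where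
  "board \<kappa> S b = {c \<in> S. \<kappa> c = b}"

text \<open>\<open>s b\<close> is the order of acyclicity contributed by board \<open>b\<close>; in
  a join these orders add up. The condition survives deleting a row and a column while lowering
  \<open>s b\<close> by one (\<open>ample_remove\<close>), and this drives the induction.\<close>

definition ample :: "('c \<Rightarrow> 'b) \<Rightarrow> 'b set \<Rightarrow> ('b \<Rightarrow> 'i set) \<Rightarrow> 'c set \<Rightarrow> ('b \<Rightarrow> nat) \<Rightarrow> bool" where
  "ample \<kappa> B R S s \<longleftrightarrow> finite B \<and> finite S \<and>
     (\<forall>b\<in>B. finite (R b) \<and> s b \<le> card (R b) \<and> 2 * s b \<le> Suc (card (board \<kappa> S b)))"

lemma down_closed_rook: "down_closed (rook \<kappa> R S)"
  unfolding down_closed_def rook_def by blast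

lemma board_remove:
  assumes "finite S" "c \<in> board \<kappa> S b"
  shows "card (board \<kappa> (S - {c}) b) = card (board \<kappa> S b) - 1"
    and "b' \<noteq> b \<Longrightarrow> board \<kappa> (S - {c}) b' = board \<kappa> S b'"
proof -
  have "board \<kappa> (S - {c}) b = board \<kappa> S b - {c}" by (auto simp: board_def)
  then show "card (board \<kappa> (S - {c}) b) = card (board \<kappa> S b) - 1"
    using assms by (simp add: card_Diff_singleton)
  show "b' \<noteq> b \<Longrightarrow> board \<kappa> (S - {c}) b' = board \<kappa> S b'"
    using assms by (auto simp: board_def)
qed

lemma finite_board: "finite S \<Longrightarrow> finite (board \<kappa> S b)"
  by (simp add: board_def)

lemma ample_remove:
  assumes "ample \<kappa> B R S s" "b \<in> B" "s b > 0" "\<rho> \<in> R b" "c \<in> board \<kappa> S b"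
  shows "ample \<kappa> B (R(b := R b - {\<rho>})) (S - {c}) (s(b := s b - 1))"
  unfolding ample_def
proof (intro conjI ballI)
  fix b' assume b': "b' \<in> B"
  have fin: "finite S" and am: "finite (R b') \<and> s b' \<le> card (R b') \<and> 2 * s b' \<le> Suc (card (board \<kappa> S b'))"
    using assms(1) b' by (auto simp: ample_def)
  have pos: "card (board \<kappa> S b) > 0"
    using assms(5) finite_board [OF fin] by (auto simp: card_gt_0_iff)
  show "finite ((R(b := R b - {\<rho>})) b')" using am by auto
  show "(s(b := s b - 1)) b' \<le> card ((R(b := R b - {\<rho>})) b')"
    using am assms(4) by (auto simp: card_Diff_singleton)
  show "2 * (s(b := s b - 1)) b' \<le> Suc (card (board \<kappa> (S - {c}) b'))"
    using am board_remove [OF fin assms(5)] assms(3) pos by (cases "b' = b") auto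
qed (use assms in \<open>auto simp: ample_def\<close>)

lemma sum_decrement:
  fixes s :: "'b \<Rightarrow> nat"
  assumes "finite B" "b \<in> B" "s b > 0"
  shows "sum (s(b := s b - 1)) B = sum s B - 1"
proof -
  have "sum s B = s b + sum s (B - {b})" by (rule sum.remove) (use assms in auto)
  moreover have "sum (s(b := s b - 1)) B = (s(b := s b - 1)) b + sum (s(b := s b - 1)) (B - {b})"
    by (rule sum.remove) (use assms in auto)
  moreover have "sum (s(b := s b - 1)) (B - {b}) = sum s (B - {b})" by (rule sum.cong) auto
  ultimately show ?thesis using assms(3) by simp
qed

lemma rook_missing_column: "{\<sigma> \<in> rook \<kappa> R S. c \<notin> snd ` \<sigma>} = rook \<kappa> R (S - {c})"
  by (auto simp: rook_def image_iff)

lemma rook_insert: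
  "insert (\<rho>, c) \<sigma> \<in> rook \<kappa> R S \<longleftrightarrow> c \<in> S \<and> \<rho> \<in> R (\<kappa> c) \<and> \<sigma> \<in> rook \<kappa> R S \<and>
     (\<forall>p\<in>\<sigma>. snd p = c \<or> fst p = \<rho> \<and> \<kappa> (snd p) = \<kappa> c \<longrightarrow> p = (\<rho>, c))"
  unfolding rook_def by auto

lemma rook_remove_row:
  "\<sigma> \<in> rook \<kappa> (R(b := R b - {\<rho>})) S \<longleftrightarrow> \<sigma> \<in> rook \<kappa> R S \<and> (\<forall>p\<in>\<sigma>. \<kappa> (snd p) = b \<longrightarrow> fst p \<noteq> \<rho>)"
  unfolding rook_def by (auto split: if_splits)

lemma rook_mono_columns: "\<sigma> \<in> rook \<kappa> R (S - {c}) \<longleftrightarrow> \<sigma> \<in> rook \<kappa> R S \<and> (\<forall>p\<in>\<sigma>. snd p \<noteq> c)"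
  unfolding rook_def by auto

lemma acyc_Mayer_Vietoris_Suc:
  assumes "down_closed P1" "down_closed P2" "acyc P1 (Suc n)" "acyc P2 (Suc n)" "P1 \<inter> P2 = Q" "acyc Q n"
  shows "acyc (P1 \<union> P2) (Suc n)"
  by (rule acyc_Mayer_Vietoris) (use assms in simp_all)

text \<open>Fix a row \<open>\<rho>\<close> of a board with \<open>s b > 0\<close> and glue the
  stars of its squares one after another. If the board has more than \<open>s b\<close> rows, start
  from the placements that leave row \<open>\<rho>\<close> empty, which an inner induction on the
  number of rows handles. If it has exactly \<open>s b\<close> rows, the stars alone cover
  everything, and a new star meets the earlier ones in placements that miss some column of a set
  \<open>T\<close>. The second claim deals with these intersections; its stronger bound on the
  columns leaves room to delete one more column.\<close>

lemma acyc_rook_aux: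
  "(\<forall>(R :: 'b \<Rightarrow> 'i set) S s. ample \<kappa> B R S s \<longrightarrow> sum s B = n \<longrightarrow> acyc (rook \<kappa> R S) n) \<and>
   (\<forall>(R :: 'b \<Rightarrow> 'i set) S s b T. ample \<kappa> B R S s \<longrightarrow> sum s B = n \<longrightarrow> b \<in> B \<longrightarrow>
      2 * s b \<le> card (board \<kappa> S b) \<longrightarrow> T \<subseteq> board \<kappa> S b \<longrightarrow> T \<noteq> {} \<longrightarrow>
      acyc {\<sigma> \<in> rook \<kappa> R S. \<not> T \<subseteq> snd ` \<sigma>} n)"
proof (induction n)
  case 0
  then show ?case by simp
next
  case (Suc n)
  have IHA: "acyc (rook \<kappa> R S) n" if "ample \<kappa> B R S s" "sum s B = n" for R :: "'b \<Rightarrow> 'i set" and S s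
    using Suc.IH that by blast
  have IHB: "acyc {\<sigma> \<in> rook \<kappa> R S. \<not> T \<subseteq> snd ` \<sigma>} n"
    if "ample \<kappa> B R S s" "sum s B = n" "b \<in> B" "2 * s b \<le> card (board \<kappa> S b)" "T \<subseteq> board \<kappa> S b" "T \<noteq> {}"
    for R :: "'b \<Rightarrow> 'i set" and S s b T
    using Suc.IH that by blast
  have A: "acyc (rook \<kappa> R S) (Suc n)" if "ample \<kappa> B R S s" "sum s B = Suc n" for R :: "'b \<Rightarrow> 'i set" and S s
    using that
  proof (induction "\<Sum>b\<in>B. card (R b)" arbitrary: R rule: less_induct)
    case less
    have fin: "finite B" "finite S" "\<And>b. b \<in> B \<Longrightarrow> finite (R b)"
      using less.prems by (auto simp: ample_def)
    have "\<exists>b\<in>B. s b > 0"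
    proof (rule ccontr)
      assume "\<not> (\<exists>b\<in>B. s b > 0)"
      then have "sum s B = 0" by (intro sum.neutral) simp
      then show False using less.prems(2) by simp
    qed
    then obtain b where b: "b \<in> B" "s b > 0" by blast
    have am: "s b \<le> card (R b)" "2 * s b \<le> Suc (card (board \<kappa> S b))"
      using less.prems b by (auto simp: ample_def)
    then obtain \<rho> where \<rho>: "\<rho> \<in> R b"
      using b by (cases "R b = {}") auto
    have card_R': "card (R b - {\<rho>}) = card (R b) - 1" "card (R b) > 0"
      using \<rho> am b by (auto simp: card_Diff_singleton)
    \<comment> \<open>Only board \<open>b\<close> loses the row, which is why the rows in
      \<open>rook\<close> may differ from board to board.\<close>
    define R' where "R' = R(b := R b - {\<rho>})"
    define star where "star c = {\<sigma>. insert (\<rho>, c) \<sigma> \<in> rook \<kappa> R S}" for c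
    have dc_star: "down_closed (star c)" for c
      using down_closedD [OF down_closed_rook] unfolding star_def down_closed_def
      by (metis (mono_tags, lifting) insert_mono mem_Collect_eq)
    have dc_Union: "down_closed (\<Union>(star ` T))" for T
      using dc_star unfolding down_closed_def by blast
    have acyc_star: "acyc (star c) m" for c m
      by (rule acyc_cone [of _ "(\<rho>, c)"]) (simp add: star_def)
    have star_rook: "star c \<subseteq> rook \<kappa> R S" for c
      by (auto simp: star_def rook_insert)
    \<comment> \<open>This is the link of the square \<open>(\<rho>, c)\<close>: its row and its
      column are free.\<close>
    have star_inter: "\<sigma> \<in> star c \<and> \<sigma> \<in> rook \<kappa> R' S \<longleftrightarrow> \<sigma> \<in> rook \<kappa> R' (S - {c})" if "c \<in> board \<kappa> S b" for c \<sigma>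
      using that \<rho> unfolding star_def R'_def rook_remove_row rook_mono_columns mem_Collect_eq rook_insert
      by (fastforce simp: board_def)
    \<comment> \<open>A placement compatible with two different squares of row \<open>\<rho>\<close>
      cannot itself use that row on board \<open>b\<close>.\<close>
    have star_star: "\<sigma> \<in> rook \<kappa> R' S" if "\<sigma> \<in> star c" "\<sigma> \<in> star c'" "c \<noteq> c'"
      "c \<in> board \<kappa> S b" "c' \<in> board \<kappa> S b" for \<sigma> c c'
      using that unfolding star_def R'_def rook_remove_row mem_Collect_eq rook_insert
      by (fastforce simp: board_def)
    have cover: "\<exists>c\<in>board \<kappa> S b. \<sigma> \<in> star c" if \<sigma>: "\<sigma> \<in> rook \<kappa> R S" "\<sigma> \<notin> rook \<kappa> R' S" for \<sigma>
    proof -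
      obtain p where p: "p \<in> \<sigma>" "\<kappa> (snd p) = b" "fst p = \<rho>"
        using \<sigma> unfolding R'_def rook_remove_row by blast
      then have "insert (\<rho>, snd p) \<sigma> = \<sigma>" by (metis insert_absorb prod.collapse)
      moreover have "snd p \<in> board \<kappa> S b" using p \<sigma> by (auto simp: rook_def board_def)
      ultimately show ?thesis using \<sigma>(1) unfolding star_def by (metis mem_Collect_eq)
    qed
    have link: "acyc (rook \<kappa> R' (S - {c})) n" if "c \<in> board \<kappa> S b" for c
      unfolding R'_def
      by (rule IHA [OF ample_remove [OF less.prems(1) b \<rho> that]])
        (use sum_decrement [of B b s] fin(1) b less.prems in simp)
    show ?case
    proof (cases "card (R b) = s b")
      case False
      have "acyc (rook \<kappa> R' S) (Suc n)"
      proof (rule less.hyps)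
        show "(\<Sum>b\<in>B. card (R' b)) < (\<Sum>b\<in>B. card (R b))"
          by (rule sum_strict_mono_ex1) (use fin b card_R' in \<open>auto simp: R'_def intro!: bexI [of _ b]\<close>)
        show "ample \<kappa> B R' S s"
          using less.prems(1) False am card_R' unfolding ample_def R'_def by auto
      qed (use less.prems in auto)
      have fam: "acyc (rook \<kappa> R' S \<union> \<Union>(star ` T)) (Suc n)" if "finite T" "T \<subseteq> board \<kappa> S b" for T
        using that
      proof (induction T rule: finite_induct)
        case empty
        then show ?case using \<open>acyc (rook \<kappa> R' S) (Suc n)\<close> by simp
      next
        case (insert c T)
        have c: "c \<in> board \<kappa> S b" using insert.prems by simp
        have inter: "star c \<inter> (rook \<kappa> R' S \<union> \<Union>(star ` T)) = rook \<kappa> R' (S - {c})"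
        proof (intro equalityI subsetI)
          fix \<sigma> assume \<sigma>: "\<sigma> \<in> star c \<inter> (rook \<kappa> R' S \<union> \<Union>(star ` T))"
          have "\<sigma> \<in> rook \<kappa> R' S"
          proof (cases "\<sigma> \<in> rook \<kappa> R' S")
            case False
            then obtain c' where c': "c' \<in> T" "\<sigma> \<in> star c'" using \<sigma> by blast
            then have "c \<noteq> c'" "c' \<in> board \<kappa> S b" using insert.hyps insert.prems by auto
            then show ?thesis using star_star c c' \<sigma> by blast
          qed
          then show "\<sigma> \<in> rook \<kappa> R' (S - {c})" using star_inter [OF c] \<sigma> by blast
        next
          fix \<sigma> assume "\<sigma> \<in> rook \<kappa> R' (S - {c})"
          then show "\<sigma> \<in> star c \<inter> (rook \<kappa> R' S \<union> \<Union>(star ` T))"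
            using star_inter [OF c] by blast
        qed
        have "down_closed (rook \<kappa> R' S \<union> \<Union>(star ` T))"
          using dc_Union [of T] down_closed_rook [of \<kappa> R' S] unfolding down_closed_def by (meson Un_iff)
        moreover have "acyc (rook \<kappa> R' S \<union> \<Union>(star ` T)) (Suc n)" "acyc (rook \<kappa> R' (S - {c})) n"
          using insert.IH insert.prems link [OF c] by auto
        ultimately have "acyc (star c \<union> (rook \<kappa> R' S \<union> \<Union>(star ` T))) (Suc n)"
          using acyc_Mayer_Vietoris_Suc [OF dc_star _ acyc_star _ inter] by metis
        moreover have "rook \<kappa> R' S \<union> \<Union>(star ` insert c T) = star c \<union> (rook \<kappa> R' S \<union> \<Union>(star ` T))"
          by auto
        ultimately show ?case by simp
      qed
      have "acyc (rook \<kappa> R' S \<union> \<Union>(star ` board \<kappa> S b)) (Suc n)"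
        by (rule fam [OF finite_board [OF fin(2)] subset_refl])
      moreover have "rook \<kappa> R' S \<union> \<Union>(star ` board \<kappa> S b) = rook \<kappa> R S"
      proof (intro equalityI subsetI)
        fix \<sigma> assume "\<sigma> \<in> rook \<kappa> R' S \<union> \<Union>(star ` board \<kappa> S b)"
        then show "\<sigma> \<in> rook \<kappa> R S"
          using star_rook rook_remove_row [of \<sigma> \<kappa> R b \<rho> S] unfolding R'_def by blast
      next
        fix \<sigma> assume "\<sigma> \<in> rook \<kappa> R S"
        then show "\<sigma> \<in> rook \<kappa> R' S \<union> \<Union>(star ` board \<kappa> S b)" using cover [of \<sigma>] by blast
      qed
      ultimately show ?thesis by simp
    next
      case True
      \<comment> \<open>Without row \<open>\<rho>\<close> at most \<open>s b - 1\<close> rooks stand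
        on the board, and it has at least \<open>2 * s b - 1\<close> columns, so some column stays
        free. Hence the stars cover these placements as well.\<close>
      have small: "\<not> board \<kappa> S b \<subseteq> snd ` \<sigma>" if "\<sigma> \<in> rook \<kappa> R' S" for \<sigma>
      proof
        assume sub: "board \<kappa> S b \<subseteq> snd ` \<sigma>"
        define \<tau> where "\<tau> = {p \<in> \<sigma>. \<kappa> (snd p) = b}"
        have "inj_on fst \<tau>" using that unfolding \<tau>_def inj_on_def rook_def by auto
        moreover have "fst ` \<tau> \<subseteq> R b - {\<rho>}" using that unfolding \<tau>_def rook_def R'_def by auto
        ultimately have "finite \<tau>" "card \<tau> \<le> card (R b) - 1"
          using fin(3) [OF b(1)] card_R'
          by (meson finite_Diff finite_imageD finite_subset, metis card_image card_mono finite_Diff)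
        moreover have "board \<kappa> S b \<subseteq> snd ` \<tau>" using sub unfolding \<tau>_def board_def by auto
        ultimately have "card (board \<kappa> S b) \<le> card (R b) - 1"
          by (meson card_image_le card_mono finite_imageI le_trans)
        then show False using True am b by linarith
      qed
      have fam: "acyc (\<Union>(star ` T)) (Suc n)" if "finite T" "T \<noteq> {}" "T \<subseteq> board \<kappa> S b" for T
        using that
      proof (induction T rule: finite_ne_induct)
        case (singleton c)
        then show ?case using acyc_star by simp
      next
        case (insert c T)
        have c: "c \<in> board \<kappa> S b" using insert by simp
        \<comment> \<open>Lying also in an earlier star means that some column of \<open>T\<close>
          is free for row \<open>\<rho>\<close>.\<close>
        have "\<sigma> \<in> star c \<inter> \<Union>(star ` T) \<longleftrightarrow> \<sigma> \<in> rook \<kappa> R' (S - {c}) \<and> \<not> T \<subseteq> snd ` \<sigma>" for \<sigma>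
        proof
          assume "\<sigma> \<in> star c \<inter> \<Union>(star ` T)"
          then obtain c' where c': "\<sigma> \<in> star c" "c' \<in> T" "\<sigma> \<in> star c'" by blast
          have *: "c' \<noteq> c" "c' \<in> board \<kappa> S b" using c' insert by auto
          then have R': "\<sigma> \<in> rook \<kappa> R' S" using star_star c' c by blast
          then have "\<sigma> \<in> rook \<kappa> R' (S - {c'})" using star_inter c' * by blast
          then have "c' \<notin> snd ` \<sigma>" unfolding rook_mono_columns by auto
          then show "\<sigma> \<in> rook \<kappa> R' (S - {c}) \<and> \<not> T \<subseteq> snd ` \<sigma>"
            using star_inter [OF c] c' R' by blast
        next
          assume a: "\<sigma> \<in> rook \<kappa> R' (S - {c}) \<and> \<not> T \<subseteq> snd ` \<sigma>"
          then obtain c' where c': "c' \<in> T" "c' \<notin> snd ` \<sigma>" by blast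
          have 1: "\<sigma> \<in> star c" "\<sigma> \<in> rook \<kappa> R' S" using star_inter [OF c] a by blast+
          then have "\<sigma> \<in> rook \<kappa> R' (S - {c'})" using c' unfolding rook_mono_columns by auto
          then have "\<sigma> \<in> star c'" using star_inter c' insert.prems by blast
          then show "\<sigma> \<in> star c \<inter> \<Union>(star ` T)" using 1 c' by blast
        qed
        then have inter: "star c \<inter> \<Union>(star ` T) = {\<sigma> \<in> rook \<kappa> R' (S - {c}). \<not> T \<subseteq> snd ` \<sigma>}" by blast
        have "acyc {\<sigma> \<in> rook \<kappa> R' (S - {c}). \<not> T \<subseteq> snd ` \<sigma>} n"
          unfolding R'_def
        proof (rule IHB [OF ample_remove [OF less.prems(1) b \<rho> c] _ b(1)])
          show "sum (s(b := s b - 1)) B = n"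
            using sum_decrement [of B b s] fin(1) b less.prems by simp
          show "2 * (s(b := s b - 1)) b \<le> card (board \<kappa> (S - {c}) b)"
            using am board_remove(1) [OF fin(2) c] by simp
          show "T \<subseteq> board \<kappa> (S - {c}) b"
            using insert unfolding board_def by auto
        qed (use insert in auto)
        moreover have "acyc (\<Union>(star ` T)) (Suc n)" using insert by simp
        ultimately have "acyc (star c \<union> \<Union>(star ` T)) (Suc n)"
          using acyc_Mayer_Vietoris_Suc [OF dc_star dc_Union acyc_star _ inter] by blast
        then show ?case by simp
      qed
      have "board \<kappa> S b \<noteq> {}" using am b by auto
      then have "acyc (\<Union>(star ` board \<kappa> S b)) (Suc n)"
        by (rule fam [OF finite_board [OF fin(2)] _ subset_refl])
      moreover have "\<Union>(star ` board \<kappa> S b) = rook \<kappa> R S"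
      proof
        show "\<Union>(star ` board \<kappa> S b) \<subseteq> rook \<kappa> R S" using star_rook by blast
        show "rook \<kappa> R S \<subseteq> \<Union>(star ` board \<kappa> S b)"
        proof
          fix \<sigma> assume \<sigma>: "\<sigma> \<in> rook \<kappa> R S"
          show "\<sigma> \<in> \<Union>(star ` board \<kappa> S b)"
          proof (cases "\<sigma> \<in> rook \<kappa> R' S")
            case True
            then obtain c where c: "c \<in> board \<kappa> S b" "c \<notin> snd ` \<sigma>" using small by blast
            then have "\<sigma> \<in> rook \<kappa> R' (S - {c})" using True unfolding rook_mono_columns by auto
            then show ?thesis using star_inter c by blast
          qed (use cover \<sigma> in blast)
        qed
      qed
      ultimately show ?thesis by simp
    qed
  qed
  \<comment> \<open>Enlarge \<open>T\<close> by one column \<open>c\<close> at a time. Missing a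
    column of \<open>insert c T\<close> means missing one of \<open>T\<close> or missing
    \<open>c\<close>; the overlap is the complex for \<open>T\<close> on the board without
    \<open>c\<close>. The extra column in the hypothesis pays for the removal of
    \<open>c\<close>.\<close>
  have B: "acyc {\<sigma> \<in> rook \<kappa> R S. \<not> T \<subseteq> snd ` \<sigma>} (Suc n)"
    if "ample \<kappa> B R S s" "sum s B = Suc n" "b \<in> B" "2 * s b \<le> card (board \<kappa> S b)" "T \<subseteq> board \<kappa> S b" "T \<noteq> {}"
    for R :: "'b \<Rightarrow> 'i set" and S s b T
  proof -
    have "finite T" using that finite_board unfolding ample_def by (metis finite_subset)
    then show ?thesis
      using that(6) that(1-5)
    proof (induction T arbitrary: S rule: finite_ne_induct)
      case (singleton c)
      then have fin: "finite S" and c: "c \<in> board \<kappa> S b" by (auto simp: ample_def)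
      have "ample \<kappa> B R (S - {c}) s"
        unfolding ample_def
      proof (intro conjI ballI)
        fix b' assume b': "b' \<in> B"
        show "2 * s b' \<le> Suc (card (board \<kappa> (S - {c}) b'))"
          using singleton b' board_remove [OF fin c] by (cases "b' = b") (auto simp: ample_def)
      qed (use singleton in \<open>auto simp: ample_def\<close>)
      then show ?case using A singleton by (simp add: rook_missing_column)
    next
      case (insert c T)
      then have fin: "finite S" "finite B" and c: "c \<in> board \<kappa> S b" by (auto simp: ample_def)
      have cardb: "card (board \<kappa> (S - {c}) b) = card (board \<kappa> S b) - 1"
        using board_remove [OF fin(1) c] by simp
      have T': "T \<subseteq> board \<kappa> (S - {c}) b" using insert unfolding board_def by auto
      let ?P = "{\<sigma> \<in> rook \<kappa> R S. \<not> T \<subseteq> snd ` \<sigma>}"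
      have un: "{\<sigma> \<in> rook \<kappa> R S. \<not> insert c T \<subseteq> snd ` \<sigma>} = ?P \<union> {\<sigma> \<in> rook \<kappa> R S. \<not> {c} \<subseteq> snd ` \<sigma>}"
        by auto
      have inter: "?P \<inter> {\<sigma> \<in> rook \<kappa> R S. \<not> {c} \<subseteq> snd ` \<sigma>} = {\<sigma> \<in> rook \<kappa> R (S - {c}). \<not> T \<subseteq> snd ` \<sigma>}"
        using rook_missing_column [of \<kappa> R S c] by blast
      have am: "ample \<kappa> B R (S - {c}) s"
        unfolding ample_def
      proof (intro conjI ballI)
        fix b' assume b': "b' \<in> B"
        show "2 * s b' \<le> Suc (card (board \<kappa> (S - {c}) b'))"
          using insert.prems b' board_remove [OF fin(1) c] by (cases "b' = b") (auto simp: ample_def)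
      qed (use insert.prems in \<open>auto simp: ample_def\<close>)
      have "acyc (?P \<inter> {\<sigma> \<in> rook \<kappa> R S. \<not> {c} \<subseteq> snd ` \<sigma>}) n"
      proof (cases "s b = 0")
        case True
        \<comment> \<open>Here \<open>s b\<close> cannot be lowered, but with \<open>s b = 0\<close>
          the board may lose columns freely, so the induction on \<open>T\<close> applies to
          \<open>S - {c}\<close>.\<close>
        have "acyc {\<sigma> \<in> rook \<kappa> R (S - {c}). \<not> T \<subseteq> snd ` \<sigma>} (Suc n)"
          by (rule insert.IH) (use am True T' insert.prems in auto)
        then show ?thesis unfolding inter by (rule acyc_mono) simp
      next
        case False
        have "acyc {\<sigma> \<in> rook \<kappa> R (S - {c}). \<not> T \<subseteq> snd ` \<sigma>} n"
        proof (rule IHB [where s = "s(b := s b - 1)" and b = b])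
          have "s b - 1 \<le> m" if "s b \<le> m" for m using that by simp
          then show "ample \<kappa> B R (S - {c}) (s(b := s b - 1))"
            using am unfolding ample_def by fastforce
          show "sum (s(b := s b - 1)) B = n"
            using sum_decrement [of B b s] fin False insert.prems by simp
          show "2 * (s(b := s b - 1)) b \<le> card (board \<kappa> (S - {c}) b)"
            using cardb insert.prems False by simp
        qed (use T' insert in auto)
        then show ?thesis unfolding inter .
      qed
      moreover have "acyc ?P (Suc n)" by (rule insert.IH) (use insert.prems in auto)
      moreover have "acyc {\<sigma> \<in> rook \<kappa> R S. \<not> {c} \<subseteq> snd ` \<sigma>} (Suc n)"
        using A [OF am] insert.prems by (simp add: rook_missing_column)
      moreover have dc: "down_closed {\<sigma> \<in> rook \<kappa> R S. \<not> U \<subseteq> snd ` \<sigma>}" for U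
        unfolding down_closed_def
      proof (intro ballI allI impI)
        fix A C assume A: "A \<in> {\<sigma> \<in> rook \<kappa> R S. \<not> U \<subseteq> snd ` \<sigma>}" "C \<subseteq> A"
        then have "C \<in> rook \<kappa> R S" using down_closedD [OF down_closed_rook] by blast
        then show "C \<in> {\<sigma> \<in> rook \<kappa> R S. \<not> U \<subseteq> snd ` \<sigma>}" using A by blast
      qed
      ultimately show ?case unfolding un by (intro acyc_Mayer_Vietoris_Suc [OF dc dc _ _ refl])
    qed
  qed
  show ?case using A B by blast
qed

lemma acyc_rook:
  assumes "ample \<kappa> B R S s"
  shows "acyc (rook \<kappa> R S) (sum s B)"
  using acyc_rook_aux assms by blast

section \<open>Equivariant chain maps on free complexes\<close>

definition lmap :: "('a \<Rightarrow> 'b) \<Rightarrow> ('a list \<Rightarrow>\<^sub>0 int) \<Rightarrow> ('b list \<Rightarrow>\<^sub>0 int)" where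
  "lmap f = frag_extend (\<lambda>w. frag_of (map f w))"

lemma lmap_simps [simp]:
  "lmap f 0 = 0" "lmap f (frag_of w) = frag_of (map f w)"
  "lmap f (a - b) = lmap f a - lmap f b" "lmap f (a + b) = lmap f a + lmap f b"
  "lmap f (- a) = - lmap f a" "lmap f (frag_cmul k a) = frag_cmul k (lmap f a)"
  by (auto simp: lmap_def frag_extend_diff frag_extend_add frag_extend_minus frag_extend_cmul)

lemma lmap_cone: "lmap f (cone v c) = cone (f v) (lmap f c)"
  by (rule frag_induction [of c UNIV]) auto

lemma bdl_map: "bdl (map f w) = lmap f (bdl w)"
  by (induction w) (auto simp: lmap_cone)

lemma bd_lmap: "bd (lmap f c) = lmap f (bd c)"
  by (rule frag_induction [of c UNIV]) (auto simp: bdl_map)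

lemma keys_lmap: "Poly_Mapping.keys (lmap f c) \<subseteq> map f ` Poly_Mapping.keys c"
  unfolding lmap_def by (rule keys_frag_extend_subset) auto

lemma lmap_cong_id:
  assumes "\<And>w. w \<in> Poly_Mapping.keys c \<Longrightarrow> map f w = w" shows "lmap f c = c"
  unfolding lmap_def by (subst (2) frag_expansion) (rule frag_extend_eq, simp add: assms)

lemma frag_extend_lmap: "frag_extend h (lmap f c) = frag_extend (\<lambda>w. h (map f w)) c"
  by (simp add: lmap_def frag_extend_extend)

lemma lmap_frag_extend: "lmap f (frag_extend h c) = frag_extend (\<lambda>w. lmap f (h w)) c"
  by (simp add: lmap_def frag_extend_extend)

lemma lmap_lmap: "lmap f (lmap g c) = lmap (f \<circ> g) c"
  by (simp add: lmap_def frag_extend_extend)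

lemma keys_lmap_simps:
  assumes "\<And>A. A \<in> P \<Longrightarrow> f ` A \<in> Q" "Poly_Mapping.keys c \<subseteq> simps P n"
  shows "Poly_Mapping.keys (lmap f c) \<subseteq> simps Q n"
  using keys_lmap [of f c] assms by (fastforce simp: simps_def)

text \<open>A free orbit contains exactly one element with \<open>\<rho> s = 0\<close>; choose there and transport.\<close>

lemma equivariant_choice:
  fixes a :: "'s \<Rightarrow> 's" and b :: "'x \<Rightarrow> 'x" and \<rho> :: "'s \<Rightarrow> nat"
  assumes "r > 0"
    and S: "\<And>s. s \<in> S \<Longrightarrow> a s \<in> S \<and> \<rho> s < r \<and> \<rho> (a s) = Suc (\<rho> s) mod r \<and> (a ^^ r) s = s"
    and E: "\<And>s. s \<in> S \<Longrightarrow> \<exists>x. R s x"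
    and R: "\<And>s x. s \<in> S \<Longrightarrow> R s x \<Longrightarrow> R (a s) (b x) \<and> (b ^^ r) x = x"
  shows "\<exists>h. \<forall>s\<in>S. R s (h s) \<and> h (a s) = b (h s)"
proof -
  obtain H where H: "\<And>s. s \<in> S \<Longrightarrow> R s (H s)" using E by metis
  \<comment> \<open>Advancing \<open>s\<close> by \<open>r - \<rho> s\<close> steps reaches the
    representative of its orbit, after a full turn if \<open>\<rho> s = 0\<close>;
    \<open>b ^^ \<rho> s\<close> transports the value chosen there to \<open>s\<close>.\<close>
  define h where "h s = (b ^^ \<rho> s) (H ((a ^^ (r - \<rho> s)) s))" for s
  have pow: "(a ^^ n) s \<in> S \<and> (R s x \<longrightarrow> R ((a ^^ n) s) ((b ^^ n) x))" if "s \<in> S" for n s x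
    using that S R by (induction n) auto
  have "R s (h s) \<and> h (a s) = b (h s)" if s: "s \<in> S" for s
  proof
    let ?u = "(a ^^ (r - \<rho> s)) s"
    have "R ((a ^^ \<rho> s) ?u) ((b ^^ \<rho> s) (H ?u))" using pow H s by blast
    moreover have "(a ^^ \<rho> s) ?u = s"
      using S [OF s] by (metis comp_apply funpow_add le_add_diff_inverse less_imp_le)
    ultimately show "R s (h s)" by (simp add: h_def)
    show "h (a s) = b (h s)"
    proof (cases "Suc (\<rho> s) < r")
      case True
      then have "(a ^^ (r - Suc (\<rho> s))) (a s) = ?u"
        by (metis Suc_diff_Suc S s comp_apply funpow_Suc_right)
      then show ?thesis using True S [OF s] by (simp add: h_def)
    next
      case False
      then have r: "Suc (\<rho> s) = r" using S [OF s] by linarith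
      then have u: "?u = a s" by (metis Suc_diff_Suc S s cancel_comm_monoid_add_class.diff_cancel diff_Suc_1 funpow_0 funpow_simps_right(2) comp_apply r)
      have "\<rho> (a s) = 0" using S [OF s] r by simp
      then have "h (a s) = H ((a ^^ r) (a s))" by (simp add: h_def)
      also have "\<dots> = H (a s)" using S s by metis
      \<comment> \<open>The orbit closes up at the last label, and the transported value returns to
        the chosen one only because \<open>b ^^ r\<close> fixes admissible values.\<close>
      also have "\<dots> = (b ^^ r) (H (a s))" using H R S s by metis
      also have "\<dots> = b (h s)" unfolding h_def u using r by (metis comp_apply funpow.simps(2))
      finally show ?thesis .
    qed
  qed
  then show ?thesis by blast
qed

text \<open>With \<open>\<alpha> = 0\<close>, \<open>e = 0\<close>, \<open>k = 1\<close> the result is a chain map; with \<open>\<alpha>\<close> the difference of two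
  chain maps, \<open>e = 1\<close>, \<open>k = -1\<close> it is a chain homotopy between them.\<close>

lemma equivariant_extension:
  fixes S :: "'a list set" and t :: "'a \<Rightarrow> 'a" and T :: "'b \<Rightarrow> 'b" and \<rho> :: "'a \<Rightarrow> nat"
  assumes "r > 0"
    and S: "\<And>u. u \<in> S \<Longrightarrow> map t u \<in> S \<and> Poly_Mapping.keys (bdl u) \<subseteq> S"
    and t: "\<And>u v. u \<in> S \<Longrightarrow> v \<in> set u \<Longrightarrow> \<rho> v < r \<and> \<rho> (t v) = Suc (\<rho> v) mod r \<and> (t ^^ r) v = v"
    and P: "down_closed P" "\<And>A. A \<in> P \<Longrightarrow> T ` A \<in> P" "\<And>A v. A \<in> P \<Longrightarrow> v \<in> A \<Longrightarrow> (T ^^ r) v = v"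
    and acyc: "acyc P m"
    and k: "k * k = (1::int)"
    and \<alpha>: "\<And>u. u \<in> S \<Longrightarrow> u \<noteq> [] \<Longrightarrow> Poly_Mapping.keys (\<alpha> u) \<subseteq> simps P (length u + e - 1) \<and>
        \<alpha> (map t u) = lmap T (\<alpha> u) \<and> bd (\<alpha> u) = frag_cmul (- k) (frag_extend \<alpha> (bdl u))"
    and x0: "Poly_Mapping.keys x0 \<subseteq> simps P e" "bd x0 = \<alpha> []" "lmap T x0 = x0"
    and n: "n + e \<le> m"
  shows "\<exists>h. h [] = x0 \<and> (\<forall>u\<in>S. length u \<le> n \<longrightarrow> Poly_Mapping.keys (h u) \<subseteq> simps P (length u + e) \<and>
     h (map t u) = lmap T (h u) \<and> bd (h u) = \<alpha> u + frag_cmul k (frag_extend h (bdl u)))"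
  using n
proof (induction n)
  case 0
  show ?case by (rule exI [of _ "\<lambda>_. x0"]) (use x0 in simp)
next
  case (Suc n)
  then obtain h where h0: "h [] = x0"
    and h: "\<And>u. u \<in> S \<Longrightarrow> length u \<le> n \<Longrightarrow> Poly_Mapping.keys (h u) \<subseteq> simps P (length u + e) \<and>
     h (map t u) = lmap T (h u) \<and> bd (h u) = \<alpha> u + frag_cmul k (frag_extend h (bdl u))"
    by auto
  define S' where "S' = {u \<in> S. length u = Suc n}"
  \<comment> \<open>The boundary prescribed for \<open>h u\<close>. The induction hypothesis
    together with \<open>k * k = 1\<close> makes it a cycle, so acyclicity of \<open>P\<close>
    provides a filling.\<close>
  define \<beta> where "\<beta> u = \<alpha> u + frag_cmul k (frag_extend h (bdl u))" for u
  have sub: "v \<in> S" "length v = n" if "u \<in> S'" "v \<in> Poly_Mapping.keys (bdl u)" for u v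
    using that S keys_bdl_length unfolding S'_def by fastforce+
  define R where "R u x \<longleftrightarrow> Poly_Mapping.keys x \<subseteq> simps P (Suc n + e) \<and> bd x = \<beta> u" for u x
  have \<beta>: "Poly_Mapping.keys (\<beta> u) \<subseteq> simps P (n + e)" "bd (\<beta> u) = 0" "\<beta> (map t u) = lmap T (\<beta> u)"
    if u: "u \<in> S'" for u
  proof -
    have u': "u \<in> S" "u \<noteq> []" "length u = Suc n" using u by (auto simp: S'_def)
    have "Poly_Mapping.keys (frag_extend h (bdl u)) \<subseteq> simps P (n + e)"
      by (rule keys_frag_extend_subset) (use sub [OF u] h in auto)
    then have "Poly_Mapping.keys (frag_cmul k (frag_extend h (bdl u))) \<subseteq> simps P (n + e)"
      using keys_cmul by blast
    then show "Poly_Mapping.keys (\<beta> u) \<subseteq> simps P (n + e)"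
      unfolding \<beta>_def using \<alpha> [OF u'(1,2)] u'(3) by (intro keys_add_subset) auto
    have "bd (frag_extend h (bdl u)) = frag_extend (\<lambda>v. bd (h v)) (bdl u)"
      by (simp add: bd_def frag_extend_extend)
    also have "\<dots> = frag_extend (\<lambda>v. \<alpha> v + frag_cmul k (frag_extend h (bdl v))) (bdl u)"
      by (rule frag_extend_eq) (use h sub [OF u] in auto)
    also have "\<dots> = frag_extend \<alpha> (bdl u) + frag_cmul k (frag_extend h (bd (bdl u)))"
      by (simp add: frag_extend_fun_add frag_extend_fun_cmul bd_def frag_extend_extend)
    finally show "bd (\<beta> u) = 0"
      using \<alpha> [OF u'(1,2)] by (simp add: \<beta>_def flip: minus_frag_cmul)
    have "frag_extend h (bdl (map t u)) = frag_extend (\<lambda>v. lmap T (h v)) (bdl u)"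
      unfolding bdl_map frag_extend_lmap by (rule frag_extend_eq) (use h sub [OF u] in auto)
    then show "\<beta> (map t u) = lmap T (\<beta> u)"
      using \<alpha> [OF u'(1,2)] by (simp add: \<beta>_def lmap_frag_extend)
  qed
  have pow_t: "(map t ^^ i) u = map (t ^^ i) u" for i u
    by (induction i) auto
  have pow_T: "(lmap T ^^ i) x = lmap (T ^^ i) x" for i x
    by (induction i) (auto simp: lmap_lmap o_def intro: lmap_cong_id [symmetric])
  have "\<exists>g. \<forall>u\<in>S'. R u (g u) \<and> g (map t u) = lmap T (g u)"
  \<comment> \<open>The action on nonempty lists is free, as the label of the first entry shows. The
    empty list is fixed, which is why \<open>x0\<close> had to be given and invariant.\<close>
  proof (rule equivariant_choice [where r = r and \<rho> = "\<lambda>u. \<rho> (hd u)"])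
    fix u assume u: "u \<in> S'"
    then have "u \<in> S" "u \<noteq> []" by (auto simp: S'_def)
    then have u': "u \<in> S" "hd u \<in> set u" "u \<noteq> []" by auto
    have "(map t ^^ r) u = u" unfolding pow_t using t [OF u'(1)] by (intro map_idI) auto
    then show "map t u \<in> S' \<and> \<rho> (hd u) < r \<and> \<rho> (hd (map t u)) = Suc (\<rho> (hd u)) mod r \<and> (map t ^^ r) u = u"
      using u S t [OF u'(1,2)] u' by (auto simp: S'_def hd_map)
    have "n + e < m" using Suc.prems by simp
    then show "\<exists>x. R u x"
      unfolding R_def using acycD [OF acyc _ \<beta>(1,2) [OF u]] by (metis add_Suc)
    fix x assume x: "R u x"
    have "(lmap T ^^ r) x = x"
      unfolding pow_T
    proof (rule lmap_cong_id)
      fix w assume "w \<in> Poly_Mapping.keys x"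
      then have "set w \<in> P" using x by (auto simp: R_def simps_def)
      then show "map (T ^^ r) w = w" using P(3) by (intro map_idI) auto
    qed
    moreover have "Poly_Mapping.keys (lmap T x) \<subseteq> simps P (Suc n + e)"
      by (rule keys_lmap_simps [OF P(2)]) (use x in \<open>auto simp: R_def\<close>)
    ultimately show "R (map t u) (lmap T x) \<and> (lmap T ^^ r) x = x"
      using x \<beta>(3) [OF u] by (auto simp: R_def bd_lmap)
  qed (use \<open>r > 0\<close> in auto)
  then obtain g where g: "\<And>u. u \<in> S' \<Longrightarrow> R u (g u) \<and> g (map t u) = lmap T (g u)" by blast
  define h' where "h' u = (if length u = Suc n then g u else h u)" for u
  have h'_bd: "frag_extend h' (bdl u) = frag_extend h (bdl u)" if "length u \<le> Suc n" for u
    by (rule frag_extend_eq) (use that keys_bdl_length in \<open>force simp: h'_def\<close>)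
  show ?case
  proof (intro exI [of _ h'] conjI ballI impI)
    show "h' [] = x0" using h0 by (simp add: h'_def)
    fix u assume u: "u \<in> S" "length u \<le> Suc n"
    have *: "Poly_Mapping.keys (h' u) \<subseteq> simps P (length u + e) \<and> h' (map t u) = lmap T (h' u) \<and>
       bd (h' u) = \<alpha> u + frag_cmul k (frag_extend h (bdl u))"
    proof (cases "length u = Suc n")
      case True
      then show ?thesis using g [of u] u by (simp add: S'_def h'_def R_def \<beta>_def)
    next
      case False
      then show ?thesis using h [of u] u by (simp add: h'_def)
    qed
    then show "Poly_Mapping.keys (h' u) \<subseteq> simps P (length u + e)" "h' (map t u) = lmap T (h' u)"
      "bd (h' u) = \<alpha> u + frag_cmul k (frag_extend h' (bdl u))"
      using h'_bd u by auto
  qed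
qed

section \<open>Orientations\<close>

text \<open>Integers are treated as chains on a single generator, so that linearity is inherited
  from \<open>frag_extend\<close>.\<close>

definition lin :: "('a \<Rightarrow> int) \<Rightarrow> ('a \<Rightarrow>\<^sub>0 int) \<Rightarrow> int" where
  "lin f c = Poly_Mapping.lookup (frag_extend (\<lambda>w. frag_cmul (f w) (frag_of ())) c) ()"

lemma lin_simps [simp]:
  "lin f 0 = 0" "lin f (frag_of w) = f w" "lin f (a - b) = lin f a - lin f b" "lin f (a + b) = lin f a + lin f b"
  "lin f (- a) = - lin f a" "lin f (frag_cmul k a) = k * lin f a"
  by (auto simp: lin_def frag_extend_diff frag_extend_add frag_extend_minus frag_extend_cmul
      lookup_minus lookup_add)

lemma lin_sum: "finite I \<Longrightarrow> lin f (sum g I) = (\<Sum>i\<in>I. lin f (g i))"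
  by (induction I rule: finite_induct) auto

lemma lin_frag_extend: "lin f (frag_extend g c) = lin (\<lambda>x. lin f (g x)) c"
  by (rule frag_induction [of c UNIV]) (auto simp: frag_extend_diff)

lemma lin_cong:
  assumes "\<And>w. w \<in> Poly_Mapping.keys c \<Longrightarrow> f w = g w" shows "lin f c = lin g c"
  unfolding lin_def by (subst frag_extend_eq [of c _ "\<lambda>w. frag_cmul (g w) (frag_of ())"]) (simp_all add: assms)

lemma lin_fun_cmul: "lin (\<lambda>w. k * f w) c = k * lin f c"
  by (rule frag_induction [of c UNIV]) (auto simp: algebra_simps)

lemma lin_fun_add: "lin (\<lambda>w. f w + g w) c = lin f c + lin g c"
  by (rule frag_induction [of c UNIV]) (auto simp: algebra_simps)

lemma lin_fun_zero [simp]: "lin (\<lambda>w. 0) c = 0"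
  by (rule frag_induction [of c UNIV]) auto

text \<open>The sign of moving \<open>v\<close> from the front to its sorted place among the
  elements of \<open>G\<close>.\<close>

definition order_sign :: "'a::linorder \<Rightarrow> 'a set \<Rightarrow> int" where
  "order_sign v G = (\<Prod>y\<in>G. if y < v then -1 else 1)"

text \<open>\<open>orient w G\<close> is the sign of the permutation sorting \<open>w\<close> if \<open>w\<close> enumerates \<open>G\<close> without
  repetition, and \<open>0\<close> otherwise.\<close>

primrec orient :: "'a::linorder list \<Rightarrow> 'a set \<Rightarrow> int" where
  "orient [] = (\<lambda>G. if G = {} then 1 else 0)"
| "orient (x # w) = (\<lambda>G. if x \<in> G then order_sign x (G - {x}) * orient w (G - {x}) else 0)"

lemma orient_nonzero: "orient w G \<noteq> 0 \<Longrightarrow> set w = G"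
  by (induction w arbitrary: G) (auto split: if_splits)

lemma order_sign_square: "order_sign v G * order_sign v G = 1"
  unfolding order_sign_def prod.distrib [symmetric] by (rule prod.neutral) auto

lemma order_sign_insert:
  "finite G \<Longrightarrow> v \<notin> G \<Longrightarrow> order_sign x (insert v G) = (if v < x then -1 else 1) * order_sign x G"
  by (simp add: order_sign_def)

lemma orient_square:
  "distinct w \<Longrightarrow> orient w (set w) * orient w (set w) = 1"
proof (induction w)
  case (Cons x w)
  then have "orient (x # w) (set (x # w)) = order_sign x (set w) * orient w (set w)" by simp
  moreover have "order_sign x (set w) * orient w (set w) * (order_sign x (set w) * orient w (set w))
      = (order_sign x (set w) * order_sign x (set w)) * (orient w (set w) * orient w (set w))"
    by (simp only: ac_simps)
  moreover have "\<dots> = 1" using Cons order_sign_square [of x "set w"] by simp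
  ultimately show ?case by metis
qed simp

lemma lin_orient_cone:
  "lin (\<lambda>w. orient w G) (cone x c) =
     (if x \<in> G then order_sign x (G - {x}) * lin (\<lambda>w. orient w (G - {x})) c else 0)"
  by (rule frag_induction [of c UNIV]) (auto simp: algebra_simps)

text \<open>Passing from lists to oriented simplices is a chain map.\<close>

lemma orient_bdl:
  assumes "finite V" "set xs \<subseteq> V" "G \<subseteq> V"
  shows "lin (\<lambda>w. orient w G) (bdl xs) = (\<Sum>v\<in>V - G. order_sign v G * orient xs (insert v G))"
  using assms
proof (induction xs arbitrary: G)
  case Nil
  then show ?case by simp
next
  case (Cons x xs)
  have fG: "finite G" using Cons.prems finite_subset by blast
  have x: "x \<in> V" using Cons.prems by simp
  show ?case
  proof (cases "x \<in> G")
    case False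
    have "(\<Sum>v\<in>V - G. order_sign v G * orient (x # xs) (insert v G))
        = (\<Sum>v\<in>{x}. order_sign v G * orient (x # xs) (insert v G))"
      by (rule sum.mono_neutral_right) (use Cons.prems False x in auto)
    also have "\<dots> = orient xs G"
      using False order_sign_square [of x G] by (simp flip: mult.assoc)
    finally show ?thesis using False by (simp add: lin_orient_cone)
  next
    case True
    define H where "H = G - {x}"
    have G: "G = insert x H" "x \<notin> H" "finite H" using True fG by (auto simp: H_def)
    have IH: "lin (\<lambda>w. orient w H) (bdl xs) = (\<Sum>v\<in>V - H. order_sign v H * orient xs (insert v H))"
      by (rule Cons.IH) (use Cons.prems in \<open>auto simp: H_def\<close>)
    have VH: "V - H = insert x (V - G)" using G x by auto
    have "order_sign x H * (\<Sum>v\<in>V - H. order_sign v H * orient xs (insert v H))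
       = orient xs G + order_sign x H * (\<Sum>v\<in>V - G. order_sign v H * orient xs (insert v H))"
      unfolding VH using Cons.prems G order_sign_square [of x H] by (simp add: distrib_left flip: mult.assoc)
    \<comment> \<open>Extracting \<open>v\<close> and \<open>x\<close> in the two possible orders
      differs by exactly one sign, since one of the two is smaller than the other.\<close>
    moreover have "order_sign v G * orient (x # xs) (insert v G) = - (order_sign x H * (order_sign v H * orient xs (insert v H)))"
      if v: "v \<in> V - G" for v
    proof -
      have "insert v G - {x} = insert v H" using G v by auto
      then have "orient (x # xs) (insert v G) = order_sign x (insert v H) * orient xs (insert v H)"
        using G by simp
      moreover have "order_sign x (insert v H) = (if v < x then -1 else 1) * order_sign x H"
        using G v by (intro order_sign_insert) auto
      moreover have "order_sign v G = (if x < v then -1 else 1) * order_sign v H"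
        using G by (simp add: order_sign_insert)
      ultimately show ?thesis using v True by (cases "v < x") auto
    qed
    ultimately show ?thesis
      using True IH by (simp add: lin_orient_cone sum_distrib_left sum_negf flip: H_def)
  qed
qed

text \<open>For injective \<open>f\<close> this is minus one to the number of inversions of
  \<open>f\<close> on \<open>G\<close>.\<close>

definition order_change :: "('a::linorder \<Rightarrow> 'b::linorder) \<Rightarrow> 'a set \<Rightarrow> int" where
  "order_change f G = (\<Prod>(a, b)\<in>{(a, b) \<in> G \<times> G. a < b}. if f a < f b then 1 else -1)"

lemma order_change_square: "order_change f G * order_change f G = 1"
  unfolding order_change_def prod.distrib [symmetric] by (rule prod.neutral) auto

lemma prod_split_at:
  fixes g :: "'a::linorder \<Rightarrow> int"
  assumes "finite H" "x \<notin> H"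
  shows "prod g H = prod g {y \<in> H. y < x} * prod g {y \<in> H. x < y}"
proof -
  have "H = {y \<in> H. y < x} \<union> {y \<in> H. x < y}"
  proof (rule Set.set_eqI)
    fix y show "y \<in> H \<longleftrightarrow> y \<in> {y \<in> H. y < x} \<union> {y \<in> H. x < y}"
      using assms(2) by (cases y x rule: linorder_cases) auto
  qed
  then have "prod g H = prod g ({y \<in> H. y < x} \<union> {y \<in> H. x < y})"
    by (rule arg_cong [where f = "prod g"])
  also have "\<dots> = prod g {y \<in> H. y < x} * prod g {y \<in> H. x < y}"
  proof (rule prod.union_disjoint)
    show "{y \<in> H. y < x} \<inter> {y \<in> H. x < y} = {}"
      by (simp add: disjoint_iff less_not_sym)
  qed (simp_all add: assms(1))
  finally show ?thesis .
qed
text \<open>The new pairs are those containing \<open>x\<close>. Such a pair is inverted exactly if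
  its other element changes sides relative to \<open>x\<close>, and comparing the two order signs
  counts these changes.\<close>

lemma order_change_insert:
  assumes "finite H" "x \<notin> H" "inj f"
  shows "order_change f (insert x H) * order_sign x H = order_change f H * order_sign (f x) (f ` H)"
proof -
  let ?E = "\<lambda>(a, b). if f a < f b then 1 else (-1::int)"
  let ?L = "{y \<in> H. y < x}" and ?U = "{y \<in> H. x < y}"
  have "{(a, b) \<in> insert x H \<times> insert x H. a < b}
      = {(a, b) \<in> H \<times> H. a < b} \<union> ((\<lambda>y. (y, x)) ` ?L \<union> Pair x ` ?U)"
    using assms(2) by auto
  moreover have "prod ?E ({(a, b) \<in> H \<times> H. a < b} \<union> ((\<lambda>y. (y, x)) ` ?L \<union> Pair x ` ?U))
      = prod ?E {(a, b) \<in> H \<times> H. a < b} * prod ?E ((\<lambda>y. (y, x)) ` ?L \<union> Pair x ` ?U)"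
    by (rule prod.union_disjoint)
      (use assms in \<open>auto intro: finite_subset [of _ "H \<times> H"]\<close>)
  moreover have "prod ?E ((\<lambda>y. (y, x)) ` ?L \<union> Pair x ` ?U)
      = prod ?E ((\<lambda>y. (y, x)) ` ?L) * prod ?E (Pair x ` ?U)"
    by (rule prod.union_disjoint) (use assms in auto)
  moreover have "prod ?E ((\<lambda>y. (y, x)) ` ?L) = (\<Prod>y\<in>?L. if f y < f x then 1 else -1)"
    by (subst prod.reindex) (auto simp: inj_on_def)
  moreover have "prod ?E (Pair x ` ?U) = (\<Prod>y\<in>?U. if f x < f y then 1 else -1)"
    by (subst prod.reindex) (auto simp: inj_on_def)
  ultimately have 1: "order_change f (insert x H) = order_change f H *
     ((\<Prod>y\<in>?L. if f y < f x then 1 else -1) * (\<Prod>y\<in>?U. if f x < f y then 1 else -1))"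
    by (simp add: order_change_def)
  note split = prod_split_at [OF assms(1,2)]
  have "(\<Prod>y\<in>?L. if y < x then -1 else (1::int)) = (\<Prod>y\<in>?L. -1)"
    "(\<Prod>y\<in>?U. if y < x then -1 else (1::int)) = 1"
    by (rule prod.cong; auto) (rule prod.neutral; auto)
  then have 2: "order_sign x H = (\<Prod>y\<in>?L. -1)"
    unfolding order_sign_def split [of "\<lambda>y. if y < x then -1 else 1"] by simp
  have 3: "order_sign (f x) (f ` H) = (\<Prod>y\<in>H. if f y < f x then -1 else 1)"
    unfolding order_sign_def by (subst prod.reindex) (use assms in \<open>auto simp: inj_on_def\<close>)
  have 4: "(\<Prod>y\<in>?L. if f y < f x then 1 else (-1::int)) * (\<Prod>y\<in>?L. -1) = (\<Prod>y\<in>?L. if f y < f x then -1 else 1)"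
    unfolding prod.distrib [symmetric] by (rule prod.cong) auto
  have 5: "(\<Prod>y\<in>?U. if f x < f y then 1 else (-1::int)) = (\<Prod>y\<in>?U. if f y < f x then -1 else 1)"
  proof (rule prod.cong [OF refl])
    fix y assume "y \<in> ?U"
    then have "f x \<noteq> f y" using assms(3) by (auto dest: injD)
    then show "(if f x < f y then 1 else (-1::int)) = (if f y < f x then -1 else 1)" by auto
  qed
  show ?thesis
    unfolding 1 2 3 5 split [of "\<lambda>y. if f y < f x then -1 else 1"] 4 [symmetric] by (simp only: ac_simps)
qed

lemma orient_map:
  assumes "finite G" "inj f"
  shows "orient (map f w) (f ` G) = order_change f G * orient w G"
  using assms(1)
proof (induction w arbitrary: G)
  case Nil
  then show ?case by (auto simp: order_change_def)
next
  case (Cons x w)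
  show ?case
  proof (cases "x \<in> G")
    case True
    define H where "H = G - {x}"
    have G: "G = insert x H" "x \<notin> H" "finite H" using True Cons by (auto simp: H_def)
    have "f ` G - {f x} = f ` H" using assms(2) G by (auto dest: injD)
    then have "orient (map f (x # w)) (f ` G) = order_sign (f x) (f ` H) * (order_change f H * orient w H)"
      using Cons.IH [OF G(3)] True by simp
    also have "\<dots> = order_change f (insert x H) * order_sign x H * orient w H"
      using order_change_insert [OF G(3,2) assms(2)] by (simp add: mult_ac)
    finally show ?thesis using True G by (simp flip: H_def)
  next
    case False
    then have "f x \<notin> f ` G" using assms(2) by (auto dest: injD)
    then show ?thesis using False by simp
  qed
qed

text \<open>Apply the transposition to \<open>a # b # w\<close>, where \<open>w\<close> lists the
  remaining elements: it swaps the first two entries, which reverses \<open>orient\<close>.\<close>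

lemma order_change_transpose:
  assumes "finite F" "a \<in> F" "b \<in> F" "a \<noteq> b"
  shows "order_change (Transposition.transpose a b) F = -1"
proof -
  define H where "H = F - {a, b}"
  define w where "w = sorted_list_of_set H"
  have H: "finite H" "a \<notin> H" "b \<notin> H" "F = insert a (insert b H)"
    using assms by (auto simp: H_def)
  have w: "set w = H" "distinct w" using H by (auto simp: w_def)
  have "map (Transposition.transpose a b) w = w" using w H by (intro map_idI) (auto simp: Transposition.transpose_def)
  moreover have "Transposition.transpose a b ` F = F" using assms by (auto simp: Transposition.transpose_def image_iff split: if_splits)
  moreover have "inj (Transposition.transpose a b)" by simp
  ultimately have eq: "orient (b # a # w) F = order_change (Transposition.transpose a b) F * orient (a # b # w) F"
    using orient_map [of F "Transposition.transpose a b" "a # b # w"] assms by simp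
  have 1: "F - {a} = insert b H" "F - {b} = insert a H" "insert b H - {b} = H" "insert a H - {a} = H"
    using assms by (auto simp: H_def)
  have "order_sign b (insert a H) * order_sign a H = - (order_sign a (insert b H) * order_sign b H)"
    using H(1-3) assms(4) by (cases "a < b") (auto simp: order_sign_insert)
  then have "order_sign b (insert a H) * order_sign a H * orient w H
     = - (order_sign a (insert b H) * order_sign b H * orient w H)"
    by (metis minus_mult_left)
  then have "orient (b # a # w) F = - orient (a # b # w) F"
    using assms H(2,3) by (simp add: 1 mult.assoc)
  moreover have "set (a # b # w) = F" "distinct (a # b # w)" using w H assms(4) by auto
  then have "orient (a # b # w) F * orient (a # b # w) F = 1"
    using orient_square by metis
  ultimately show ?thesis using eq
    by (metis mult_cancel_right mult_minus1 mult_zero_left zero_neq_one)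
qed

lemma orient_permutes:
  assumes "finite F" "p permutes F"
  shows "orient (map p w) F = sign p * orient w F"
  using assms(2,1)
proof (induction p rule: permutes_induct)
  case id
  then show ?case by simp
next
  case (swap a b p)
  have "Transposition.transpose a b ` F = F"
    using swap by (auto simp: Transposition.transpose_def image_iff split: if_splits)
  then have "orient (map (Transposition.transpose a b) (map p w)) F
      = order_change (Transposition.transpose a b) F * orient (map p w) F"
    using orient_map [of F "Transposition.transpose a b" "map p w"] assms(1) by simp
  moreover have "permutation p" using swap assms(1) permutation_permutes by blast
  then have "sign (Transposition.transpose a b \<circ> p) = - sign p"
    using swap by (simp add: sign_compose permutation_swap_id sign_swap_id)
  ultimately show ?case
    using swap order_change_transpose [OF assms(1), of a b] by (simp add: o_def)
qed

section \<open>The simplicial sphere with rotation\<close>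

text \<open>The code \<open>j * r + i\<close> with \<open>i < r\<close> stands for vertex \<open>i\<close> of the \<open>j\<close>-th copy of the boundary of
  the simplex on \<open>{..<r}\<close>; the sphere is the join of \<open>m\<close> copies, of dimension \<open>m * (r - 1) - 1\<close>.\<close>

definition block_sphere :: "nat \<Rightarrow> nat \<Rightarrow> nat set set" where
  "block_sphere m r = avoiding {..<m * r} {..<m} (\<lambda>j. {j * r..<j * r + r})"

text \<open>Being the identity from \<open>m * r\<close> on makes it a bijection of all natural
  numbers, since \<open>orient_map\<close> asks for a globally injective map.\<close>

definition rot :: "nat \<Rightarrow> nat \<Rightarrow> nat \<Rightarrow> nat" where
  "rot m r y = (if y < m * r then y div r * r + Suc (y mod r) mod r else y)"

text \<open>If all values of \<open>\<mu>\<close> are below \<open>r\<close>, this is a maximal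
  simplex of the sphere.\<close>

definition facet :: "nat \<Rightarrow> nat \<Rightarrow> (nat \<Rightarrow> nat) \<Rightarrow> nat set" where
  "facet m r \<mu> = {y \<in> {..<m * r}. y mod r \<noteq> \<mu> (y div r)}"

lemma block_code:
  assumes "i < (r::nat)" shows "(j * r + i) div r = j" "(j * r + i) mod r = i" "j * r + i < m * r \<longleftrightarrow> j < m"
proof -
  show 1: "(j * r + i) div r = j" "(j * r + i) mod r = i" using assms by auto
  show "j * r + i < m * r \<longleftrightarrow> j < m"
  proof
    assume *: "j * r + i < m * r"
    show "j < m"
    proof (rule ccontr)
      assume "\<not> j < m"
      then have "m * r \<le> j * r" by (intro mult_le_mono1) simp
      then show False using * by linarith
    qed
  next
    assume "j < m"
    then have "Suc j * r \<le> m * r" by (intro mult_le_mono1) simp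
    then show "j * r + i < m * r" using assms by simp
  qed
qed

lemma block_decode:
  fixes r :: nat assumes "r > 0" "y < m * r" shows "y div r < m" "y mod r < r" "y = y div r * r + y mod r"
  using assms by (auto simp: less_mult_imp_div_less)

lemma block_sphere_iff:
  assumes "r > 0"
  shows "\<sigma> \<in> block_sphere m r \<longleftrightarrow> \<sigma> \<subseteq> {..<m * r} \<and> (\<forall>j<m. \<exists>i<r. j * r + i \<notin> \<sigma>)"
proof -
  have "{j * r..<j * r + r} \<subseteq> \<sigma> \<longleftrightarrow> (\<forall>i<r. j * r + i \<in> \<sigma>)" for j
  proof
    assume *: "\<forall>i<r. j * r + i \<in> \<sigma>"
    show "{j * r..<j * r + r} \<subseteq> \<sigma>"
    proof
      fix y assume "y \<in> {j * r..<j * r + r}"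
      then show "y \<in> \<sigma>" using * [rule_format, of "y - j * r"] by auto
    qed
  qed auto
  then show ?thesis by (auto simp: block_sphere_def avoiding_def)
qed

lemma down_closed_sphere: "down_closed (block_sphere m r)"
  by (simp add: block_sphere_def down_closed_avoiding)

lemma acyc_sphere:
  assumes "r > 0" shows "acyc (block_sphere m r) (m * (r - 1))"
  unfolding block_sphere_def
proof (rule acyc_avoiding)
  show "disjoint_family_on (\<lambda>j. {j * r..<j * r + r}) {..<m}"
    unfolding disjoint_family_on_def
  proof (intro ballI impI)
    fix i j :: nat assume "i \<noteq> j"
    have "y div r = k" if "y \<in> {k * r..<k * r + r}" for y k
      using that by (auto intro!: div_nat_eqI simp: mult.commute)
    then show "{i * r..<i * r + r} \<inter> {j * r..<j * r + r} = {}"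
      using \<open>i \<noteq> j\<close> by blast
  qed
  show "finite {j * r..<j * r + r} \<and> {j * r..<j * r + r} \<noteq> {} \<and> {j * r..<j * r + r} \<subseteq> {..<m * r}"
    if "j \<in> {..<m}" for j
  proof -
    have "Suc j * r \<le> m * r" using that by (intro mult_le_mono1) simp
    then have "j * r + r \<le> m * r" by simp
    then show ?thesis using assms by auto
  qed
qed auto

lemma rot_props:
  assumes "r > 0" "y < m * r"
  shows "rot m r y < m * r" "rot m r y div r = y div r" "rot m r y mod r = Suc (y mod r) mod r"
  using block_code [of "Suc (y mod r) mod r" r "y div r"] block_decode [OF assms] assms
  by (auto simp: rot_def)

lemma rot_pow:
  assumes "r > 0" "y < m * r"
  shows "(rot m r ^^ i) y = y div r * r + (y mod r + i) mod r"
proof (induction i)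
  case 0
  then show ?case using block_decode [OF assms] by simp
next
  case (Suc i)
  have "y div r * r + (y mod r + i) mod r < m * r"
    using block_code(3) [of "(y mod r + i) mod r" r] block_decode [OF assms] assms by simp
  then show ?case
    using Suc block_code [of "(y mod r + i) mod r" r "y div r"] assms by (simp add: rot_def mod_Suc_eq)
qed

lemma rot_pow_r: "r > 0 \<Longrightarrow> (rot m r ^^ r) y = y"
proof (cases "y < m * r")
  case False
  have "(rot m r ^^ i) y = y" for i using False by (induction i) (auto simp: rot_def)
  then show ?thesis by blast
qed (use block_decode in \<open>simp add: rot_pow\<close>)

lemma bij_rot: assumes "r > 0" shows "bij (rot m r)"
proof (rule o_bij)
  have "(rot m r ^^ Suc (r - 1)) = id" using rot_pow_r [OF assms, of m] assms by (simp add: fun_eq_iff)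
  then show "(rot m r ^^ (r - 1)) \<circ> rot m r = id" "rot m r \<circ> (rot m r ^^ (r - 1)) = id"
    by (metis funpow_Suc_right, metis funpow.simps(2))
qed

lemma rot_pow_less: "r > 0 \<Longrightarrow> y < m * r \<Longrightarrow> (rot m r ^^ i) y < m * r"
  by (induction i) (auto simp: rot_props(1))

lemma rot_sphere:
  assumes r: "r > 0" and \<sigma>: "\<sigma> \<in> block_sphere m r" shows "rot m r ` \<sigma> \<in> block_sphere m r"
proof -
  have s: "\<sigma> \<subseteq> {..<m * r}" "\<And>j. j < m \<Longrightarrow> \<exists>i<r. j * r + i \<notin> \<sigma>"
    using \<sigma> by (auto simp: block_sphere_iff [OF r])
  have "\<exists>i<r. j * r + i \<notin> rot m r ` \<sigma>" if j: "j < m" for j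
  proof -
    obtain i where i: "i < r" "j * r + i \<notin> \<sigma>" using s(2) j by blast
    have "j * r + i < m * r" using block_code(3) [OF i(1)] j by simp
    then have "rot m r (j * r + i) = j * r + Suc i mod r"
      using block_code(1,2) [OF i(1)] by (simp add: rot_def)
    moreover have "rot m r (j * r + i) \<notin> rot m r ` \<sigma>"
      using i bij_rot [OF r, of m] by (metis bij_is_inj inj_image_mem_iff)
    ultimately have "j * r + Suc i mod r \<notin> rot m r ` \<sigma>" by simp
    moreover have "Suc i mod r < r" using r by simp
    ultimately show ?thesis by blast
  qed
  moreover have "rot m r ` \<sigma> \<subseteq> {..<m * r}" using s rot_props(1) [OF r] by auto
  ultimately show ?thesis by (auto simp: block_sphere_iff [OF r])
qed

lemma finite_facet [simp]: "finite (facet m r \<mu>)"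
  by (simp add: facet_def)

lemma facet_cong: "(\<And>j. j < m \<Longrightarrow> \<mu> j = \<nu> j) \<Longrightarrow> facet m r \<mu> = facet m r \<nu>"
  unfolding facet_def by (cases "r = 0") (auto simp: less_mult_imp_div_less)

text \<open>The two facets are the only simplices of the sphere that extend their common ridge
  \<open>G\<close> by one vertex. A cycle has boundary coefficient zero at \<open>G\<close>, which
  ties its coefficients on the two facets together. The sign \<open>k\<close> comes from
  \<open>p\<close>, \<open>q\<close> and \<open>G\<close> alone and is the same for all
  cycles.\<close>

lemma facet_adjacent:
  assumes r: "r > 0" and \<mu>: "\<And>j. j < m \<Longrightarrow> \<mu> j < r" and j: "j < m" and b: "b < r"
  shows "\<exists>k. k * k = (1::int) \<and> (\<forall>c. Poly_Mapping.keys c \<subseteq> simps (block_sphere m r) n \<longrightarrow> bd c = 0 \<longrightarrow>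
     lin (\<lambda>w. orient w (facet m r (\<mu>(j := b)))) c = k * lin (\<lambda>w. orient w (facet m r \<mu>)) c)"
proof (cases "\<mu> j = b")
  case True
  then have "\<mu>(j := b) = \<mu>" by auto
  then show ?thesis by (intro exI [of _ 1]) simp
next
  case False
  define p q where "p = j * r + \<mu> j" and "q = j * r + b"
  define G where "G = facet m r \<mu> - {q}"
  let ?V = "{..<m * r}"
  have p: "p < m * r" "p div r = j" "p mod r = \<mu> j"
    using block_code [of "\<mu> j" r j] \<mu> j by (auto simp: p_def)
  have q: "q < m * r" "q div r = j" "q mod r = b"
    using block_code [of b r j] b j by (auto simp: q_def)
  have "p \<noteq> q" using False by (simp add: p_def q_def)
  have code_eq: "y = p" if "y div r = j" "y mod r = \<mu> j" for y
    using that unfolding p_def by (metis div_mult_mod_eq)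
  have code_eq': "y = q" if "y div r = j" "y mod r = b" for y
    using that unfolding q_def by (metis div_mult_mod_eq)
  have Gp: "insert p G = facet m r (\<mu>(j := b))"
  proof (rule Set.set_eqI)
    fix y
    show "y \<in> insert p G \<longleftrightarrow> y \<in> facet m r (\<mu>(j := b))"
    proof (cases "y div r = j")
      case True
      then have "y = p \<longleftrightarrow> y mod r = \<mu> j" "y = q \<longleftrightarrow> y mod r = b"
        using p(3) q(3) code_eq [of y] code_eq' [of y] by metis+
      then show ?thesis using True p(1) \<open>p \<noteq> q\<close> by (simp add: G_def facet_def) blast
    next
      case f: False
      then have "y \<noteq> p" "y \<noteq> q" using p(2) q(2) by metis+
      then show ?thesis using f by (simp add: G_def facet_def)
    qed
  qed
  have Gq: "insert q G = facet m r \<mu>"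
    using q False by (auto simp: G_def facet_def)
  have pq: "p \<notin> G" "q \<notin> G" using p by (auto simp: G_def facet_def)
  have GV: "G \<subseteq> ?V" by (auto simp: G_def facet_def)
  define k where "k = - (order_sign p G * order_sign q G)"
  have "k * k = (order_sign p G * order_sign p G) * (order_sign q G * order_sign q G)"
    by (simp add: k_def mult_ac)
  then have k: "k * k = 1" by (simp add: order_sign_square)
  have "lin (\<lambda>w. orient w (insert p G)) c = k * lin (\<lambda>w. orient w (insert q G)) c"
    if c: "Poly_Mapping.keys c \<subseteq> simps (block_sphere m r) n" "bd c = 0" for c
  proof -
    have "lin (\<lambda>w. orient w G) (bd c) = lin (\<lambda>w. lin (\<lambda>w. orient w G) (bdl w)) c"
      by (simp add: bd_def lin_frag_extend)
    also have "\<dots> = lin (\<lambda>w. order_sign p G * orient w (insert p G) + order_sign q G * orient w (insert q G)) c"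
    proof (rule lin_cong)
      fix w assume "w \<in> Poly_Mapping.keys c"
      then have w: "set w \<in> block_sphere m r" using c by (auto simp: simps_def)
      have "lin (\<lambda>w. orient w G) (bdl w) = (\<Sum>v\<in>?V - G. order_sign v G * orient w (insert v G))"
        by (rule orient_bdl) (use w GV in \<open>auto simp: block_sphere_iff [OF r]\<close>)
      also have "\<dots> = (\<Sum>v\<in>{p, q}. order_sign v G * orient w (insert v G))"
      proof (rule sum.mono_neutral_right)
        \<comment> \<open>Any other \<open>v\<close> is the vertex that the facet omits in some
          block different from \<open>j\<close>; adding it fills that block, and full blocks do not
          occur in the sphere.\<close>
        show "\<forall>v\<in>?V - G - {p, q}. order_sign v G * orient w (insert v G) = 0"
        proof
          fix v assume v: "v \<in> ?V - G - {p, q}"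
          have "v mod r = \<mu> (v div r)" using v by (auto simp: G_def facet_def)
          define i where "i = v div r"
          have i: "i < m" using v block_decode(1) [OF r] by (auto simp: i_def)
          have "i \<noteq> j" using v code_eq [of v] \<open>v mod r = \<mu> (v div r)\<close> by (auto simp: i_def)
          have "i * r + a \<in> insert v G" if "a < r" for a
          proof (cases "a = \<mu> i")
            case True
            then show ?thesis using \<open>v mod r = \<mu> (v div r)\<close> unfolding i_def by (metis div_mult_mod_eq insertI1)
          next
            case False
            have "i * r + a \<noteq> q" using block_code(1) [OF that, of i] q \<open>i \<noteq> j\<close> by metis
            then show ?thesis using False block_code [OF that] i by (auto simp: G_def facet_def)
          qed
          then have "insert v G \<notin> block_sphere m r" using i by (auto simp: block_sphere_iff [OF r])
          then have "orient w (insert v G) = 0" using orient_nonzero w by metis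
          then show "order_sign v G * orient w (insert v G) = 0" by simp
        qed
      qed (use p q pq in auto)
      finally show "lin (\<lambda>w. orient w G) (bdl w)
         = order_sign p G * orient w (insert p G) + order_sign q G * orient w (insert q G)"
        using \<open>p \<noteq> q\<close> by simp
    qed
    also have "\<dots> = order_sign p G * lin (\<lambda>w. orient w (insert p G)) c
        + order_sign q G * lin (\<lambda>w. orient w (insert q G)) c"
      by (simp add: lin_fun_add lin_fun_cmul)
    finally have "order_sign p G * lin (\<lambda>w. orient w (insert p G)) c
        = - (order_sign q G * lin (\<lambda>w. orient w (insert q G)) c)"
      using c by simp
    then have "order_sign p G * (order_sign p G * lin (\<lambda>w. orient w (insert p G)) c)
        = k * lin (\<lambda>w. orient w (insert q G)) c"
      by (simp add: k_def)
    then show ?thesis using order_sign_square [of p G] by (simp flip: mult.assoc)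
  qed
  then show ?thesis using k Gp Gq by auto
qed

text \<open>Pass from \<open>\<mu>\<close> to \<open>\<nu>\<close> one block at a time; every step
  crosses a ridge.\<close>

lemma facet_related:
  assumes r: "r > 0" and \<mu>: "\<And>j. j < m \<Longrightarrow> \<mu> j < r" and \<nu>: "\<And>j. j < m \<Longrightarrow> \<nu> j < r"
  shows "\<exists>k. k * k = (1::int) \<and> (\<forall>c. Poly_Mapping.keys c \<subseteq> simps (block_sphere m r) n \<longrightarrow> bd c = 0 \<longrightarrow>
     lin (\<lambda>w. orient w (facet m r \<nu>)) c = k * lin (\<lambda>w. orient w (facet m r \<mu>)) c)"
proof -
  have chain: "\<exists>k. k * k = (1::int) \<and> (\<forall>c. Poly_Mapping.keys c \<subseteq> simps (block_sphere m r) n \<longrightarrow> bd c = 0 \<longrightarrow>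
     lin (\<lambda>w. orient w (facet m r (\<lambda>j. if j < i then \<nu> j else \<mu> j))) c = k * lin (\<lambda>w. orient w (facet m r \<mu>)) c)"
    if "i \<le> m" for i
    using that
  proof (induction i)
    case 0
    show ?case by (intro exI [of _ 1]) simp
  next
    case (Suc i)
    let ?\<mu> = "\<lambda>j. if j < i then \<nu> j else \<mu> j"
    obtain k where k: "k * k = (1::int)" "\<And>c. Poly_Mapping.keys c \<subseteq> simps (block_sphere m r) n \<Longrightarrow> bd c = 0 \<Longrightarrow>
     lin (\<lambda>w. orient w (facet m r ?\<mu>)) c = k * lin (\<lambda>w. orient w (facet m r \<mu>)) c"
      using Suc by auto
    have "\<exists>k. k * k = (1::int) \<and> (\<forall>c. Poly_Mapping.keys c \<subseteq> simps (block_sphere m r) n \<longrightarrow> bd c = 0 \<longrightarrow>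
     lin (\<lambda>w. orient w (facet m r (?\<mu>(i := \<nu> i)))) c = k * lin (\<lambda>w. orient w (facet m r ?\<mu>)) c)"
      by (rule facet_adjacent [OF r]) (use \<mu> \<nu> Suc.prems in auto)
    then obtain k' where k': "k' * k' = (1::int)" "\<And>c. Poly_Mapping.keys c \<subseteq> simps (block_sphere m r) n \<Longrightarrow> bd c = 0 \<Longrightarrow>
     lin (\<lambda>w. orient w (facet m r (?\<mu>(i := \<nu> i)))) c = k' * lin (\<lambda>w. orient w (facet m r ?\<mu>)) c"
      by blast
    have eq: "?\<mu>(i := \<nu> i) = (\<lambda>j. if j < Suc i then \<nu> j else \<mu> j)" by (auto simp: less_Suc_eq)
    have "(k' * k) * (k' * k) = (k' * k') * (k * k)" by (simp only: ac_simps)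
    then have "(k' * k) * (k' * k) = 1" using k k' by simp
    then show ?case using k k' unfolding eq by (intro exI [of _ "k' * k"]) (simp add: mult.assoc)
  qed
  have eq: "facet m r (\<lambda>j. if j < m then \<nu> j else \<mu> j) = facet m r \<nu>"
    by (rule facet_cong) simp
  show ?thesis using chain [OF order_refl] unfolding eq .
qed

lemma rot_facet:
  assumes r: "r > 0" and \<mu>: "\<And>j. j < m \<Longrightarrow> \<mu> j < r"
  shows "rot m r ` facet m r \<mu> = facet m r (\<lambda>j. Suc (\<mu> j) mod r)"
proof -
  have inj: "Suc a mod r = Suc b mod r \<longleftrightarrow> a = b" if "a < r" "b < r" for a b
    using that by (auto simp: mod_Suc)
  have "rot m r y \<in> facet m r (\<lambda>j. Suc (\<mu> j) mod r) \<longleftrightarrow> y \<in> facet m r \<mu>" if y: "y < m * r" for y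
    using rot_props [OF r y] block_decode [OF r y] y inj \<mu> by (auto simp: facet_def)
  then have img: "rot m r y \<in> facet m r (\<lambda>j. Suc (\<mu> j) mod r) \<longleftrightarrow> y \<in> facet m r \<mu>" if "y < m * r" for y
    using that .
  have sub: "facet m r \<kappa> \<subseteq> {..<m * r}" for \<kappa> by (auto simp: facet_def)
  show ?thesis
  proof (intro equalityI subsetI)
    fix y assume "y \<in> rot m r ` facet m r \<mu>"
    then obtain x where "y = rot m r x" "x \<in> facet m r \<mu>" by blast
    then show "y \<in> facet m r (\<lambda>j. Suc (\<mu> j) mod r)" using img [of x] sub [of \<mu>] by blast
  next
    fix y assume y: "y \<in> facet m r (\<lambda>j. Suc (\<mu> j) mod r)"
    define x where "x = (rot m r ^^ (r - 1)) y"
    have "y < m * r" using y sub by blast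
    then have "x < m * r" unfolding x_def by (rule rot_pow_less [OF r])
    moreover have "rot m r x = y"
      using rot_pow_r [OF r, of m y] r unfolding x_def by (metis Suc_pred' comp_apply funpow.simps(2) Suc_pred One_nat_def)
    ultimately show "y \<in> rot m r ` facet m r \<mu>" using img [of x] y by blast
  qed
qed

text \<open>Rotation multiplies the coefficient by a sign \<open>e\<close> that is the same for all
  cycles. As rotation has order \<open>r\<close>, a nonzero coefficient forces
  \<open>e ^ r = 1\<close>, so \<open>e = 1\<close> for odd \<open>r\<close>; for
  \<open>r = 2\<close> the two signs agree modulo \<open>r\<close>.\<close>

lemma orient_rot_dvd:
  assumes "prime r" and \<mu>: "\<And>j. j < m \<Longrightarrow> \<mu> j < r"
    and c: "Poly_Mapping.keys c \<subseteq> simps (block_sphere m r) n" "bd c = 0"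
  shows "int r dvd lin (\<lambda>w. orient w (facet m r \<mu>)) (lmap (rot m r) c) - lin (\<lambda>w. orient w (facet m r \<mu>)) c"
proof -
  have r: "r > 0" using assms(1) prime_gt_0_nat by blast
  let ?o = "\<lambda>\<mu> c. lin (\<lambda>w. orient w (facet m r \<mu>)) c"
  define \<nu> where "\<nu> j = (\<mu> j + (r - 1)) mod r" for j
  have \<nu>: "\<And>j. \<nu> j < r" using r by (simp add: \<nu>_def)
  have "Suc (\<nu> j) mod r = \<mu> j" if "j < m" for j
    using \<mu> [OF that] r by (simp add: \<nu>_def mod_Suc_eq flip: add_Suc_right)
  then have rot: "rot m r ` facet m r \<nu> = facet m r \<mu>"
    using rot_facet [OF r, of m \<nu>] \<nu> facet_cong [of m "\<lambda>j. Suc (\<nu> j) mod r" \<mu>] by simp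
  have 1: "?o \<mu> (lmap (rot m r) x) = order_change (rot m r) (facet m r \<nu>) * ?o \<nu> x" for x
  proof -
    have "?o \<mu> (lmap (rot m r) x) = lin (\<lambda>w. orient (map (rot m r) w) (facet m r \<mu>)) x"
      by (simp add: lmap_def lin_frag_extend)
    also have "\<dots> = lin (\<lambda>w. order_change (rot m r) (facet m r \<nu>) * orient w (facet m r \<nu>)) x"
      using orient_map [OF finite_facet bij_is_inj [OF bij_rot [OF r]]] rot by (metis (no_types, lifting))
    finally show ?thesis by (simp add: lin_fun_cmul)
  qed
  obtain k where k: "k * k = (1::int)" "\<And>x. Poly_Mapping.keys x \<subseteq> simps (block_sphere m r) n \<Longrightarrow> bd x = 0 \<Longrightarrow>
     ?o \<nu> x = k * ?o \<mu> x"
  proof -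
    have "\<exists>k. k * k = (1::int) \<and> (\<forall>c. Poly_Mapping.keys c \<subseteq> simps (block_sphere m r) n \<longrightarrow> bd c = 0 \<longrightarrow> ?o \<nu> c = k * ?o \<mu> c)"
      by (rule facet_related [OF r]) (use \<mu> \<nu> in auto)
    then show ?thesis using that by metis
  qed
  define e where "e = order_change (rot m r) (facet m r \<nu>) * k"
  have e2: "e * e = 1"
  proof -
    have "e * e = (order_change (rot m r) (facet m r \<nu>) * order_change (rot m r) (facet m r \<nu>)) * (k * k)"
      by (simp only: e_def ac_simps)
    then show ?thesis by (simp add: order_change_square k)
  qed
  have e: "?o \<mu> (lmap (rot m r) x) = e * ?o \<mu> x" if "Poly_Mapping.keys x \<subseteq> simps (block_sphere m r) n" "bd x = 0" for x
    using 1 [of x] k(2) [OF that] by (simp add: e_def)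
  have pow: "Poly_Mapping.keys ((lmap (rot m r) ^^ i) c) \<subseteq> simps (block_sphere m r) n \<and> bd ((lmap (rot m r) ^^ i) c) = 0 \<and>
     ?o \<mu> ((lmap (rot m r) ^^ i) c) = e ^ i * ?o \<mu> c" for i
  proof (induction i)
    case (Suc i)
    then show ?case
      using e [of "(lmap (rot m r) ^^ i) c"] keys_lmap_simps [of "block_sphere m r" "rot m r" "block_sphere m r"] rot_sphere [OF r]
      by (simp add: bd_lmap)
  qed (use c in auto)
  have lp: "(lmap (rot m r) ^^ i) c = lmap (rot m r ^^ i) c" for i
    by (induction i) (auto simp: lmap_lmap o_def intro: lmap_cong_id [symmetric])
  have "(lmap (rot m r) ^^ r) c = c"
    unfolding lp by (rule lmap_cong_id) (simp add: rot_pow_r [OF r] map_idI)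
  then have fix_r: "e ^ r * ?o \<mu> c = ?o \<mu> c" using pow [of r] by simp
  have e_cases: "e = 1 \<or> e = -1" using e2 by (simp add: square_eq_1_iff)
  show ?thesis
  proof (cases "e = 1 \<or> ?o \<mu> c = 0")
    case True
    then show ?thesis using e [OF c] by auto
  next
    case False
    then have "e = -1" "e ^ r = 1" using e_cases fix_r by auto
    then have "even r" by (metis (no_types) one_neq_neg_one power_minus_odd power_one)
    then have "r = 2" using assms(1) primes_dvd_imp_eq two_is_prime_nat by blast
    then show ?thesis using e [OF c] \<open>e = -1\<close> by simp
  qed
qed

section \<open>Block-preserving permutations\<close>

text \<open>These index the facets of the join of chessboards: column \<open>y\<close> carries row
  \<open>p y mod r\<close>, and the last position of each block, which is not a column, takes the
  leftover row. Only with it is a facet a full permutation with a sign.\<close>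

definition block_perms :: "nat \<Rightarrow> nat \<Rightarrow> (nat \<Rightarrow> nat) set" where
  "block_perms m r = {p. p permutes {..<m * r} \<and> (\<forall>y. p y div r = y div r)}"

definition cols :: "nat \<Rightarrow> nat \<Rightarrow> nat list" where
  "cols m r = filter (\<lambda>y. y mod r \<noteq> r - 1) [0..<m * r]"

lemma set_cols: "set (cols m r) = {y. y < m * r \<and> y mod r \<noteq> r - 1}"
  by (auto simp: cols_def)

lemma sorted_cols: "sorted_wrt (<) (cols m r)"
  unfolding cols_def by (intro sorted_wrt_filter) simp

lemma distinct_cols: "distinct (cols m r)"
  by (simp add: cols_def)

lemma facet_cols: "facet m r (\<lambda>_. r - 1) = set (cols m r)"
  by (auto simp: facet_def set_cols)

lemma length_cols:
  assumes "r > 0" shows "length (cols m r) = m * (r - 1)"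
proof -
  have "{y. y < m * r \<and> y mod r = r - 1} = (\<lambda>j. j * r + (r - 1)) ` {..<m}"
  proof (intro equalityI subsetI)
    fix y assume "y \<in> {y. y < m * r \<and> y mod r = r - 1}"
    then show "y \<in> (\<lambda>j. j * r + (r - 1)) ` {..<m}"
      using block_decode [OF assms, of y m] by (intro image_eqI [of _ _ "y div r"]) auto
  next
    fix y assume "y \<in> (\<lambda>j. j * r + (r - 1)) ` {..<m}"
    then obtain j where "j < m" "y = j * r + (r - 1)" by blast
    then show "y \<in> {y. y < m * r \<and> y mod r = r - 1}"
      using block_code [of "r - 1" r j] assms by simp
  qed
  moreover have "inj_on (\<lambda>j. j * r + (r - 1)) {..<m}"
  proof (rule inj_onI)
    fix i j assume "i * r + (r - 1) = j * r + (r - 1)"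
    then have "i * r = j * r" by (rule add_right_imp_eq)
    then show "i = j" using assms by simp
  qed
  ultimately have 1: "card {y. y < m * r \<and> y mod r = r - 1} = m" by (simp add: card_image)
  have "set (cols m r) = {..<m * r} - {y. y < m * r \<and> y mod r = r - 1}"
    unfolding set_cols by blast
  moreover have "card ({..<m * r} - {y. y < m * r \<and> y mod r = r - 1})
      = card {..<m * r} - card {y. y < m * r \<and> y mod r = r - 1}"
    by (rule card_Diff_subset) auto
  ultimately have "card (set (cols m r)) = m * r - m" by (simp only: 1 card_lessThan)
  then show ?thesis using distinct_card [OF distinct_cols, of m r] by (simp add: diff_mult_distrib2)
qed

lemma finite_block_perms: "finite (block_perms m r)"
  unfolding block_perms_def by (rule finite_subset [OF _ finite_permutations [of "{..<m * r}"]]) auto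

lemma block_perms_comp: "p \<in> block_perms m r \<Longrightarrow> q \<in> block_perms m r \<Longrightarrow> p \<circ> q \<in> block_perms m r"
  unfolding block_perms_def by (auto intro: permutes_compose)

lemma block_perms_permutation: "p \<in> block_perms m r \<Longrightarrow> permutation p"
  unfolding block_perms_def permutation_permutes by blast

lemma block_perms_inj: "p \<in> block_perms m r \<Longrightarrow> inj p"
  unfolding block_perms_def using permutes_inj by blast

lemma block_perms_less:
  assumes "p \<in> block_perms m r" "y < m * r" shows "p y < m * r"
proof -
  have "p permutes {..<m * r}" using assms by (simp add: block_perms_def)
  then show ?thesis using permutes_in_image assms(2) by fastforce
qed

lemma rot_block_perms: "r > 0 \<Longrightarrow> rot m r \<in> block_perms m r"
  unfolding block_perms_def
proof (intro CollectI conjI allI)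
  assume r: "r > 0"
  show "rot m r permutes {..<m * r}"
  proof (rule bij_imp_permutes)
    have "inj_on (rot m r) {..<m * r}"
      using bij_rot [OF r, of m] by (meson bij_is_inj inj_on_subset subset_UNIV)
    moreover have "rot m r ` {..<m * r} \<subseteq> {..<m * r}" using rot_props(1) [OF r] by auto
    ultimately show "bij_betw (rot m r) {..<m * r} {..<m * r}"
      by (simp add: bij_betw_def endo_inj_surj)
  qed (simp add: rot_def)
  show "rot m r y div r = y div r" for y
    using rot_props(2) [OF r] by (cases "y < m * r") (auto simp: rot_def)
qed

lemma transpose_block_perms:
  assumes "a < m * r" "b < m * r" "a div r = b div r"
  shows "Transposition.transpose a b \<in> block_perms m r"
  using assms unfolding block_perms_def
  by (auto intro: permutes_swap_id simp: Transposition.transpose_def)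

text \<open>Such a \<open>p\<close> preserves blocks and columns, so it fixes the last position of
  every block and amounts to \<open>m\<close> independent permutations of \<open>r - 1\<close>
  points; \<open>F\<close> and \<open>H\<close> translate between the two descriptions. The number
  will be the degree of \<open>code\<close>.\<close>

lemma card_block_perms_facet:
  assumes r: "r > 0"
  shows "card {p \<in> block_perms m r. p ` set (cols m r) = set (cols m r)} = fact (r - 1) ^ m"
proof -
  let ?Q = "{p \<in> block_perms m r. p ` set (cols m r) = set (cols m r)}"
  define A where "A = {\<pi>. \<pi> permutes {..<r - 1}}"
  define F where "F p = (\<lambda>j\<in>{..<m}. \<lambda>i. if i < r - 1 then p (j * r + i) mod r else i)" for p :: "nat \<Rightarrow> nat"
  define H where "H P = (\<lambda>y. if y < m * r then y div r * r + P (y div r) (y mod r) else y)"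
    for P :: "nat \<Rightarrow> nat \<Rightarrow> nat"
  have finA: "finite A" "card A = fact (r - 1)"
    unfolding A_def using card_permutations [of "{..<r - 1}" "r - 1"] finite_permutations by auto
  have last: "p y = y" if p: "p \<in> ?Q" and y: "y < m * r" "y mod r = r - 1" for p y
  proof -
    have "y \<notin> set (cols m r)" using y by (simp add: set_cols)
    then have "p y \<notin> p ` set (cols m r)"
      using p block_perms_inj by (metis (no_types, lifting) inj_image_mem_iff mem_Collect_eq)
    then have "p y \<notin> set (cols m r)" using p by simp
    moreover have "p y < m * r" "p y div r = y div r"
      using block_perms_less p y by (auto simp: block_perms_def)
    ultimately show ?thesis using y by (metis (mono_tags, lifting) div_mult_mod_eq mem_Collect_eq set_cols)
  qed
  have col: "j * r + i \<in> set (cols m r)" if "j < m" "i < r - 1" for i j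
    using block_code [of i r j] that by (simp add: set_cols)
  have FA: "F p \<in> {..<m} \<rightarrow>\<^sub>E A" if p: "p \<in> ?Q" for p
  proof
    fix j assume j: "j \<in> {..<m}"
    have blk: "p (j * r + i) div r = j" if "i < r - 1" for i
      using p block_code(1) [of i r j] that by (simp add: block_perms_def)
    have "inj_on (\<lambda>i. p (j * r + i) mod r) {..<r - 1}"
    proof (rule inj_onI)
      fix a b assume ab: "a \<in> {..<r - 1}" "b \<in> {..<r - 1}" "p (j * r + a) mod r = p (j * r + b) mod r"
      then have "p (j * r + a) = p (j * r + b)" using blk [of a] blk [of b] by (metis div_mult_mod_eq lessThan_iff)
      then show "a = b" using block_perms_inj p by (metis (no_types, lifting) add_left_cancel injD mem_Collect_eq)
    qed
    moreover have "p (j * r + i) mod r < r - 1" if "i < r - 1" for i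
    proof -
      have "p (j * r + i) \<in> set (cols m r)" using p col [of j i] j that by blast
      then have "p (j * r + i) mod r \<noteq> r - 1" by (simp add: set_cols)
      moreover have "p (j * r + i) mod r < r" using r by simp
      ultimately show ?thesis by linarith
    qed
    then have "(\<lambda>i. p (j * r + i) mod r) ` {..<r - 1} \<subseteq> {..<r - 1}" by auto
    ultimately have "bij_betw (\<lambda>i. p (j * r + i) mod r) {..<r - 1} {..<r - 1}"
      by (simp add: bij_betw_def endo_inj_surj)
    then have "bij_betw (F p j) {..<r - 1} {..<r - 1}"
      using j by (subst bij_betw_cong [where g = "\<lambda>i. p (j * r + i) mod r"]) (auto simp: F_def)
    then show "F p j \<in> A" unfolding A_def using j by (auto intro!: bij_imp_permutes simp: F_def split: if_splits)
  next
    show "F p j = undefined" if "j \<notin> {..<m}" for j using that by (simp add: F_def)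
  qed
  have HP: "H P \<in> ?Q" if P: "P \<in> {..<m} \<rightarrow>\<^sub>E A" for P
  proof -
    have Pj: "P j permutes {..<r - 1}" if "j < m" for j using P that by (auto simp: A_def)
    have lt: "P j i < r" "i < r - 1 \<longleftrightarrow> P j i < r - 1" if "j < m" "i < r" for i j
      using permutes_in_image [OF Pj [OF that(1)], of i] permutes_not_in [OF Pj [OF that(1)], of i] that by auto
    have Hy: "H P y div r = y div r" "H P y mod r = P (y div r) (y mod r)" "H P y < m * r" if "y < m * r" for y
      using block_code [of "P (y div r) (y mod r)" r "y div r"] lt(1) block_decode [OF r that] that
      by (auto simp: H_def)
    have "inj_on (H P) {..<m * r}"
    proof (rule inj_onI)
      fix a b assume ab: "a \<in> {..<m * r}" "b \<in> {..<m * r}" "H P a = H P b"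
      then have "a div r = b div r" "P (a div r) (a mod r) = P (b div r) (b mod r)"
        using Hy [of a] Hy [of b] by auto
      moreover have "a div r < m" using ab block_decode [OF r] by auto
      ultimately have "a mod r = b mod r" using permutes_inj [OF Pj] by (metis injD)
      then show "a = b" using \<open>a div r = b div r\<close> by (metis div_mult_mod_eq)
    qed
    moreover have "H P ` {..<m * r} \<subseteq> {..<m * r}" using Hy(3) by auto
    ultimately have "bij_betw (H P) {..<m * r} {..<m * r}"
      by (simp add: bij_betw_def endo_inj_surj)
    then have 1: "H P permutes {..<m * r}" by (rule bij_imp_permutes) (simp add: H_def)
    have 2: "H P y div r = y div r" for y using Hy(1) [of y] by (cases "y < m * r") (auto simp: H_def)
    have "H P ` set (cols m r) \<subseteq> set (cols m r)"
    proof (rule image_subsetI)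
      fix y assume "y \<in> set (cols m r)"
      then have y: "y < m * r" "y mod r \<noteq> r - 1" by (auto simp: set_cols)
      note d = block_decode [OF r y(1)]
      have "y mod r < r - 1" using y(2) d(2) by linarith
      then have "P (y div r) (y mod r) < r - 1" using lt(2) [OF d(1,2)] by blast
      then show "H P y \<in> set (cols m r)" using Hy [OF y(1)] by (simp add: set_cols)
    qed
    moreover have "inj_on (H P) (set (cols m r))" using permutes_inj [OF 1] by (meson inj_on_subset subset_UNIV)
    ultimately have "H P ` set (cols m r) = set (cols m r)" by (intro endo_inj_surj) auto
    then show ?thesis using 1 2 by (simp add: block_perms_def)
  qed
  have "bij_betw F ?Q ({..<m} \<rightarrow>\<^sub>E A)"
  proof (rule bij_betw_byWitness [where f' = H])
    show "\<forall>p\<in>?Q. H (F p) = p"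
    proof
      fix p assume p: "p \<in> ?Q"
      have "H (F p) y = p y" for y
      proof (cases "y < m * r")
        case True
        have d: "y div r < m" "y = y div r * r + y mod r" "y mod r < r" using block_decode [OF r True] by auto
        have py: "p y div r = y div r" using p by (simp add: block_perms_def)
        show ?thesis
        proof (cases "y mod r < r - 1")
          case t: True
          then have "H (F p) y = y div r * r + p y mod r" using True d by (simp add: H_def F_def)
          then show ?thesis using py by (metis div_mult_mod_eq)
        next
          case False
          then have "y mod r = r - 1" using d by linarith
          then have "p y = y" using last [OF p True] by simp
          then show ?thesis using True d False by (simp add: H_def F_def)
        qed
      next
        case False
        then have "p y = y" using p by (auto simp: block_perms_def permutes_def)
        then show ?thesis using False by (simp add: H_def)
      qed
      then show "H (F p) = p" by blast
    qed
    show "\<forall>P\<in>{..<m} \<rightarrow>\<^sub>E A. F (H P) = P"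
    proof
      fix P assume P: "P \<in> {..<m} \<rightarrow>\<^sub>E A"
      have in_m: "F (H P) j i = P j i" if j: "j < m" for i j
      proof -
        have Pj: "P j permutes {..<r - 1}" using P j by (auto simp: A_def)
        show ?thesis
        proof (cases "i < r - 1")
          case True
          then have "P j i < r" using permutes_in_image [OF Pj, of i] by auto
          then show ?thesis using True j block_code [of i r j] by (simp add: F_def H_def)
        next
          case False
          then show ?thesis using j permutes_not_in [OF Pj, of i] by (simp add: F_def)
        qed
      qed
      have out_m: "F (H P) j = P j" if "\<not> j < m" for j
        using that P by (auto simp: F_def PiE_def extensional_def)
      show "F (H P) = P"
      proof (rule ext)
        fix j show "F (H P) j = P j"
          using in_m out_m by (cases "j < m") (auto simp: fun_eq_iff)
      qed
    qed
    show "F ` ?Q \<subseteq> {..<m} \<rightarrow>\<^sub>E A" by (rule image_subsetI) (rule FA)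
    show "H ` ({..<m} \<rightarrow>\<^sub>E A) \<subseteq> ?Q" by (rule image_subsetI) (rule HP)
  qed
  then have "card ?Q = card ({..<m} \<rightarrow>\<^sub>E A)" by (rule bij_betw_same_card)
  then show ?thesis by (simp add: card_PiE finA)
qed

text \<open>The sets \<open>{p \<in> Q. lab p = i}\<close> are permuted cyclically by \<open>f\<close>, so their sums of \<open>b\<close> agree
  modulo \<open>r\<close>.\<close>

lemma dvd_sum_cyclic:
  fixes b :: "'a \<Rightarrow> int" and lab :: "'a \<Rightarrow> nat"
  assumes "finite Q" "\<And>p. p \<in> Q \<Longrightarrow> f p \<in> Q" "inj_on f Q"
    and lab: "\<And>p. p \<in> Q \<Longrightarrow> lab p < r" "\<And>p. p \<in> Q \<Longrightarrow> lab (f p) = Suc (lab p) mod r"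
    and b: "\<And>p. p \<in> Q \<Longrightarrow> int r dvd b (f p) - b p"
  shows "int r dvd sum b Q"
proof -
  define q where "q i = {p \<in> Q. lab p = i}" for i
  have surj: "f ` Q = Q" using assms(1-3) by (intro endo_inj_surj) auto
  have step: "int r dvd sum b (q (Suc i)) - sum b (q i)" if i: "Suc i < r" for i
  proof -
    have "f ` q i = q (Suc i)"
    proof (intro equalityI subsetI)
      fix x assume "x \<in> f ` q i"
      then show "x \<in> q (Suc i)" using assms(2) lab(2) i by (auto simp: q_def)
    next
      fix x assume x: "x \<in> q (Suc i)"
      then obtain p where p: "p \<in> Q" "x = f p" using surj by (auto simp: q_def)
      then have "Suc (lab p) mod r = Suc i" using x lab(2) by (auto simp: q_def)
      then have "lab p = i" using lab(1) [OF p(1)] i by (auto simp: mod_Suc split: if_splits)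
      then show "x \<in> f ` q i" using p by (auto simp: q_def)
    qed
    moreover have "inj_on f (q i)" using assms(3) by (rule inj_on_subset) (auto simp: q_def)
    ultimately have "sum b (q (Suc i)) = (\<Sum>p\<in>q i. b (f p))" by (metis sum.reindex_cong)
    then have "sum b (q (Suc i)) - sum b (q i) = (\<Sum>p\<in>q i. b (f p) - b p)" by (simp add: sum_subtractf)
    then show ?thesis using b by (auto simp: q_def intro!: dvd_sum)
  qed
  have const: "int r dvd sum b (q i) - sum b (q 0)" if "i < r" for i
    using that
  proof (induction i)
    case (Suc i)
    then have "int r dvd (sum b (q (Suc i)) - sum b (q i)) + (sum b (q i) - sum b (q 0))"
      using step by (intro dvd_add) auto
    then show ?case by simp
  qed simp
  have "sum b Q = (\<Sum>i<r. sum b (q i))"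
    unfolding q_def by (rule sum.group [symmetric]) (use assms(1) lab(1) in auto)
  also have "\<dots> = (\<Sum>i<r. sum b (q i) - sum b (q 0)) + int r * sum b (q 0)"
    by (simp add: sum_subtractf)
  finally show ?thesis using const by (auto intro!: dvd_add dvd_sum)
qed

section \<open>The degree argument\<close>

text \<open>A vertex \<open>(i, y)\<close> has row \<open>i\<close> and column \<open>y\<close>. The columns with \<open>y < m * r\<close> form \<open>m\<close> classes of
  size \<open>r - 1\<close>, and \<open>y = m * r\<close> is one more class of size \<open>1\<close>; only lists with increasing columns
  are considered.\<close>

definition flags :: "nat \<Rightarrow> nat \<Rightarrow> (nat \<times> nat) list set" where
  "flags m r = {u. sorted_wrt (<) (map snd u) \<and>
     (\<forall>p\<in>set u. fst p < r \<and> snd p \<le> m * r \<and> snd p mod r \<noteq> r - 1) \<and>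
     (\<forall>p\<in>set u. \<forall>q\<in>set u. fst p = fst q \<and> snd p div r = snd q div r \<longrightarrow> p = q)}"

definition row_shift :: "nat \<Rightarrow> nat \<times> 'c \<Rightarrow> nat \<times> 'c" where
  "row_shift r p = (Suc (fst p) mod r, snd p)"

lemma sorted_wrt_delete: "sorted_wrt P xs \<Longrightarrow> sorted_wrt P (take i xs @ drop (Suc i) xs)"
proof (cases "i < length xs")
  case True
  assume "sorted_wrt P xs"
  then have "sorted_wrt P (take i xs @ xs ! i # drop (Suc i) xs)"
    using id_take_nth_drop [OF True] by metis
  then show ?thesis by (simp add: sorted_wrt_append)
qed simp

lemma keys_bdl_flags:
  assumes "u \<in> flags m r" shows "Poly_Mapping.keys (bdl u) \<subseteq> flags m r"
proof
  fix v assume "v \<in> Poly_Mapping.keys (bdl u)"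
  then obtain i where i: "v = take i u @ drop (Suc i) u" using keys_bdl by blast
  have "set v \<subseteq> set u" using i set_take_subset [of i u] set_drop_subset [of "Suc i" u] by simp
  moreover have "sorted_wrt (<) (map snd v)"
    using assms sorted_wrt_delete [of "(<)" "map snd u" i] by (simp add: flags_def i take_map drop_map)
  ultimately show "v \<in> flags m r" using assms unfolding flags_def by blast
qed

lemma Suc_mod_inj: "a < r \<Longrightarrow> b < r \<Longrightarrow> Suc a mod r = Suc b mod r \<longleftrightarrow> a = b"
  by (auto simp: mod_Suc)

lemma row_shift_flags:
  assumes "r > 0" "u \<in> flags m r" shows "map (row_shift r) u \<in> flags m r"
  unfolding flags_def
proof (intro CollectI conjI ballI impI)
  have "map snd (map (row_shift r) u) = map snd u" by (simp add: row_shift_def)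
  moreover have "sorted_wrt (<) (map snd u)" using assms by (simp add: flags_def)
  ultimately show "sorted_wrt (<) (map snd (map (row_shift r) u))" by (simp only:)
next
  fix p assume "p \<in> set (map (row_shift r) u)"
  then obtain p' where p': "p' \<in> set u" "p = row_shift r p'" by auto
  then show "fst p < r" "snd p \<le> m * r" "snd p mod r \<noteq> r - 1"
    using assms by (auto simp: flags_def row_shift_def)
  fix q assume "q \<in> set (map (row_shift r) u)" and pq: "fst p = fst q \<and> snd p div r = snd q div r"
  then obtain q' where q': "q' \<in> set u" "q = row_shift r q'" by auto
  have "fst p' < r" "fst q' < r" using assms p' q' by (auto simp: flags_def)
  then have "fst p' = fst q'" using pq p' q' Suc_mod_inj by (simp add: row_shift_def)
  moreover have "snd p' div r = snd q' div r" using pq p' q' by (simp add: row_shift_def)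
  ultimately have "p' = q'" using p' q' assms(2) unfolding flags_def by blast
  then show "p = q" using p' q' by simp
qed

lemma row_shift_pow: "fst p < r \<Longrightarrow> (row_shift r ^^ i) p = ((fst p + i) mod r, snd p)"
  by (induction i) (auto simp: row_shift_def mod_Suc_eq)

text \<open>The sphere has nothing above a facet: any additional vertex would fill a block.\<close>

lemma lin_orient_facet_boundary:
  assumes r: "r > 0" and c: "Poly_Mapping.keys c \<subseteq> simps (block_sphere m r) n"
  shows "lin (\<lambda>w. orient w (facet m r (\<lambda>_. r - 1))) (bd c) = 0"
proof -
  let ?F = "facet m r (\<lambda>_. r - 1)"
  have "lin (\<lambda>w. orient w ?F) (bd c) = lin (\<lambda>w. lin (\<lambda>w. orient w ?F) (bdl w)) c"
    by (simp add: bd_def lin_frag_extend)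
  also have "\<dots> = lin (\<lambda>w. 0) c"
  proof (rule lin_cong)
    fix w assume "w \<in> Poly_Mapping.keys c"
    then have w: "set w \<in> block_sphere m r" using c by (auto simp: simps_def)
    have "lin (\<lambda>w. orient w ?F) (bdl w) = (\<Sum>v\<in>{..<m * r} - ?F. order_sign v ?F * orient w (insert v ?F))"
      by (rule orient_bdl) (use w in \<open>auto simp: block_sphere_iff [OF r] facet_def\<close>)
    also have "\<dots> = 0"
    proof (rule sum.neutral, rule ballI)
      fix v assume v: "v \<in> {..<m * r} - ?F"
      then have vm: "v mod r = r - 1" "v < m * r" by (auto simp: facet_def)
      have "v div r * r + a \<in> insert v ?F" if "a < r" for a
      proof (cases "a = r - 1")
        case True
        then show ?thesis using vm by (metis div_mult_mod_eq insertI1)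
      next
        case False
        then show ?thesis using block_code [OF that, of "v div r"] block_decode(1) [OF r vm(2)]
          by (simp add: facet_def)
      qed
      then have "insert v ?F \<notin> block_sphere m r"
        using block_decode(1) [OF r vm(2)] by (auto simp: block_sphere_iff [OF r])
      then have "orient w (insert v ?F) = 0" using orient_nonzero w by metis
      then show "order_sign v ?F * orient w (insert v ?F) = 0" by simp
    qed
    finally show "lin (\<lambda>w. orient w ?F) (bdl w) = 0" .
  qed
  finally show ?thesis by simp
qed

definition code :: "nat \<Rightarrow> nat \<times> nat \<Rightarrow> nat" where
  "code r p = snd p div r * r + fst p"

text \<open>A block offers only \<open>r - 1\<close> columns, each used at most once, so no
  placement can reach all \<open>r\<close> rows of it. The extra column \<open>m * r\<close> is
  excluded because its block lies beyond the sphere.\<close>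

lemma code_sphere:
  assumes r: "r > 0" and u: "u \<in> flags m r" and low: "\<forall>p\<in>set u. snd p < m * r"
  shows "code r ` set u \<in> block_sphere m r"
proof -
  have u': "fst p < r" "snd p mod r \<noteq> r - 1" if "p \<in> set u" for p
    using u that by (auto simp: flags_def)
  have cd: "code r p div r = snd p div r" "code r p mod r = fst p" "code r p < m * r" if "p \<in> set u" for p
    using block_code [OF u'(1) [OF that]] block_decode(1) [OF r] low that by (auto simp: code_def)
  have "sorted_wrt (<) (map snd u)" using u by (simp add: flags_def)
  then have "distinct (map snd u)" using strict_sorted_iff by blast
  then have inj: "inj_on snd (set u)" by (simp add: distinct_map)
  have "\<exists>i<r. j * r + i \<notin> code r ` set u" for j
  proof (rule ccontr)
    assume "\<not> (\<exists>i<r. j * r + i \<notin> code r ` set u)"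
    then have all: "j * r + i \<in> code r ` set u" if "i < r" for i using that by blast
    define A where "A = {p \<in> set u. snd p div r = j}"
    have "{..<r} \<subseteq> fst ` A"
    proof
      fix i assume "i \<in> {..<r}"
      then have i: "i < r" by simp
      obtain p where p: "p \<in> set u" "j * r + i = code r p" using all [OF i] by blast
      then have "snd p div r = j" "fst p = i" using cd [OF p(1)] block_code [OF i, of j] by simp_all
      then show "i \<in> fst ` A" using p by (auto simp: A_def)
    qed
    then have "r \<le> card (fst ` A)" using card_mono [of "fst ` A" "{..<r}"] by (simp add: A_def)
    also have "\<dots> \<le> card A" by (rule card_image_le) (simp add: A_def)
    also have "\<dots> = card (snd ` A)" using inj by (intro card_image [symmetric]) (auto simp: A_def inj_on_def)
    also have "\<dots> \<le> card ((\<lambda>i. j * r + i) ` {..<r - 1})"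
    proof (rule card_mono)
      show "snd ` A \<subseteq> (\<lambda>i. j * r + i) ` {..<r - 1}"
      proof
        fix y assume "y \<in> snd ` A"
        then obtain p where p: "p \<in> set u" "snd p div r = j" "y = snd p" by (auto simp: A_def)
        have "y mod r < r" using r by simp
        moreover have "y mod r \<noteq> r - 1" using u'(2) [OF p(1)] p(3) by simp
        ultimately have "y mod r < r - 1" by linarith
        moreover have "y = j * r + y mod r" using p by (metis div_mult_mod_eq)
        ultimately show "y \<in> (\<lambda>i. j * r + i) ` {..<r - 1}" by blast
      qed
    qed simp
    also have "\<dots> \<le> r - 1" using card_image_le [of "{..<r - 1}" "\<lambda>i. j * r + i"] by simp
    finally show False using r by simp
  qed
  moreover have "code r ` set u \<subseteq> {..<m * r}" using cd(3) by auto
  ultimately show ?thesis by (simp add: block_sphere_iff [OF r])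
qed

lemma code_row_shift:
  assumes "r > 0" "fst p < r" "snd p < m * r"
  shows "code r (row_shift r p) = rot m r (code r p)"
  using block_code [OF assms(2), of "snd p div r"] block_decode(1) [OF assms(1,3)]
  by (simp add: code_def row_shift_def rot_def)

section \<open>The fundamental cycle of the join of chessboards\<close>

definition zlist :: "nat \<Rightarrow> nat \<Rightarrow> (nat \<Rightarrow> nat) \<Rightarrow> (nat \<times> nat) list" where
  "zlist m r p = map (\<lambda>y. (p y mod r, y)) (cols m r)"

lemma zlist_flags:
  assumes "r > 0" "p \<in> block_perms m r" shows "zlist m r p \<in> flags m r"
proof -
  have inj: "y = y'" if "p y mod r = p y' mod r" "y div r = y' div r" for y y'
  proof -
    have "p y div r = p y' div r" using assms(2) that by (simp add: block_perms_def)
    then have "p y = p y'" using that by (metis div_mult_mod_eq)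
    then show ?thesis using block_perms_inj [OF assms(2)] by (simp add: injD)
  qed
  show ?thesis
    unfolding flags_def
  proof (intro CollectI conjI ballI impI)
    have "map snd (zlist m r p) = cols m r" by (simp add: zlist_def o_def)
    then show "sorted_wrt (<) (map snd (zlist m r p))" by (simp only: sorted_cols)
  next
    fix v assume "v \<in> set (zlist m r p)"
    then obtain y where y: "y \<in> set (cols m r)" "v = (p y mod r, y)" by (auto simp: zlist_def)
    then show "fst v < r" "snd v \<le> m * r" "snd v mod r \<noteq> r - 1"
      using assms(1) by (auto simp: set_cols)
    fix w assume "w \<in> set (zlist m r p)" and vw: "fst v = fst w \<and> snd v div r = snd w div r"
    then obtain y' where y': "w = (p y' mod r, y')" by (auto simp: zlist_def)
    then show "v = w" using inj [of y y'] y vw by simp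
  qed
qed

lemma map_code_zlist:
  assumes "p \<in> block_perms m r" shows "map (code r) (zlist m r p) = map p (cols m r)"
proof -
  have "y div r * r + p y mod r = p y" for y
    using assms by (metis (mono_tags, lifting) block_perms_def div_mult_mod_eq mem_Collect_eq)
  then show ?thesis by (simp add: zlist_def code_def)
qed

definition zcycle :: "nat \<Rightarrow> nat \<Rightarrow> ((nat \<times> nat) list \<Rightarrow>\<^sub>0 int)" where
  "zcycle m r = (\<Sum>p\<in>block_perms m r. frag_cmul (sign p) (frag_of (zlist m r p)))"

lemma bd_sum: "finite I \<Longrightarrow> bd (sum g I) = (\<Sum>i\<in>I. bd (g i))"
  by (induction I rule: finite_induct) auto

text \<open>Deleting column \<open>y\<close> from \<open>zlist m r p\<close> gives the same list for \<open>p\<close> and for \<open>p\<close> precomposed with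
  the transposition of \<open>y\<close> and the unused last position of its block; the two signs cancel.\<close>

lemma bd_zcycle:
  assumes r: "r > 0" shows "bd (zcycle m r) = 0"
proof -
  let ?Q = "block_perms m r" and ?D = "length (cols m r)"
  define del where "del i p = take i (zlist m r p) @ drop (Suc i) (zlist m r p)" for i p
  have "(\<Sum>p\<in>?Q. frag_cmul (sign p) (frag_of (del i p))) = 0" if i: "i < ?D" for i
  proof -
    define a where "a = cols m r ! i"
    define b where "b = a div r * r + (r - 1)"
    have "a \<in> set (cols m r)" using i by (simp add: a_def)
    then have a: "a < m * r" "a mod r \<noteq> r - 1" by (auto simp: set_cols)
    have b: "b < m * r" "b div r = a div r" "b mod r = r - 1"
      using block_code [of "r - 1" r "a div r"] block_decode(1) [OF r a(1)] r by (auto simp: b_def)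
    let ?\<tau> = "Transposition.transpose a b"
    have ab: "a \<noteq> b" using a b by auto
    have \<tau>: "?\<tau> \<in> ?Q" using transpose_block_perms a b by metis
    have inv: "p \<circ> ?\<tau> \<circ> ?\<tau> = p" for p :: "nat \<Rightarrow> nat" by (simp add: comp_assoc)
    have bij: "bij_betw (\<lambda>p. p \<circ> ?\<tau>) ?Q ?Q"
      by (rule bij_betw_byWitness [where f' = "\<lambda>p. p \<circ> ?\<tau>"])
        (use inv \<tau> block_perms_comp in auto)
    have rest: "take i (cols m r) @ drop (Suc i) (cols m r) = filter (\<lambda>y. y \<noteq> a) (cols m r)"
    proof -
      have split: "cols m r = take i (cols m r) @ a # drop (Suc i) (cols m r)"
        using id_take_nth_drop [OF i] by (simp add: a_def)
      then have "distinct (take i (cols m r) @ a # drop (Suc i) (cols m r))"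
        using distinct_cols by metis
      then have "filter (\<lambda>y. y \<noteq> a) (take i (cols m r)) = take i (cols m r)"
        "filter (\<lambda>y. y \<noteq> a) (drop (Suc i) (cols m r)) = drop (Suc i) (cols m r)"
        by (auto intro!: filter_True)
      then have "filter (\<lambda>y. y \<noteq> a) (take i (cols m r) @ a # drop (Suc i) (cols m r))
         = take i (cols m r) @ drop (Suc i) (cols m r)"
        by simp
      then show ?thesis using split by metis
    qed
    have del: "del i p = map (\<lambda>y. (p y mod r, y)) (filter (\<lambda>y. y \<noteq> a) (cols m r))" for p
      unfolding del_def zlist_def rest [symmetric] by (simp add: take_map drop_map)
    have eq: "del i (p \<circ> ?\<tau>) = del i p" for p
      unfolding del
    proof (rule map_cong [OF refl])
      fix y assume "y \<in> set (filter (\<lambda>y. y \<noteq> a) (cols m r))"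
      then have "y \<noteq> a" "y \<noteq> b" using b by (auto simp: set_cols)
      then show "((p \<circ> ?\<tau>) y mod r, y) = (p y mod r, y)" by (simp add: Transposition.transpose_def)
    qed
    define X where "X = (\<Sum>p\<in>?Q. frag_cmul (sign p) (frag_of (del i p)))"
    have "X = (\<Sum>p\<in>?Q. frag_cmul (sign (p \<circ> ?\<tau>)) (frag_of (del i (p \<circ> ?\<tau>))))"
      unfolding X_def by (rule sum.reindex_bij_betw [OF bij, symmetric])
    also have "\<dots> = (\<Sum>p\<in>?Q. - frag_cmul (sign p) (frag_of (del i p)))"
    proof (rule sum.cong [OF refl])
      fix p assume p: "p \<in> ?Q"
      have "sign (p \<circ> ?\<tau>) = - sign p"
        using block_perms_permutation [OF p] ab by (simp add: sign_compose permutation_swap_id sign_swap_id)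
      then show "frag_cmul (sign (p \<circ> ?\<tau>)) (frag_of (del i (p \<circ> ?\<tau>))) = - frag_cmul (sign p) (frag_of (del i p))"
        by (simp add: eq)
    qed
    also have "\<dots> = - X" unfolding X_def by (rule sum_negf)
    finally have X: "X = - X" .
    have "X = 0"
    proof (rule poly_mapping_eqI)
      fix w
      have "Poly_Mapping.lookup X w = - Poly_Mapping.lookup X w"
        by (subst X) (rule lookup_uminus)
      then show "Poly_Mapping.lookup X w = Poly_Mapping.lookup 0 w" by simp
    qed
    then show ?thesis by (simp add: X_def)
  qed
  note inner = this
  have "bd (zcycle m r) = (\<Sum>p\<in>?Q. frag_cmul (sign p) (bdl (zlist m r p)))"
    by (simp add: zcycle_def bd_sum [OF finite_block_perms])
  also have "\<dots> = (\<Sum>p\<in>?Q. \<Sum>i<?D. frag_cmul ((-1) ^ i) (frag_cmul (sign p) (frag_of (del i p))))"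
  proof (rule sum.cong [OF refl])
    fix p
    have len: "length (zlist m r p) = ?D" by (simp add: zlist_def)
    show "frag_cmul (sign p) (bdl (zlist m r p)) = (\<Sum>i<?D. frag_cmul ((-1) ^ i) (frag_cmul (sign p) (frag_of (del i p))))"
      unfolding bdl_eq_sum [of "zlist m r p"] len del_def frag_cmul_sum by (simp add: mult.commute)
  qed
  also have "\<dots> = (\<Sum>i<?D. frag_cmul ((-1) ^ i) (\<Sum>p\<in>?Q. frag_cmul (sign p) (frag_of (del i p))))"
    by (subst sum.swap) (simp add: frag_cmul_sum)
  also have "\<dots> = 0" using inner by simp
  finally show ?thesis .
qed

lemma frag_extend_sum_of:
  "finite I \<Longrightarrow> frag_extend f (\<Sum>i\<in>I. frag_cmul (k i) (frag_of (x i))) = (\<Sum>i\<in>I. frag_cmul (k i) (f (x i)))"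
  by (simp add: frag_extend_sum o_def frag_extend_cmul)

lemma bd_frag_extend:
  assumes "\<And>w. w \<in> Poly_Mapping.keys c \<Longrightarrow> bd (h w) = g w"
  shows "bd (frag_extend h c) = frag_extend g c"
  unfolding bd_def frag_extend_extend by (rule frag_extend_eq) (use assms in \<open>simp add: bd_def\<close>)

lemma frag_extend_bd: "frag_extend f (bd c) = frag_extend (\<lambda>w. frag_extend f (bdl w)) c"
  by (simp add: bd_def frag_extend_extend)

text \<open>Up to a chain homotopy \<open>h\<close> the map \<open>\<Phi>\<close> agrees with the simplicial map \<open>code\<close> below the top
  dimension, so in the top dimension they differ by an equivariant family \<open>\<delta>\<close> of cycles. On the
  cycle \<open>zcycle\<close> this changes the degree \<open>(r - 1)! ^ m\<close> of \<open>code\<close> by a multiple of \<open>r\<close> only, whereas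
  the degree of \<open>\<Phi>\<close> vanishes because \<open>zcycle\<close> bounds a cone over the last column.\<close>

theorem no_equivariant_chain_map:
  fixes \<Phi> :: "(nat \<times> nat) list \<Rightarrow> (nat list \<Rightarrow>\<^sub>0 int)"
  assumes r: "prime r" and m: "m > 0"
    and keys: "\<And>u. u \<in> flags m r \<Longrightarrow> Poly_Mapping.keys (\<Phi> u) \<subseteq> simps (block_sphere m r) (length u)"
    and nil: "\<Phi> [] = frag_of []"
    and bd\<Phi>: "\<And>u. u \<in> flags m r \<Longrightarrow> bd (\<Phi> u) = frag_extend \<Phi> (bdl u)"
    and eqv: "\<And>u. u \<in> flags m r \<Longrightarrow> \<Phi> (map (row_shift r) u) = lmap (rot m r) (\<Phi> u)"
  shows False
proof -
  have r0: "r > 0" and r2: "r \<ge> 2" using r prime_ge_2_nat by (auto simp: prime_gt_0_nat)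
  define D where "D = m * (r - 1)"
  have D: "D > 0" using m r2 by (simp add: D_def)
  let ?K = "block_sphere m r" and ?T = "rot m r" and ?t = "row_shift r" and ?Q = "block_perms m r"
  \<comment> \<open>The lists on which \<open>code\<close> takes values in the sphere, and on which
    it can be compared with \<open>\<Phi>\<close>.\<close>
  define S where "S = {u \<in> flags m r. \<forall>p\<in>set u. snd p < m * r}"
  define \<alpha> where "\<alpha> u = \<Phi> u - frag_of (map (code r) u)" for u
  have \<alpha>_fun: "\<alpha> = (\<lambda>u. \<Phi> u - frag_of (map (code r) u))" by (simp add: \<alpha>_def fun_eq_iff)
  have S_flags: "u \<in> flags m r" if "u \<in> S" for u using that by (simp add: S_def)
  have S_bdl: "Poly_Mapping.keys (bdl u) \<subseteq> S" if "u \<in> S" for u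
  proof
    fix v assume v: "v \<in> Poly_Mapping.keys (bdl u)"
    have "v \<in> flags m r" using keys_bdl_flags [OF S_flags [OF that]] v by blast
    moreover have "set v \<subseteq> set u" by (rule keys_bdl_set [OF v])
    ultimately show "v \<in> S" using that unfolding S_def by blast
  qed
  have S_shift: "map ?t u \<in> S" if "u \<in> S" for u
    using that row_shift_flags [OF r0] by (auto simp: S_def row_shift_def)
  have \<alpha>_keys: "Poly_Mapping.keys (\<alpha> u) \<subseteq> simps ?K (length u)" if "u \<in> S" for u
    unfolding \<alpha>_def using keys [OF S_flags [OF that]] code_sphere [OF r0 S_flags [OF that]] that
    by (intro keys_diff_subset) (auto simp: simps_def S_def)
  have \<alpha>_eqv: "\<alpha> (map ?t u) = lmap ?T (\<alpha> u)" if "u \<in> S" for u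
  proof -
    have "map (code r) (map ?t u) = map ?T (map (code r) u)"
      using that code_row_shift [OF r0] by (auto simp: S_def flags_def)
    then show ?thesis unfolding \<alpha>_def eqv [OF S_flags [OF that]] lmap_simps by (simp only:)
  qed
  have \<alpha>_bd: "bd (\<alpha> u) = frag_extend \<alpha> (bdl u)" if "u \<in> S" for u
  proof -
    have "frag_extend \<alpha> (bdl u) = frag_extend \<Phi> (bdl u) - lmap (code r) (bdl u)"
      unfolding \<alpha>_fun frag_extend_fun_diff lmap_def ..
    then show ?thesis using bd\<Phi> [OF S_flags [OF that]] by (simp add: \<alpha>_def bdl_map)
  qed
  \<comment> \<open>The homotopy raises lengths by one and the sphere is acyclic only below
    \<open>D\<close>, so the construction stops at lists of length \<open>D - 1\<close>.\<close>
  have "\<exists>h. h [] = 0 \<and> (\<forall>u\<in>S. length u \<le> D - 1 \<longrightarrow> Poly_Mapping.keys (h u) \<subseteq> simps ?K (length u + 1) \<and>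
     h (map ?t u) = lmap ?T (h u) \<and> bd (h u) = \<alpha> u + frag_cmul (-1) (frag_extend h (bdl u)))"
  proof (rule equivariant_extension [where r = r and m = D and \<rho> = fst])
    show "\<And>u. u \<in> S \<Longrightarrow> map ?t u \<in> S \<and> Poly_Mapping.keys (bdl u) \<subseteq> S" using S_shift S_bdl by blast
    show "fst v < r \<and> fst (?t v) = Suc (fst v) mod r \<and> (?t ^^ r) v = v" if "u \<in> S" "v \<in> set u" for u v
    proof -
      have "fst v < r" using that by (auto simp: S_def flags_def)
      then show ?thesis using row_shift_pow [of v r r] by (simp add: row_shift_def)
    qed
    show "\<And>A v. A \<in> ?K \<Longrightarrow> v \<in> A \<Longrightarrow> (?T ^^ r) v = v" using rot_pow_r [OF r0] by blast
    show "acyc ?K D" unfolding D_def by (rule acyc_sphere [OF r0])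
    show "\<And>u. u \<in> S \<Longrightarrow> u \<noteq> [] \<Longrightarrow> Poly_Mapping.keys (\<alpha> u) \<subseteq> simps ?K (length u + 1 - 1) \<and>
        \<alpha> (map ?t u) = lmap ?T (\<alpha> u) \<and> bd (\<alpha> u) = frag_cmul (- (- 1)) (frag_extend \<alpha> (bdl u))"
      using \<alpha>_keys \<alpha>_eqv \<alpha>_bd by simp
    show "bd 0 = \<alpha> []" by (simp add: \<alpha>_def nil)
  qed (use r0 D down_closed_sphere rot_sphere [OF r0] in auto)
  then obtain h where h: "\<And>u. u \<in> S \<Longrightarrow> length u \<le> D - 1 \<Longrightarrow> Poly_Mapping.keys (h u) \<subseteq> simps ?K (length u + 1) \<and>
     h (map ?t u) = lmap ?T (h u) \<and> bd (h u) = \<alpha> u - frag_extend h (bdl u)"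
    by auto
  \<comment> \<open>In length \<open>D\<close> this is the boundary that one more step of the
    homotopy would have to fill; here it is kept as an error term.\<close>
  define \<delta> where "\<delta> u = \<alpha> u - frag_extend h (bdl u)" for u
  have sub: "v \<in> S" "length v = D - 1" if "u \<in> S" "length u = D" "v \<in> Poly_Mapping.keys (bdl u)" for u v
    using that S_bdl keys_bdl_length by fastforce+
  have \<delta>_keys: "Poly_Mapping.keys (\<delta> u) \<subseteq> simps ?K D" if u: "u \<in> S" "length u = D" for u
  proof -
    have "Poly_Mapping.keys (frag_extend h (bdl u)) \<subseteq> simps ?K D"
      by (rule keys_frag_extend_subset) (use h sub [OF u] D in force)
    then show ?thesis unfolding \<delta>_def using \<alpha>_keys [OF u(1)] u(2) by (intro keys_diff_subset) auto
  qed
  have \<delta>_bd: "bd (\<delta> u) = 0" if u: "u \<in> S" "length u = D" for u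
  proof -
    have "bd (frag_extend h (bdl u)) = frag_extend (\<lambda>v. \<alpha> v - frag_extend h (bdl v)) (bdl u)"
      by (rule bd_frag_extend) (use h sub [OF u] in auto)
    also have "\<dots> = frag_extend \<alpha> (bdl u) - frag_extend h (bd (bdl u))"
      by (simp only: frag_extend_fun_diff frag_extend_bd)
    finally show ?thesis using \<alpha>_bd [OF u(1)] by (simp add: \<delta>_def)
  qed
  have \<delta>_eqv: "\<delta> (map ?t u) = lmap ?T (\<delta> u)" if u: "u \<in> S" "length u = D" for u
  proof -
    have "frag_extend h (bdl (map ?t u)) = frag_extend (\<lambda>v. lmap ?T (h v)) (bdl u)"
      unfolding bdl_map frag_extend_lmap by (rule frag_extend_eq) (use h sub [OF u] in auto)
    then show ?thesis using \<alpha>_eqv [OF u(1)] by (simp add: \<delta>_def lmap_frag_extend)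
  qed
  let ?z = "zcycle m r"
  define F where "F = facet m r (\<lambda>_. r - 1)"
  define o' where "o' c = lin (\<lambda>w. orient w F) c" for c
  have zl: "zlist m r p \<in> S" "length (zlist m r p) = D" if "p \<in> ?Q" for p
    using zlist_flags [OF r0 that] length_cols [OF r0, of m] by (auto simp: S_def zlist_def set_cols D_def)
  have \<Phi>z: "frag_extend f ?z = (\<Sum>p\<in>?Q. frag_cmul (sign p) (f (zlist m r p)))" for f :: "_ \<Rightarrow> (nat list \<Rightarrow>\<^sub>0 int)"
    unfolding zcycle_def by (rule frag_extend_sum_of [OF finite_block_perms])
  have o'_sum: "o' (\<Sum>p\<in>?Q. frag_cmul (sign p) (f p)) = (\<Sum>p\<in>?Q. sign p * o' (f p))" for f
    by (simp add: o'_def lin_sum [OF finite_block_perms])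
  have vanish: "o' (frag_extend \<Phi> ?z) = 0"
  proof -
    \<comment> \<open>Column \<open>m * r\<close> is the only one in block \<open>m\<close>, so
      \<open>a\<close> conflicts with no row in use. It is the largest column and goes to the end of
      the list, which produces the sign \<open>(-1) ^ D\<close> in the boundary.\<close>
    define a where "a = (0::nat, m * r)"
    define za where "za = (\<Sum>p\<in>?Q. frag_cmul (sign p) (frag_of (zlist m r p @ [a])))"
    have za_flags: "zlist m r p @ [a] \<in> flags m r" if p: "p \<in> ?Q" for p
    proof -
      have s: "\<forall>v\<in>set (zlist m r p). snd v < m * r" using zl(1) [OF p] by (simp add: S_def)
      then have "\<forall>v\<in>set (zlist m r p). snd v div r < m" using block_decode(1) [OF r0] by blast
      moreover have "snd a div r = m" "snd a mod r \<noteq> r - 1" "fst a < r" using r0 r2 by (auto simp: a_def)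
      moreover have "snd a = m * r" by (simp add: a_def)
      ultimately show ?thesis
        using zlist_flags [OF r0 p] s unfolding flags_def
        by (auto simp: sorted_wrt_append)
    qed
    have bdza: "bd za = frag_cmul ((-1) ^ D) ?z"
    proof -
      have "bd za = (\<Sum>p\<in>?Q. frag_cmul (sign p) (bdl (zlist m r p @ [a])))"
        by (simp add: za_def bd_sum [OF finite_block_perms])
      also have "\<dots> = (\<Sum>p\<in>?Q. frag_cmul (sign p) (frag_extend (\<lambda>u. frag_of (u @ [a])) (bdl (zlist m r p)))
          + frag_cmul ((-1) ^ D) (frag_cmul (sign p) (frag_of (zlist m r p))))"
        by (rule sum.cong [OF refl]) (simp add: bdl_append_frag zl frag_cmul_distrib2 mult.commute)
      also have "\<dots> = (\<Sum>p\<in>?Q. frag_cmul (sign p) (frag_extend (\<lambda>u. frag_of (u @ [a])) (bdl (zlist m r p))))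
          + frag_cmul ((-1) ^ D) ?z"
        by (simp only: sum.distrib zcycle_def frag_cmul_sum o_def)
      also have "(\<Sum>p\<in>?Q. frag_cmul (sign p) (frag_extend (\<lambda>u. frag_of (u @ [a])) (bdl (zlist m r p))))
          = frag_extend (\<lambda>u. frag_of (u @ [a])) (bd ?z)"
        unfolding frag_extend_bd zcycle_def frag_extend_sum_of [OF finite_block_perms] ..
      finally show ?thesis by (simp add: bd_zcycle [OF r0])
    qed
    have za_keys: "u \<in> flags m r \<and> length u = Suc D" if "u \<in> Poly_Mapping.keys za" for u
    proof -
      have "u \<in> (\<Union>p\<in>?Q. Poly_Mapping.keys (frag_cmul (sign p) (frag_of (zlist m r p @ [a]))))"
        using that keys_sum unfolding za_def by (rule rev_subsetD)
      then obtain p where "p \<in> ?Q" "u = zlist m r p @ [a]" by auto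
      then show ?thesis using za_flags zl(2) by simp
    qed
    have 1: "bd (frag_extend \<Phi> za) = frag_extend \<Phi> (bd za)"
      unfolding frag_extend_bd by (rule bd_frag_extend) (use za_keys bd\<Phi> in blast)
    have 2: "Poly_Mapping.keys (frag_extend \<Phi> za) \<subseteq> simps ?K (Suc D)"
      by (rule keys_frag_extend_subset) (use za_keys keys in metis)
    have "(-1) ^ D * o' (frag_extend \<Phi> ?z) = 0"
      using lin_orient_facet_boundary [OF r0 2] by (simp add: 1 bdza frag_extend_cmul o'_def F_def)
    then show ?thesis by simp
  qed
  have degree: "(\<Sum>p\<in>?Q. sign p * o' (frag_of (map (code r) (zlist m r p)))) = fact (r - 1) ^ m * orient (cols m r) F"
  proof -
    let ?Q' = "{p \<in> ?Q. p ` set (cols m r) = set (cols m r)}"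
    have F: "F = set (cols m r)" unfolding F_def by (rule facet_cols)
    have 1: "sign p * o' (frag_of (map (code r) (zlist m r p))) = sign p * orient (map p (cols m r)) F" if "p \<in> ?Q" for p
      using map_code_zlist [OF that] by (simp add: o'_def)
    have 2: "sign p * orient (map p (cols m r)) F = 0" if "p \<in> ?Q - ?Q'" for p
      using that orient_nonzero [of "map p (cols m r)" F] by (auto simp: F)
    \<comment> \<open>Here \<open>p\<close> fixes every point outside \<open>F\<close>, so it is a
      permutation of \<open>F\<close>, and the sign from \<open>orient_permutes\<close> cancels the
      coefficient \<open>sign p\<close>.\<close>
    have 3: "sign p * orient (map p (cols m r)) F = orient (cols m r) F" if p: "p \<in> ?Q'" for p
    proof -
      have fix_last: "p y = y" if y: "y \<notin> F" for y
      proof (cases "y < m * r")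
        case True
        have "inj p" using p block_perms_inj [of p m r] by simp
        then have "p y \<notin> p ` F" using y by (simp add: inj_image_mem_iff)
        then have "p y \<notin> F" using p F by simp
        moreover have "p y < m * r" "p y div r = y div r" using p block_perms_less True by (auto simp: block_perms_def)
        ultimately have "p y mod r = y mod r" using y True by (simp add: F set_cols)
        then show ?thesis using \<open>p y div r = y div r\<close> by (metis div_mult_mod_eq)
      next
        case False
        then show ?thesis using p by (auto simp: block_perms_def permutes_def)
      qed
      have "inj p" using p block_perms_inj [of p m r] by simp
      then have "inj_on p F" by (rule inj_on_subset) simp
      moreover have "p ` F = F" using p unfolding F by simp
      ultimately have "bij_betw p F F" unfolding bij_betw_def ..
      then have "p permutes F" using fix_last by (rule bij_imp_permutes)
      moreover have "finite F" by (simp add: F_def)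
      ultimately have "orient (map p (cols m r)) F = sign p * orient (cols m r) F" by (rule orient_permutes [rotated])
      then show ?thesis by (simp flip: mult.assoc)
    qed
    have "(\<Sum>p\<in>?Q. sign p * o' (frag_of (map (code r) (zlist m r p)))) = (\<Sum>p\<in>?Q. sign p * orient (map p (cols m r)) F)"
      by (rule sum.cong [OF refl 1])
    also have "\<dots> = (\<Sum>p\<in>?Q'. sign p * orient (map p (cols m r)) F)"
      by (rule sum.mono_neutral_right) (use finite_block_perms 2 in auto)
    also have "\<dots> = (\<Sum>p\<in>?Q'. orient (cols m r) F)" by (rule sum.cong [OF refl 3])
    finally show ?thesis by (simp add: card_block_perms_facet [OF r0])
  qed
  have dvd: "int r dvd (\<Sum>p\<in>?Q. sign p * o' (\<delta> (zlist m r p)))"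
  proof (rule dvd_sum_cyclic [where f = "\<lambda>p. ?T \<circ> p" and lab = "\<lambda>p. p 0 mod r"])
    show "finite ?Q" by (rule finite_block_perms)
    have T: "?T \<in> ?Q" by (rule rot_block_perms [OF r0])
    show "\<And>p. p \<in> ?Q \<Longrightarrow> ?T \<circ> p \<in> ?Q" by (rule block_perms_comp [OF T])
    have Tinj: "inj ?T" by (rule block_perms_inj [OF T])
    show "inj_on (\<lambda>p. ?T \<circ> p) ?Q"
    proof (rule inj_onI)
      fix p q assume "?T \<circ> p = ?T \<circ> q"
      then show "p = q" using Tinj by (metis inj_iff fun.map_comp fun.map_id)
    qed
    show "\<And>p. p \<in> ?Q \<Longrightarrow> p 0 mod r < r" using r0 by simp
    fix p assume p: "p \<in> ?Q"
    have less: "p y < m * r" if "y < m * r" for y using block_perms_less [OF p that] .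
    show "(?T \<circ> p) 0 mod r = Suc (p 0 mod r) mod r"
      using rot_props(3) [OF r0 less] m r0 by simp
    have "zlist m r (?T \<circ> p) = map ?t (zlist m r p)"
      unfolding zlist_def using rot_props(3) [OF r0 less] by (auto simp: row_shift_def set_cols)
    then have \<delta>: "\<delta> (zlist m r (?T \<circ> p)) = lmap ?T (\<delta> (zlist m r p))" using \<delta>_eqv zl [OF p] by simp
    have "sign (?T \<circ> p) = sign ?T * sign p"
      using sign_compose block_perms_permutation T p by blast
    define x where "x = o' (\<delta> (zlist m r p))"
    define x' where "x' = o' (lmap ?T (\<delta> (zlist m r p)))"
    have "int r dvd x' - x"
      unfolding x_def x'_def o'_def F_def
      by (rule orient_rot_dvd [OF r]) (use r0 \<delta>_keys \<delta>_bd zl [OF p] in auto)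
    \<comment> \<open>Since \<open>?T ^^ r = id\<close>, the sign of the rotation is
      \<open>1\<close> unless \<open>r = 2\<close>, and then \<open>-1\<close> and \<open>1\<close>
      agree modulo \<open>r\<close>.\<close>
    moreover have "int r dvd sign ?T - 1"
    proof (cases "sign ?T = 1")
      case False
      then have s: "sign ?T = -1" by (simp add: sign_def split: if_splits)
      have pow: "permutation (?T ^^ i) \<and> sign (?T ^^ i) = sign ?T ^ i" for i
      proof (induction i)
        case (Suc i)
        then show ?case
          unfolding funpow.simps(2) power_Suc
          using block_perms_permutation [OF T] sign_compose permutation_compose by metis
      qed (simp add: sign_id)
      have "?T ^^ r = id" using rot_pow_r [OF r0] by (simp add: fun_eq_iff)
      then have "(-1::int) ^ r = 1" using pow [of r] s by (simp add: sign_id)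
      then have "even r" by (metis (no_types) one_neq_neg_one power_minus_odd power_one)
      then have "r = 2" using r primes_dvd_imp_eq two_is_prime_nat by blast
      then show ?thesis using s by simp
    qed simp
    ultimately have "int r dvd sign p * (sign ?T * (x' - x) + (sign ?T - 1) * x)"
      using dvd_add [OF dvd_mult dvd_mult2] dvd_mult by blast
    also have "sign p * (sign ?T * (x' - x) + (sign ?T - 1) * x) = sign (?T \<circ> p) * x' - sign p * x"
      by (simp add: \<open>sign (?T \<circ> p) = sign ?T * sign p\<close> algebra_simps)
    finally show "int r dvd sign (?T \<circ> p) * o' (\<delta> (zlist m r (?T \<circ> p))) - sign p * o' (\<delta> (zlist m r p))"
      by (simp only: \<delta> x_def x'_def)
  qed
  have decomp: "\<Phi> u = \<delta> u + frag_of (map (code r) u) + frag_extend h (bdl u)" for u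
    by (simp add: \<delta>_def \<alpha>_def)
  have "frag_extend \<Phi> ?z = (\<Sum>p\<in>?Q. frag_cmul (sign p) (\<delta> (zlist m r p)))
     + (\<Sum>p\<in>?Q. frag_cmul (sign p) (frag_of (map (code r) (zlist m r p))))
     + (\<Sum>p\<in>?Q. frag_cmul (sign p) (frag_extend h (bdl (zlist m r p))))"
    unfolding \<Phi>z by (subst decomp) (simp only: frag_cmul_distrib2 sum.distrib)
  also have "(\<Sum>p\<in>?Q. frag_cmul (sign p) (frag_extend h (bdl (zlist m r p)))) = frag_extend h (bd ?z)"
    unfolding frag_extend_bd \<Phi>z ..
  finally have "frag_extend \<Phi> ?z = (\<Sum>p\<in>?Q. frag_cmul (sign p) (\<delta> (zlist m r p)))
     + (\<Sum>p\<in>?Q. frag_cmul (sign p) (frag_of (map (code r) (zlist m r p))))"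
    by (simp add: bd_zcycle [OF r0])
  then have "0 = o' (\<Sum>p\<in>?Q. frag_cmul (sign p) (\<delta> (zlist m r p)))
     + o' (\<Sum>p\<in>?Q. frag_cmul (sign p) (frag_of (map (code r) (zlist m r p))))"
    using vanish by (simp add: o'_def)
  then have "0 = (\<Sum>p\<in>?Q. sign p * o' (\<delta> (zlist m r p))) + fact (r - 1) ^ m * orient (cols m r) F"
    by (simp only: o'_sum degree)
  then have "fact (r - 1) ^ m * orient (cols m r) F = - (\<Sum>p\<in>?Q. sign p * o' (\<delta> (zlist m r p)))"
    by linarith
  then have "int r dvd fact (r - 1) ^ m * orient (cols m r) F"
    using dvd by simp
  then have dvd': "int r dvd fact (r - 1) ^ m * orient (cols m r) F * orient (cols m r) F"
    by (rule dvd_mult2)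
  have "orient (cols m r) F * orient (cols m r) F = 1"
    using orient_square [OF distinct_cols, of m r] unfolding F_def facet_cols .
  then have "int r dvd fact (r - 1) ^ m" using dvd' by (simp only: mult.assoc mult.right_neutral)
  then have "int r dvd int (fact (r - 1) ^ m)" by simp
  then have "r dvd fact (r - 1) ^ m" using int_dvd_int_iff by blast
  then have "r dvd fact (r - 1)" using r prime_dvd_power by blast
  then have "r \<le> r - 1" using r prime_dvd_fact_iff by blast
  then show False using r0 by simp
qed

section \<open>Chain maps from labellings\<close>

definition realization :: "'v set \<Rightarrow> 'v set set \<Rightarrow> ('v \<Rightarrow> real) set" where
  "realization U X = {x. (\<forall>v. 0 \<le> x v) \<and> {v. x v \<noteq> 0} \<in> X \<and> sum x U = 1}"

definition realization_space :: "'v set \<Rightarrow> 'v set set \<Rightarrow> ('v \<Rightarrow> real) topology" where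
  "realization_space U X = subtopology (powertop_real UNIV) (realization U X)"

text \<open>The linear singular simplex with corners \<open>w\<close>; a repeated vertex collects
  the coordinates of all its occurrences. The restriction makes it extensional, as singular
  simplices have to be.\<close>

definition affine_map :: "'v list \<Rightarrow> (nat \<Rightarrow> real) \<Rightarrow> ('v \<Rightarrow> real)" where
  "affine_map w = restrict (\<lambda>x v. \<Sum>j<length w. if w ! j = v then x j else 0) (standard_simplex (length w - 1))"

definition corner :: "nat \<Rightarrow> nat \<Rightarrow> real" where
  "corner j = (\<lambda>i. if i = j then 1 else 0)"

definition label_list :: "(('v \<Rightarrow> real) \<Rightarrow> 'l) \<Rightarrow> nat \<Rightarrow> ((nat \<Rightarrow> real) \<Rightarrow> ('v \<Rightarrow> real)) \<Rightarrow> 'l list" where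
  "label_list \<Lambda> p \<sigma> = map (\<lambda>j. \<Lambda> (\<sigma> (corner j))) [0..<Suc p]"

text \<open>Simplicial approximation on chains: each singular simplex is replaced by the labels of
  its corners, which is sensible once the simplices are small.\<close>

definition label_chain :: "(('v \<Rightarrow> real) \<Rightarrow> 'l) \<Rightarrow> nat \<Rightarrow> ('v \<Rightarrow> real) chain \<Rightarrow> ('l list \<Rightarrow>\<^sub>0 int)" where
  "label_chain \<Lambda> p = frag_extend (\<lambda>\<sigma>. frag_of (label_list \<Lambda> p \<sigma>))"

lemma corner_in [simp]: "j \<le> p \<Longrightarrow> corner j \<in> standard_simplex p"
  by (simp add: corner_def)

lemma topspace_realization [simp]: "topspace (realization_space U X) = realization U X"
  by (simp add: realization_space_def)

lemma sum_skip:
  fixes g :: "nat \<Rightarrow> 'b::comm_monoid_add"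
  assumes "k \<le> p"
  shows "(\<Sum>j<Suc p. g j) = g k + (\<Sum>j<p. g (if j < k then j else Suc j))"
proof -
  let ?s = "\<lambda>j. if j < k then j else Suc j"
  have "inj_on ?s {..<p}" by (auto simp: inj_on_def split: if_splits)
  have "?s ` {..<p} = {..<Suc p} - {k}"
  proof (intro equalityI subsetI)
    fix j assume j: "j \<in> {..<Suc p} - {k}"
    show "j \<in> ?s ` {..<p}"
    proof (cases "j < k")
      case True
      then show ?thesis using assms by (intro image_eqI [of _ _ j]) auto
    next
      case False
      then show ?thesis using j by (intro image_eqI [of _ _ "j - 1"]) auto
    qed
  qed (use assms in \<open>auto split: if_splits\<close>)
  then have "sum g ({..<Suc p} - {k}) = (\<Sum>j<p. g (?s j))"
    using sum.reindex [OF \<open>inj_on ?s {..<p}\<close>, of g] by (simp add: o_def)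
  then show ?thesis using sum.remove [of "{..<Suc p}" k g] assms by simp
qed

lemma nth_delete:
  assumes "k < length w" "j < length w - 1"
  shows "(take k w @ drop (Suc k) w) ! j = w ! (if j < k then j else Suc j)"
  using assms by (auto simp: nth_append)

lemma singular_face_affine_map:
  assumes "length w \<ge> 2" "k < length w"
  shows "singular_face (length w - 1) k (affine_map w) = affine_map (take k w @ drop (Suc k) w)"
proof
  fix x
  let ?p = "length w - 1"
  let ?w' = "take k w @ drop (Suc k) w"
  have len: "length ?w' = ?p" using assms by simp
  show "singular_face ?p k (affine_map w) x = affine_map ?w' x"
  proof (cases "x \<in> standard_simplex (?p - 1)")
    case True
    then have face: "simplical_face k x \<in> standard_simplex ?p"
      using assms by (intro simplical_face_in_standard_simplex) auto
    have Suc_p: "Suc ?p = length w" and "k \<le> ?p" using assms by auto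
    have "(\<Sum>j<length w. if w ! j = v then simplical_face k x j else 0) = (\<Sum>j<?p. if ?w' ! j = v then x j else 0)" for v
    proof -
      have "(\<Sum>j<length w. if w ! j = v then simplical_face k x j else 0)
          = (\<Sum>j<Suc ?p. if w ! j = v then simplical_face k x j else 0)" by (simp only: Suc_p)
      also have "\<dots> = (\<Sum>j<?p. if w ! (if j < k then j else Suc j) = v
            then simplical_face k x (if j < k then j else Suc j) else 0)"
        unfolding sum_skip [OF \<open>k \<le> ?p\<close>] by (simp add: simplical_face_def)
      also have "\<dots> = (\<Sum>j<?p. if ?w' ! j = v then x j else 0)"
      proof (rule sum.cong [OF refl])
        fix j assume "j \<in> {..<?p}"
        then have "?w' ! j = w ! (if j < k then j else Suc j)" using assms by (intro nth_delete) auto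
        moreover have "simplical_face k x (if j < k then j else Suc j) = x j" by (simp add: simplical_face_def)
        ultimately show "(if w ! (if j < k then j else Suc j) = v
            then simplical_face k x (if j < k then j else Suc j) else 0) = (if ?w' ! j = v then x j else 0)"
          by (simp only:)
      qed
      finally show ?thesis .
    qed
    then show ?thesis using True face len by (simp add: singular_face_def affine_map_def)
  next
    case False
    then show ?thesis using len by (simp add: singular_face_def affine_map_def)
  qed
qed

lemma affine_map_simplex:
  assumes X: "down_closed X" and U: "finite U" "set w \<subseteq> U" and w: "w \<noteq> []" "set w \<in> X"
  shows "singular_simplex (length w - 1) (realization_space U X) (affine_map w)"
  unfolding singular_simplex_def
proof
  let ?p = "length w - 1"
  let ?f = "\<lambda>x v. \<Sum>j<length w. if w ! j = v then x j else (0::real)"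
  have "continuous_map (powertop_real UNIV) euclideanreal (\<lambda>x. ?f x v)" for v
    by (intro continuous_map_sum) (auto intro: continuous_map_product_projection)
  then have "continuous_map (subtopology (powertop_real UNIV) (standard_simplex ?p)) (powertop_real UNIV) ?f"
    by (auto simp: continuous_map_componentwise_UNIV intro: continuous_map_from_subtopology)
  moreover have "?f x \<in> realization U X" if x: "x \<in> standard_simplex ?p" for x
  proof -
    have x0: "0 \<le> x j" for j using x by (simp add: standard_simplex_def)
    have "{v. ?f x v \<noteq> 0} \<subseteq> set w"
    proof
      fix v assume v: "v \<in> {v. ?f x v \<noteq> 0}"
      show "v \<in> set w"
      proof (rule ccontr)
        assume "v \<notin> set w"
        then have "?f x v = 0" by (intro sum.neutral) auto
        then show False using v by simp
      qed
    qed
    then have "{v. ?f x v \<noteq> 0} \<in> X" by (rule down_closedD [OF X w(2)])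
    moreover have "sum (?f x) U = 1"
    proof -
      have range: "{..<length w} = {..?p}" using w(1) by (cases w) auto
      have "sum (?f x) U = (\<Sum>j<length w. \<Sum>v\<in>U. if w ! j = v then x j else 0)" by (rule sum.swap)
      also have "\<dots> = (\<Sum>j<length w. x j)"
        by (rule sum.cong) (use U in \<open>auto simp: sum.delta' nth_mem subset_iff\<close>)
      also have "\<dots> = 1" using x range by (simp add: standard_simplex_def)
      finally show ?thesis .
    qed
    moreover have "\<forall>v. 0 \<le> ?f x v" by (intro allI sum_nonneg) (simp add: x0)
    ultimately show ?thesis unfolding realization_def by blast
  qed
  ultimately have "continuous_map (subtopology (powertop_real UNIV) (standard_simplex ?p)) (realization_space U X) ?f"
    by (auto simp: realization_space_def continuous_map_in_subtopology)
  then show "continuous_map (subtopology (powertop_real UNIV) (standard_simplex ?p)) (realization_space U X) (affine_map w)"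
    by (rule continuous_map_eq) (simp add: affine_map_def)
  show "affine_map w \<in> extensional (standard_simplex ?p)" by (simp add: affine_map_def)
qed

text \<open>The lengths start at two because singular chains are not augmented: in dimension zero
  the left side vanishes, whereas \<open>bdl [v]\<close> is the empty list.\<close>

lemma chain_boundary_affine_map:
  assumes "length w \<ge> 2"
  shows "chain_boundary (length w - 1) (frag_of (affine_map w)) = frag_extend (\<lambda>u. frag_of (affine_map u)) (bdl w)"
proof -
  have "{..length w - 1} = {..<length w}" using assms by auto
  then have "chain_boundary (length w - 1) (frag_of (affine_map w))
     = (\<Sum>k<length w. frag_cmul ((-1) ^ k) (frag_of (singular_face (length w - 1) k (affine_map w))))"
    using assms by (simp add: chain_boundary_of)
  also have "\<dots> = (\<Sum>k<length w. frag_cmul ((-1) ^ k) (frag_of (affine_map (take k w @ drop (Suc k) w))))"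
  proof (rule sum.cong [OF refl])
    fix k assume "k \<in> {..<length w}"
    then show "frag_cmul ((-1) ^ k) (frag_of (singular_face (length w - 1) k (affine_map w)))
        = frag_cmul ((-1) ^ k) (frag_of (affine_map (take k w @ drop (Suc k) w)))"
      using singular_face_affine_map [OF assms, of k] by (simp only: lessThan_iff)
  qed
  also have "\<dots> = frag_extend (\<lambda>u. frag_of (affine_map u)) (bdl w)"
    by (simp add: bdl_eq_sum frag_extend_sum_of)
  finally show ?thesis .
qed

lemma simplical_face_corner:
  "simplical_face k (corner j) = corner (if j < k then j else Suc j)"
  by (auto simp: simplical_face_def corner_def fun_eq_iff)

lemma label_list_singular_face:
  assumes "p > 0" "k \<le> p"
  shows "label_list \<Lambda> (p - 1) (singular_face p k \<sigma>) = take k (label_list \<Lambda> p \<sigma>) @ drop (Suc k) (label_list \<Lambda> p \<sigma>)"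
proof (rule nth_equalityI)
  show "length (label_list \<Lambda> (p - 1) (singular_face p k \<sigma>))
      = length (take k (label_list \<Lambda> p \<sigma>) @ drop (Suc k) (label_list \<Lambda> p \<sigma>))"
    using assms by (simp add: label_list_def)
  fix j assume "j < length (label_list \<Lambda> (p - 1) (singular_face p k \<sigma>))"
  then have j: "j < p" using assms by (simp add: label_list_def)
  have len: "length (label_list \<Lambda> p \<sigma>) = Suc p" by (simp add: label_list_def)
  have "label_list \<Lambda> (p - 1) (singular_face p k \<sigma>) ! j = \<Lambda> (\<sigma> (simplical_face k (corner j)))"
    using j assms by (simp add: label_list_def singular_face_def nth_append del: upt_Suc)
  also have "\<dots> = label_list \<Lambda> p \<sigma> ! (if j < k then j else Suc j)"
    unfolding simplical_face_corner using j assms by (simp add: label_list_def del: upt_Suc)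
  also have "\<dots> = (take k (label_list \<Lambda> p \<sigma>) @ drop (Suc k) (label_list \<Lambda> p \<sigma>)) ! j"
    using j assms len by (intro nth_delete [symmetric]) auto
  finally show "label_list \<Lambda> (p - 1) (singular_face p k \<sigma>) ! j
      = (take k (label_list \<Lambda> p \<sigma>) @ drop (Suc k) (label_list \<Lambda> p \<sigma>)) ! j" .
qed

lemma bd_label_chain:
  fixes \<Lambda> :: "('v \<Rightarrow> real) \<Rightarrow> 'l"
  assumes "p > 0"
  shows "bd (label_chain \<Lambda> p c) = label_chain \<Lambda> (p - 1) (chain_boundary p c)"
proof (rule frag_induction [of c UNIV])
  fix \<sigma> :: "(nat \<Rightarrow> real) \<Rightarrow> 'v \<Rightarrow> real"
  have len: "length (label_list \<Lambda> p \<sigma>) = Suc p" by (simp add: label_list_def)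
  have "bd (label_chain \<Lambda> p (frag_of \<sigma>))
     = (\<Sum>k<Suc p. frag_cmul ((-1) ^ k) (frag_of (take k (label_list \<Lambda> p \<sigma>) @ drop (Suc k) (label_list \<Lambda> p \<sigma>))))"
    by (simp only: label_chain_def frag_extend_of bd_simps bdl_eq_sum len)
  also have "\<dots> = (\<Sum>k\<le>p. frag_cmul ((-1) ^ k) (frag_of (label_list \<Lambda> (p - 1) (singular_face p k \<sigma>))))"
    unfolding lessThan_Suc_atMost
    by (rule sum.cong [OF refl]) (simp only: atMost_iff label_list_singular_face [OF assms])
  also have "\<dots> = label_chain \<Lambda> (p - 1) (chain_boundary p (frag_of \<sigma>))"
    using assms by (simp add: label_chain_def chain_boundary_of frag_extend_sum_of)
  finally show "bd (label_chain \<Lambda> p (frag_of \<sigma>)) = label_chain \<Lambda> (p - 1) (chain_boundary p (frag_of \<sigma>))" .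
qed (simp_all add: label_chain_def frag_extend_diff chain_boundary_diff)

section \<open>Iterated subdivision and simplicial approximation\<close>

lemma singular_chain_subdivision_power:
  "singular_chain p X c \<Longrightarrow> singular_chain p X ((singular_subdivision p ^^ n) c)"
  by (induction n) (auto simp: singular_chain_singular_subdivision)

lemma chain_boundary_subdivision_power:
  assumes "singular_chain p X c"
  shows "chain_boundary p ((singular_subdivision p ^^ n) c) = (singular_subdivision (p - 1) ^^ n) (chain_boundary p c)"
proof (induction n)
  case (Suc n)
  then show ?case
    using chain_boundary_singular_subdivision [OF singular_chain_subdivision_power [OF assms, of n]] by simp
qed simp

lemma chain_map_subdivision_power:
  assumes "singular_chain p X c"
  shows "(singular_subdivision p ^^ n) (chain_map p g c) = chain_map p g ((singular_subdivision p ^^ n) c)"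
proof (induction n)
  case (Suc n)
  then show ?case
    using naturality_singular_subdivision [OF singular_chain_subdivision_power [OF assms, of n], of g] by simp
qed simp

lemma subdivision_power_extend:
  "(singular_subdivision p ^^ n) (frag_extend g c) = frag_extend (\<lambda>w. (singular_subdivision p ^^ n) (g w)) c"
  by (rule frag_induction [of c UNIV]) (auto simp: frag_extend_diff singular_subdivision_power_diff)

lemma label_chain_chain_map:
  assumes c: "singular_chain p Y c" and \<Lambda>: "\<And>x. x \<in> topspace Y \<Longrightarrow> \<Lambda> (act x) = T (\<Lambda> x)"
  shows "label_chain \<Lambda> p (chain_map p act c) = lmap T (label_chain \<Lambda> p c)"
  using c unfolding singular_chain_def
proof (induction c rule: frag_induction)
  case (one \<sigma>)
  have "\<sigma> (corner j) \<in> topspace Y" if "j \<le> p" for j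
    using one corner_in [OF that] by (auto simp: singular_simplex_def continuous_map_def)
  then have "label_list \<Lambda> p (simplex_map p act \<sigma>) = map T (label_list \<Lambda> p \<sigma>)"
    using \<Lambda> by (auto simp: label_list_def simplex_map_def)
  then show ?case by (simp add: label_chain_def)
qed (auto simp: label_chain_def frag_extend_diff chain_map_diff)

text \<open>Subdivide until every small simplex lies in an open set whose labels span a simplex of
  \<open>P\<close>, then read off labels. Subdivision commutes with boundaries and with maps, so the
  result is an equivariant chain map. Vertices move by \<open>t\<close>, hence coordinates are
  pulled back along \<open>s\<close>, its inverse on \<open>U\<close>. The bound \<open>L\<close>
  leaves finitely many lists, so that one number of subdivisions suits them all.\<close>

lemma chain_map_from_labelling:
  fixes \<Lambda> :: "('v \<Rightarrow> real) \<Rightarrow> 'l"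
  assumes X: "down_closed X" "finite U" "\<And>A. A \<in> X \<Longrightarrow> A \<subseteq> U" and P: "down_closed P" "{} \<in> P"
    and cover: "\<And>x. x \<in> realization U X \<Longrightarrow> \<exists>V. openin (realization_space U X) V \<and> x \<in> V \<and> \<Lambda> ` V \<in> P"
    and act: "\<And>u v. u \<in> U \<Longrightarrow> u = s v \<longleftrightarrow> t u = v"
    and \<Lambda>: "\<And>x. x \<in> realization U X \<Longrightarrow> \<Lambda> (\<lambda>v. x (s v)) = T (\<Lambda> x)"
  obtains \<phi> where "\<phi> [] = frag_of []"
    and "\<And>w. set w \<in> X \<Longrightarrow> length w \<le> L \<Longrightarrow> Poly_Mapping.keys (\<phi> w) \<subseteq> simps P (length w)"
    and "\<And>w. set w \<in> X \<Longrightarrow> length w \<le> L \<Longrightarrow> bd (\<phi> w) = frag_extend \<phi> (bdl w)"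
    and "\<And>w. set w \<in> X \<Longrightarrow> length w \<le> L \<Longrightarrow> \<phi> (map t w) = lmap T (\<phi> w)"
proof -
  let ?Y = "realization_space U X"
  define W where "W = {w. set w \<in> X \<and> length w \<le> L \<and> w \<noteq> []}"
  have "W \<subseteq> {w. set w \<subseteq> U \<and> length w \<le> L}" using X(3) by (auto simp: W_def)
  then have finW: "finite W" using finite_lists_length_le [OF X(2)] finite_subset by blast
  have sing: "singular_chain (length w - 1) ?Y (frag_of (affine_map w))" if "w \<in> W" for w
    using affine_map_simplex [OF X(1,2), of w] that X(3) by (auto simp: W_def singular_chain_of)
  define small where "small w n \<longleftrightarrow> (\<forall>m\<ge>n. \<forall>f\<in>Poly_Mapping.keys ((singular_subdivision (length w - 1) ^^ m) (frag_of (affine_map w))).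
      \<exists>V. openin ?Y V \<and> \<Lambda> ` V \<in> P \<and> f \<in> standard_simplex (length w - 1) \<rightarrow> V)" for w :: "'v list" and n
  have "\<exists>n. small w n" if w: "w \<in> W" for w
  proof -
    have "topspace ?Y \<subseteq> \<Union>{V. openin ?Y V \<and> \<Lambda> ` V \<in> P}" using cover by auto
    then obtain n where "\<And>m f. n \<le> m \<Longrightarrow> f \<in> Poly_Mapping.keys ((singular_subdivision (length w - 1) ^^ m) (frag_of (affine_map w)))
        \<Longrightarrow> \<exists>V\<in>{V. openin ?Y V \<and> \<Lambda> ` V \<in> P}. f \<in> standard_simplex (length w - 1) \<rightarrow> V"
      using sufficient_iterated_singular_subdivision_exists
        [of "{V. openin ?Y V \<and> \<Lambda> ` V \<in> P}", OF _ _ sing [OF w]] by blast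
    then have "small w n" unfolding small_def by simp
    then show ?thesis by blast
  qed
  then obtain N where N: "\<And>w. w \<in> W \<Longrightarrow> small w (N w)" by metis
  \<comment> \<open>One exponent for all lists, needed for compatibility with boundaries; smallness
    persists under further subdivision, so any common upper bound of the \<open>N w\<close> will
    do.\<close>
  define n where "n = (\<Sum>w\<in>W. N w)"
  have n: "N w \<le> n" if "w \<in> W" for w
    unfolding n_def using finW that by (intro member_le_sum) auto
  define \<psi> where "\<psi> w = (singular_subdivision (length w - 1) ^^ n) (frag_of (affine_map w))" for w :: "'v list"
  \<comment> \<open>The empty list is not a singular simplex; sending it to itself preserves the
    augmentation.\<close>
  define \<phi> where "\<phi> w = (if w = [] then frag_of [] else label_chain \<Lambda> (length w - 1) (\<psi> w))" for w
  have \<psi>_sing: "singular_chain (length w - 1) ?Y (\<psi> w)" if "w \<in> W" for w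
    unfolding \<psi>_def by (rule singular_chain_subdivision_power [OF sing [OF that]])
  show thesis
  proof (rule that [of \<phi>])
    show \<phi>0: "\<phi> [] = frag_of []" by (simp add: \<phi>_def)
    fix w assume w: "set w \<in> X" "length w \<le> L"
    show "Poly_Mapping.keys (\<phi> w) \<subseteq> simps P (length w)"
    proof (cases "w = []")
      case True
      then show ?thesis using P(2) by (simp add: \<phi>_def simps_def)
    next
      case False
      then have wW: "w \<in> W" using w by (simp add: W_def)
      show ?thesis
        unfolding \<phi>_def label_chain_def if_not_P [OF False]
      proof (rule keys_frag_extend_subset)
        fix \<sigma> assume \<sigma>: "\<sigma> \<in> Poly_Mapping.keys (\<psi> w)"
        then obtain V where V: "\<Lambda> ` V \<in> P" "\<sigma> \<in> standard_simplex (length w - 1) \<rightarrow> V"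
          using N [OF wW] n [OF wW] unfolding \<psi>_def small_def by blast
        have "set (label_list \<Lambda> (length w - 1) \<sigma>) \<subseteq> \<Lambda> ` V"
          using V(2) by (auto simp: label_list_def less_Suc_eq_le simp del: upt_Suc)
        then have "set (label_list \<Lambda> (length w - 1) \<sigma>) \<in> P" using down_closedD [OF P(1) V(1)] by blast
        moreover have "length (label_list \<Lambda> (length w - 1) \<sigma>) = length w"
          using False by (simp add: label_list_def)
        ultimately show "Poly_Mapping.keys (frag_of (label_list \<Lambda> (length w - 1) \<sigma>)) \<subseteq> simps P (length w)"
          by (simp add: simps_def)
      qed
    qed
    show "bd (\<phi> w) = frag_extend \<phi> (bdl w)"
    proof -
      consider "w = []" | v where "w = [v]" | "length w \<ge> 2"
        by (cases w rule: remdups_adj.cases) auto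
      then show ?thesis
      proof cases
        case 2
        then have "w \<in> W" using w by (simp add: W_def)
        then have "singular_chain 0 ?Y (frag_of (affine_map [v]))" using sing 2 by fastforce
        then have "\<psi> [v] = frag_of (affine_map [v])"
          unfolding \<psi>_def by (induction n) (auto simp: singular_subdivision_zero)
        then show ?thesis using 2 by (simp add: \<phi>_def label_chain_def label_list_def)
      next
        case 3
        then have ne: "w \<noteq> []" and wW: "w \<in> W" using w by (auto simp: W_def)
        let ?p = "length w - 1"
        have "bd (\<phi> w) = label_chain \<Lambda> (?p - 1) (chain_boundary ?p (\<psi> w))"
          using 3 ne by (simp add: \<phi>_def bd_label_chain)
        also have "chain_boundary ?p (\<psi> w) = (singular_subdivision (?p - 1) ^^ n) (frag_extend (\<lambda>u. frag_of (affine_map u)) (bdl w))"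
          unfolding \<psi>_def chain_boundary_subdivision_power [OF sing [OF wW]] chain_boundary_affine_map [OF 3] ..
        also have "\<dots> = frag_extend \<psi> (bdl w)"
          unfolding subdivision_power_extend
        proof (rule frag_extend_eq)
          fix u assume "u \<in> Poly_Mapping.keys (bdl w)"
          then have "length u = ?p" using keys_bdl_length by fastforce
          then show "(singular_subdivision (?p - 1) ^^ n) (frag_of (affine_map u)) = \<psi> u" by (simp add: \<psi>_def)
        qed
        also have "label_chain \<Lambda> (?p - 1) (frag_extend \<psi> (bdl w)) = frag_extend \<phi> (bdl w)"
          unfolding label_chain_def frag_extend_extend
        proof (rule frag_extend_eq)
          fix u assume "u \<in> Poly_Mapping.keys (bdl w)"
          then have "length u = ?p" using keys_bdl_length by fastforce
          then show "frag_extend (\<lambda>\<sigma>. frag_of (label_list \<Lambda> (?p - 1) \<sigma>)) (\<psi> u) = \<phi> u"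
            using 3 by (auto simp: \<phi>_def label_chain_def)
        qed
        finally show ?thesis .
      qed (simp add: \<phi>_def)
    qed
    show "\<phi> (map t w) = lmap T (\<phi> w)"
    proof (cases "w = []")
      case False
      then have wW: "w \<in> W" using w by (simp add: W_def)
      let ?p = "length w - 1" and ?act = "\<lambda>x v. x (s v)"
      have "affine_map (map t w) = simplex_map ?p ?act (affine_map w)"
      proof
        fix x :: "nat \<Rightarrow> real"
        have "(\<Sum>j<length w. if map t w ! j = v then x j else 0) = (\<Sum>j<length w. if w ! j = s v then x j else 0)" for v
          by (rule sum.cong) (use w(1) X(3) act in \<open>auto simp: subset_iff\<close>)
        then show "affine_map (map t w) x = simplex_map ?p ?act (affine_map w) x"
          by (simp add: affine_map_def simplex_map_def)
      qed
      then have "\<psi> (map t w) = (singular_subdivision ?p ^^ n) (chain_map ?p ?act (frag_of (affine_map w)))"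
        by (simp add: \<psi>_def)
      also have "\<dots> = chain_map ?p ?act (\<psi> w)"
        unfolding \<psi>_def by (rule chain_map_subdivision_power [OF sing [OF wW]])
      finally have "\<phi> (map t w) = label_chain \<Lambda> ?p (chain_map ?p ?act (\<psi> w))"
        using False by (simp add: \<phi>_def)
      also have "\<dots> = lmap T (label_chain \<Lambda> ?p (\<psi> w))"
        by (rule label_chain_chain_map [OF \<psi>_sing [OF wW]]) (use \<Lambda> in simp)
      finally show ?thesis using False by (simp add: \<phi>_def)
    qed (simp add: \<phi>_def)
  qed
qed

section \<open>Equivariant labels from coordinates that separate the rows\<close>

lemma finite_positive_lower_bound:
  fixes D :: "real set"
  assumes "finite D" "\<And>d. d \<in> D \<Longrightarrow> d > 0" obtains e where "e > 0" "\<And>d. d \<in> D \<Longrightarrow> e \<le> d"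
proof (rule that)
  show "Min (insert 1 D) > 0" using assms by simp
  show "Min (insert 1 D) \<le> d" if "d \<in> D" for d using that assms by (intro Min_le) auto
qed

lemma openin_finite_ball:
  assumes "finite I" "\<And>i. i \<in> I \<Longrightarrow> openin Y {y \<in> topspace Y. P i y}"
  shows "openin Y {y \<in> topspace Y. \<forall>i\<in>I. P i y}"
  using assms
proof (induction I rule: finite_induct)
  case (insert i I)
  have "{y \<in> topspace Y. \<forall>k\<in>insert i I. P k y} = {y \<in> topspace Y. P i y} \<inter> {y \<in> topspace Y. \<forall>k\<in>I. P k y}"
    by blast
  then show ?case using insert.IH insert.prems by (simp add: openin_Int)
qed simp

text \<open>The label of a point records a coordinate \<open>j\<close> in which the \<open>r\<close> values spread most, and a
  row where the maximum is attained. Ties between rows are broken cyclically from \<open>\<iota>\<close>, which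
  keeps the label equivariant. Nearby points only have labels among the maximal rows of \<open>x\<close>
  in its coordinates of maximal spread, and these rows never form a full block.\<close>

lemma labelling_exists:
  fixes F :: "'x \<Rightarrow> nat \<Rightarrow> nat \<Rightarrow> real" and Y :: "'x topology"
  assumes r: "r > 0"
    and cont: "\<And>i j. i < r \<Longrightarrow> j < m \<Longrightarrow> continuous_map Y euclideanreal (\<lambda>x. F x i j)"
    and apart: "\<And>x. x \<in> topspace Y \<Longrightarrow> \<exists>j<m. \<exists>a<r. \<exists>b<r. F x a j \<noteq> F x b j"
    and act: "\<And>x i j. x \<in> topspace Y \<Longrightarrow> i < r \<Longrightarrow> j < m \<Longrightarrow> F (act x) (Suc i mod r) j = F x i j"
    and \<iota>: "\<And>x. x \<in> topspace Y \<Longrightarrow> \<iota> x < r \<and> \<iota> (act x) = Suc (\<iota> x) mod r"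
  obtains \<Lambda> where "\<And>x. x \<in> topspace Y \<Longrightarrow> \<Lambda> (act x) = rot m r (\<Lambda> x)"
    and "\<And>x. x \<in> topspace Y \<Longrightarrow> \<exists>V. openin Y V \<and> x \<in> V \<and> \<Lambda> ` V \<in> block_sphere m r"
proof -
  define D where "D x j = (\<lambda>(a, b). F x a j - F x b j) ` ({..<r} \<times> {..<r})" for x j
  define spread where "spread x j = Max (D x j)" for x j
  define best where "best x j \<longleftrightarrow> j < m \<and> (\<forall>j'<m. spread x j' \<le> spread x j)" for x j
  define top_rows where "top_rows x j = {i. i < r \<and> (\<forall>a<r. F x a j \<le> F x i j)}" for x j
  define jj where "jj x = (SOME j. best x j)" for x
  define ii where "ii x = (\<iota> x + (LEAST s. (\<iota> x + s) mod r \<in> top_rows x (jj x))) mod r" for x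
  define \<Lambda> where "\<Lambda> x = jj x * r + ii x" for x
  have finD: "finite (D x j)" "D x j \<noteq> {}" for x j using r by (auto simp: D_def)
  have spread_ge: "F x a j - F x b j \<le> spread x j" if "a < r" "b < r" for x a b j
    unfolding spread_def using finD(1) that by (intro Max_ge) (auto simp: D_def)
  have spread_ex: "\<exists>a<r. \<exists>b<r. F x a j - F x b j = spread x j" for x j
  proof -
    have "spread x j \<in> D x j" unfolding spread_def using finD by (rule Max_in)
    then obtain p where "p \<in> {..<r} \<times> {..<r}" "spread x j = F x (fst p) j - F x (snd p) j"
      unfolding D_def by (auto simp: case_prod_unfold)
    then show ?thesis by (metis SigmaE fst_conv lessThan_iff snd_conv)
  qed
  have m: "m > 0" if "x \<in> topspace Y" for x using apart [OF that] by auto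
  have best_jj: "best x (jj x)" if x: "x \<in> topspace Y" for x
  proof -
    have "Max (spread x ` {..<m}) \<in> spread x ` {..<m}" using m [OF x] by (intro Max_in) auto
    then obtain j where j: "j < m" "spread x j = Max (spread x ` {..<m})" by auto
    have "spread x j' \<le> spread x j" if "j' < m" for j'
      unfolding j(2) using that by (intro Max_ge) auto
    then have "best x j" using j(1) by (simp add: best_def)
    then show ?thesis unfolding jj_def by (rule someI)
  qed
  have ii: "ii x \<in> top_rows x (jj x)" if x: "x \<in> topspace Y" for x
  proof -
    let ?g = "\<lambda>i. F x i (jj x)"
    have "Max (?g ` {..<r}) \<in> ?g ` {..<r}" using r by (intro Max_in) auto
    then obtain i where i: "i < r" "?g i = Max (?g ` {..<r})" by auto
    have "?g a \<le> ?g i" if "a < r" for a unfolding i(2) using that by (intro Max_ge) auto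
    then have top: "i \<in> top_rows x (jj x)" using i(1) by (simp add: top_rows_def)
    \<comment> \<open>This offset from \<open>\<iota> x\<close> arrives at \<open>i\<close>, so the
      search for the first maximal row succeeds.\<close>
    have "(\<iota> x + (i + (r - \<iota> x))) mod r = i" using \<iota> [OF x] i(1) by simp
    then show ?thesis unfolding ii_def
      by (intro LeastI [of "\<lambda>s. (\<iota> x + s) mod r \<in> top_rows x (jj x)" "i + (r - \<iota> x)"]) (simp add: top)
  qed
  have equivariant: "\<Lambda> (act x) = rot m r (\<Lambda> x)" if x: "x \<in> topspace Y" for x
  proof -
    have onto: "\<exists>a'<r. a = Suc a' mod r" if "a < r" for a
    proof (cases a)
      case 0
      then show ?thesis using r by (intro exI [of _ "r - 1"]) simp
    next
      case (Suc a')
      then show ?thesis using that by (intro exI [of _ a']) simp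
    qed
    have D_act: "D (act x) j = D x j" if j: "j < m" for j
    proof (intro equalityI subsetI)
      fix d assume "d \<in> D (act x) j"
      then obtain a b where ab: "a < r" "b < r" "d = F (act x) a j - F (act x) b j" by (auto simp: D_def)
      obtain a' b' where "a' < r" "a = Suc a' mod r" "b' < r" "b = Suc b' mod r"
        using onto ab(1,2) by metis
      then have "d = F x a' j - F x b' j" using ab act [OF x _ j] by simp
      then show "d \<in> D x j" using \<open>a' < r\<close> \<open>b' < r\<close> by (auto simp: D_def)
    next
      fix d assume "d \<in> D x j"
      then obtain a b where ab: "a < r" "b < r" "d = F x a j - F x b j" by (auto simp: D_def)
      then have "d = F (act x) (Suc a mod r) j - F (act x) (Suc b mod r) j" using act [OF x _ j] by simp
      moreover have "Suc a mod r < r" "Suc b mod r < r" using r by simp_all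
      ultimately show "d \<in> D (act x) j" by (auto simp: D_def)
    qed
    have "best (act x) = best x"
    proof
      fix j
      have "spread (act x) j = spread x j" if "j < m" for j using D_act [OF that] by (simp add: spread_def)
      then show "best (act x) j = best x j" unfolding best_def by auto
    qed
    then have jj: "jj (act x) = jj x" by (simp add: jj_def)
    have jm: "jj x < m" using best_jj [OF x] by (simp add: best_def)
    have top: "Suc i mod r \<in> top_rows (act x) (jj x) \<longleftrightarrow> i \<in> top_rows x (jj x)" if i: "i < r" for i
    proof -
      have "(\<forall>a<r. F (act x) a (jj x) \<le> F (act x) (Suc i mod r) (jj x)) \<longleftrightarrow> (\<forall>a<r. F x a (jj x) \<le> F x i (jj x))"
      proof
        assume *: "\<forall>a<r. F (act x) a (jj x) \<le> F (act x) (Suc i mod r) (jj x)"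
        show "\<forall>a<r. F x a (jj x) \<le> F x i (jj x)"
        proof (intro allI impI)
          fix a assume a: "a < r"
          have "Suc a mod r < r" using r by simp
          then show "F x a (jj x) \<le> F x i (jj x)" using * act [OF x a jm] act [OF x i jm] by metis
        qed
      next
        assume *: "\<forall>a<r. F x a (jj x) \<le> F x i (jj x)"
        show "\<forall>a<r. F (act x) a (jj x) \<le> F (act x) (Suc i mod r) (jj x)"
        proof (intro allI impI)
          fix a assume "a < r"
          then obtain a' where "a' < r" "a = Suc a' mod r" using onto by blast
          then show "F (act x) a (jj x) \<le> F (act x) (Suc i mod r) (jj x)"
            using * act [OF x _ jm] i by simp
        qed
      qed
      then show ?thesis using i r by (simp add: top_rows_def)
    qed
    have shift: "(\<iota> (act x) + s) mod r = Suc ((\<iota> x + s) mod r) mod r" for s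
      using \<iota> [OF x] by (simp add: mod_simps)
    have "(\<iota> (act x) + s) mod r \<in> top_rows (act x) (jj x) \<longleftrightarrow> (\<iota> x + s) mod r \<in> top_rows x (jj x)" for s
      unfolding shift by (rule top) (simp add: r)
    then have "ii (act x) = Suc (ii x) mod r" unfolding ii_def jj by (simp only: shift)
    moreover have "rot m r (jj x * r + ii x) = jj x * r + Suc (ii x) mod r"
    proof -
      have i: "ii x < r" using r by (simp add: ii_def)
      show ?thesis using block_code [OF i, of "jj x"] jm by (simp add: rot_def)
    qed
    ultimately show ?thesis by (simp add: \<Lambda>_def jj)
  qed
  have local: "\<exists>V. openin Y V \<and> x \<in> V \<and> \<Lambda> ` V \<in> block_sphere m r" if x: "x \<in> topspace Y" for x
  proof -
    define j0 where "j0 = jj x"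
    have j0: "best x j0" "j0 < m" using best_jj [OF x] by (auto simp: j0_def best_def)
    have s_pos: "spread x j0 > 0"
    proof -
      obtain j a b where j: "j < m" "a < r" "b < r" "F x a j \<noteq> F x b j" using apart [OF x] by blast
      have "0 < spread x j" using spread_ge [of a b x j] spread_ge [of b a x j] j by linarith
      then show ?thesis using j0(1) j(1) unfolding best_def by force
    qed
    \<comment> \<open>All positive gaps at \<open>x\<close>: between the maximal spread and smaller
      spreads, and between unequal values of the same coordinate. Nearby points must not reverse any
      of them.\<close>
    define G where "G = (\<lambda>j. spread x j0 - spread x j) ` {j. j < m \<and> \<not> best x j} \<union>
       (\<lambda>(a, i, j). F x a j - F x i j) ` {(a, i, j). a < r \<and> i < r \<and> j < m \<and> F x i j < F x a j}"
    have "finite {(a, i, j). a < r \<and> i < r \<and> j < m \<and> F x i j < F x a j}"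
      by (rule finite_subset [of _ "{..<r} \<times> {..<r} \<times> {..<m}"]) auto
    then have "finite G" by (simp add: G_def)
    moreover have "d > 0" if d: "d \<in> G" for d
    proof -
      consider j where "j < m" "\<not> best x j" "d = spread x j0 - spread x j"
        | a i j where "F x i j < F x a j" "d = F x a j - F x i j"
        using d unfolding G_def by auto
      then show ?thesis
      proof cases
        case 1
        have "spread x j < spread x j0"
        proof (rule ccontr)
          assume "\<not> spread x j < spread x j0"
          then have "\<forall>j'<m. spread x j' \<le> spread x j" using j0(1) unfolding best_def by force
          then show False using 1 by (simp add: best_def)
        qed
        then show ?thesis using 1 by simp
      qed simp
    qed
    ultimately obtain e0 where e0: "e0 > 0" "\<And>d. d \<in> G \<Longrightarrow> e0 \<le> d"
      using finite_positive_lower_bound by blast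
    \<comment> \<open>Comparing two spreads involves four values, each of which moves by less than
      \<open>e\<close>.\<close>
    define e where "e = e0 / 4"
    have e: "e > 0" using e0 by (simp add: e_def)
    have gap1: "spread x j \<le> spread x j0 - 4 * e" if "j < m" "\<not> best x j" for j
      using e0(2) [of "spread x j0 - spread x j"] that by (auto simp: G_def e_def)
    have gap2: "F x i j \<le> F x a j - 4 * e" if "a < r" "i < r" "j < m" "F x i j < F x a j" for a i j
    proof -
      have "F x a j - F x i j \<in> G" using that unfolding G_def by force
      then show ?thesis using e0(2) by (fastforce simp: e_def)
    qed
    define V where "V = {y \<in> topspace Y. \<forall>p\<in>{..<r} \<times> {..<m}. \<bar>F y (fst p) (snd p) - F x (fst p) (snd p)\<bar> < e}"
    have "openin Y V"
      unfolding V_def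
    proof (rule openin_finite_ball)
      fix p assume p: "p \<in> {..<r} \<times> {..<m}"
      have "continuous_map Y euclideanreal (\<lambda>y. F y (fst p) (snd p))" using p by (intro cont) auto
      then have "openin Y {y \<in> topspace Y. F y (fst p) (snd p) \<in> ball (F x (fst p) (snd p)) e}"
        by (rule openin_continuous_map_preimage) simp
      then show "openin Y {y \<in> topspace Y. \<bar>F y (fst p) (snd p) - F x (fst p) (snd p)\<bar> < e}"
        by (simp add: dist_real_def abs_minus_commute)
    qed simp
    moreover have "x \<in> V" using x e by (simp add: V_def)
    moreover have "\<Lambda> ` V \<in> block_sphere m r"
    proof -
      \<comment> \<open>The labels that can occur near \<open>x\<close>. A full block of them would
        make all rows maximal in a coordinate of maximal spread, so that spread would be zero,
        against \<open>s_pos\<close>.\<close>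
      define H where "H = {j * r + i | i j. best x j \<and> i \<in> top_rows x j}"
      have HK: "H \<in> block_sphere m r"
        unfolding block_sphere_iff [OF r]
      proof (intro conjI allI impI)
        show "H \<subseteq> {..<m * r}" using block_code(3) by (auto simp: H_def best_def top_rows_def)
        fix j assume j: "j < m"
        show "\<exists>i<r. j * r + i \<notin> H"
        proof (rule ccontr)
          assume "\<not> (\<exists>i<r. j * r + i \<notin> H)"
          then have all: "best x j \<and> i \<in> top_rows x j" if "i < r" for i
          proof -
            have "j * r + i \<in> H" using \<open>\<not> (\<exists>i<r. j * r + i \<notin> H)\<close> that by blast
            then obtain i' j' where *: "j * r + i = j' * r + i'" "best x j'" "i' \<in> top_rows x j'" by (auto simp: H_def)
            have "i' < r" using * by (simp add: top_rows_def)
            then have "j = j'" "i = i'"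
              using *(1) block_code(1,2) [OF that, of j] block_code(1,2) [OF \<open>i' < r\<close>, of j'] by metis+
            then show ?thesis using * by simp
          qed
          obtain a b where ab: "a < r" "b < r" "F x a j - F x b j = spread x j" using spread_ex by blast
          have "F x a j \<le> F x b j" using all [OF ab(2)] ab(1) by (simp add: top_rows_def)
          moreover have "spread x j0 \<le> spread x j" using all [OF r] j0(2) by (simp add: best_def)
          ultimately show False using ab s_pos by linarith
        qed
      qed
      have "\<Lambda> ` V \<subseteq> H"
      proof (rule image_subsetI)
        fix y assume y: "y \<in> V"
        then have yY: "y \<in> topspace Y" by (simp add: V_def)
        have near: "\<bar>F y i j - F x i j\<bar> < e" if "i < r" "j < m" for i j
          using y that unfolding V_def by force
        have jm: "jj y < m" using best_jj [OF yY] by (simp add: best_def)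
        have 1: "best x (jj y)"
        proof (rule ccontr)
          assume "\<not> best x (jj y)"
          then have 2: "spread x (jj y) \<le> spread x j0 - 4 * e" using gap1 jm by blast
          obtain a b where ab: "a < r" "b < r" "F y a (jj y) - F y b (jj y) = spread y (jj y)" using spread_ex by blast
          obtain a0 b0 where ab0: "a0 < r" "b0 < r" "F x a0 j0 - F x b0 j0 = spread x j0" using spread_ex by blast
          have "spread y j0 \<le> spread y (jj y)" using best_jj [OF yY] j0(2) by (simp add: best_def)
          then show False
            using 2 ab(3) ab0(3) spread_ge [OF ab(1,2), of x "jj y"] spread_ge [OF ab0(1,2), of y j0]
              near [OF ab(1) jm] near [OF ab(2) jm] near [OF ab0(1) j0(2)] near [OF ab0(2) j0(2)]
            by linarith
        qed
        have iy: "ii y < r" "\<And>a. a < r \<Longrightarrow> F y a (jj y) \<le> F y (ii y) (jj y)"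
          using ii [OF yY] by (auto simp: top_rows_def)
        have "F x a (jj y) \<le> F x (ii y) (jj y)" if a: "a < r" for a
        proof (rule ccontr)
          assume "\<not> F x a (jj y) \<le> F x (ii y) (jj y)"
          then have "F x (ii y) (jj y) \<le> F x a (jj y) - 4 * e" using gap2 [OF a iy(1) jm] by simp
          then show False using near [OF a jm] near [OF iy(1) jm] iy(2) [OF a] e by linarith
        qed
        then have "ii y \<in> top_rows x (jj y)" using iy(1) by (simp add: top_rows_def)
        then show "\<Lambda> y \<in> H" using 1 by (auto simp: H_def \<Lambda>_def)
      qed
      then show ?thesis using HK down_closedD [OF down_closed_sphere] by blast
    qed
    ultimately show ?thesis by blast
  qed
  show thesis using that [of \<Lambda>] equivariant local by blast
qed

section \<open>A coincidence theorem for rook complexes\<close>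

text \<open>The inverse of \<open>row_shift\<close> on rows below \<open>r\<close>. Other rows stay
  where they are, so that \<open>row_unshift_iff\<close> holds for every \<open>v\<close>.\<close>

definition row_unshift :: "nat \<Rightarrow> nat \<times> 'c \<Rightarrow> nat \<times> 'c" where
  "row_unshift r v = (if fst v < r then (fst v + (r - 1)) mod r else fst v, snd v)"

lemma row_unshift_iff:
  assumes "fst u < r" shows "u = row_unshift r v \<longleftrightarrow> row_shift r u = v"
proof (cases "fst v < r")
  case True
  have "fst u = (fst v + (r - 1)) mod r \<longleftrightarrow> Suc (fst u) mod r = fst v"
  proof
    assume "fst u = (fst v + (r - 1)) mod r"
    then have "Suc (fst u) mod r = (fst v + Suc (r - 1)) mod r" by (simp add: mod_Suc_eq)
    then show "Suc (fst u) mod r = fst v" using True by simp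
  next
    assume "Suc (fst u) mod r = fst v"
    then have "(fst v + (r - 1)) mod r = (fst u + Suc (r - 1)) mod r" by (metis add_Suc_shift mod_add_left_eq)
    then show "fst u = (fst v + (r - 1)) mod r" using assms by simp
  qed
  then show ?thesis using True by (auto simp: row_unshift_def row_shift_def prod_eq_iff)
next
  case False
  have "Suc (fst u) mod r < r" using assms by simp
  then have "Suc (fst u) mod r \<noteq> fst v" "fst u \<noteq> fst v" using False assms by metis+
  then show ?thesis using False by (simp add: row_unshift_def row_shift_def prod_eq_iff)
qed

lemma row_unshift_Suc: "i < r \<Longrightarrow> row_unshift r (Suc i mod r, c) = (i, c)"
  using row_unshift_iff [of "(i, c)" r "(Suc i mod r, c)"] by (simp add: row_shift_def)

lemma rook_row_shift:
  assumes r: "r > 0" and \<sigma>: "\<sigma> \<in> rook \<kappa> (\<lambda>_. {..<r}) S"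
  shows "row_shift r ` \<sigma> \<in> rook \<kappa> (\<lambda>_. {..<r}) S"
proof -
  have "row_shift r p = row_shift r q"
    if pq: "p \<in> \<sigma>" "q \<in> \<sigma>" and at: "snd (row_shift r p) = snd (row_shift r q) \<or>
      fst (row_shift r p) = fst (row_shift r q) \<and> \<kappa> (snd (row_shift r p)) = \<kappa> (snd (row_shift r q))" for p q
  proof -
    have "fst p < r" "fst q < r" using pq \<sigma> by (auto simp: rook_def)
    then have "snd p = snd q \<or> fst p = fst q \<and> \<kappa> (snd p) = \<kappa> (snd q)"
      using at Suc_mod_inj [of "fst p" r "fst q"] by (simp add: row_shift_def)
    then have "p = q" using pq \<sigma> by (auto simp: rook_def)
    then show ?thesis by simp
  qed
  moreover have "snd (row_shift r p) \<in> S \<and> fst (row_shift r p) < r" if "p \<in> \<sigma>" for p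
    using that \<sigma> r by (auto simp: rook_def row_shift_def)
  ultimately show ?thesis by (simp add: rook_def)
qed

lemma equivariant_chain_map_exists:
  fixes F :: "(nat \<times> 'c \<Rightarrow> real) \<Rightarrow> nat \<Rightarrow> nat \<Rightarrow> real" and \<kappa> :: "'c \<Rightarrow> 'b" and S :: "'c set" and r m L :: nat
  defines "X \<equiv> rook \<kappa> (\<lambda>_. {..<r}) S" and "U \<equiv> {..<r} \<times> S"
  assumes r: "r > 0" and S: "finite S"
    and cont: "\<And>i j. i < r \<Longrightarrow> j < m \<Longrightarrow> continuous_map (realization_space U X) euclideanreal (\<lambda>x. F x i j)"
    and act: "\<And>x i j. x \<in> realization U X \<Longrightarrow> i < r \<Longrightarrow> j < m \<Longrightarrow> F (\<lambda>v. x (row_unshift r v)) (Suc i mod r) j = F x i j"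
    and apart: "\<And>x. x \<in> realization U X \<Longrightarrow> \<exists>j<m. \<exists>a<r. \<exists>b<r. F x a j \<noteq> F x b j"
  obtains \<phi> where "\<phi> [] = frag_of []"
    and "\<And>w. set w \<in> X \<Longrightarrow> length w \<le> L \<Longrightarrow> Poly_Mapping.keys (\<phi> w) \<subseteq> simps (block_sphere m r) (length w)"
    and "\<And>w. set w \<in> X \<Longrightarrow> length w \<le> L \<Longrightarrow> bd (\<phi> w) = frag_extend \<phi> (bdl w)"
    and "\<And>w. set w \<in> X \<Longrightarrow> length w \<le> L \<Longrightarrow> \<phi> (map (row_shift r) w) = lmap (rot m r) (\<phi> w)"
proof -
  let ?act = "\<lambda>(x :: nat \<times> 'c \<Rightarrow> real) v. x (row_unshift r v)"
  \<comment> \<open>The tie-breaking row. The column is chosen from the set of columns in use, which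
    shifting the rows does not change; a rook placement has only one row in that column, and this
    row moves with the shift.\<close>
  define col where "col x = (SOME c. \<exists>i. x (i, c) \<noteq> (0::real))" for x :: "nat \<times> 'c \<Rightarrow> real"
  define \<iota> where "\<iota> x = (THE i. x (i, col x) \<noteq> 0)" for x :: "nat \<times> 'c \<Rightarrow> real"
  have sub: "A \<subseteq> U" if "A \<in> X" for A using that unfolding X_def U_def rook_def by force
  have \<iota>: "\<iota> x < r \<and> \<iota> (?act x) = Suc (\<iota> x) mod r" if x: "x \<in> realization U X" for x
  proof -
    have supp: "{v. x v \<noteq> 0} \<in> X" and sum1: "sum x U = 1" using x by (auto simp: realization_def)
    have "\<exists>v. x v \<noteq> 0"
    proof (rule ccontr)
      assume "\<nexists>v. x v \<noteq> 0"
      then have "sum x U = 0" by (intro sum.neutral) blast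
      then show False using sum1 by simp
    qed
    then have "\<exists>c. \<exists>i. x (i, c) \<noteq> 0" by (metis surj_pair)
    then have "\<exists>i. x (i, col x) \<noteq> 0" unfolding col_def by (rule someI_ex)
    then obtain i where i: "x (i, col x) \<noteq> 0" by blast
    have row: "i' < r" if "x (i', c) \<noteq> 0" for i' c
    proof -
      have "(i', c) \<in> U" using sub [OF supp] that by blast
      then show ?thesis by (simp add: U_def)
    qed
    have uniq: "i' = i" if "x (i', col x) \<noteq> 0" for i'
    proof -
      have "(i', col x) \<in> {v. x v \<noteq> 0}" "(i, col x) \<in> {v. x v \<noteq> 0}" using that i by simp_all
      moreover have "\<forall>p\<in>{v. x v \<noteq> 0}. \<forall>q\<in>{v. x v \<noteq> 0}. snd p = snd q \<longrightarrow> p = q"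
        using supp unfolding X_def rook_def by blast
      ultimately have "(i', col x) = (i, col x)" by (metis snd_conv)
      then show ?thesis by simp
    qed
    have \<iota>x: "\<iota> x = i" unfolding \<iota>_def using i uniq by (rule the_equality)
    have ir: "i < r" using row i .
    have nz: "?act x (i', c) \<noteq> 0 \<longleftrightarrow> (\<exists>i''. i' = Suc i'' mod r \<and> x (i'', c) \<noteq> 0)" for i' c
    proof
      assume *: "?act x (i', c) \<noteq> 0"
      define u where "u = row_unshift r (i', c)"
      have u: "x u \<noteq> 0" "snd u = c" using * by (auto simp: u_def row_unshift_def)
      then have "fst u < r" using row by (metis prod.collapse)
      then have "row_shift r u = (i', c)" using row_unshift_iff u_def by blast
      then have "i' = Suc (fst u) mod r" by (auto simp: row_shift_def)
      then show "\<exists>i''. i' = Suc i'' mod r \<and> x (i'', c) \<noteq> 0" using u by (metis prod.collapse)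
    next
      assume "\<exists>i''. i' = Suc i'' mod r \<and> x (i'', c) \<noteq> 0"
      then obtain i'' where i'': "i' = Suc i'' mod r" "x (i'', c) \<noteq> 0" by blast
      then have "row_unshift r (i', c) = (i'', c)" using row_unshift_Suc row by metis
      then show "?act x (i', c) \<noteq> 0" using i'' by simp
    qed
    have "(\<exists>i'. ?act x (i', c) \<noteq> 0) \<longleftrightarrow> (\<exists>i'. x (i', c) \<noteq> 0)" for c
      unfolding nz by blast
    then have col: "col (?act x) = col x" unfolding col_def by simp
    have "\<iota> (?act x) = Suc i mod r"
      unfolding \<iota>_def col
    proof (rule the_equality)
      show "?act x (Suc i mod r, col x) \<noteq> 0" using nz i by blast
      show "i' = Suc i mod r" if "?act x (i', col x) \<noteq> 0" for i' using that nz uniq by blast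
    qed
    then show ?thesis using \<iota>x ir by simp
  qed
  obtain \<Lambda> where \<Lambda>: "\<And>x. x \<in> realization U X \<Longrightarrow> \<Lambda> (?act x) = rot m r (\<Lambda> x)"
    "\<And>x. x \<in> realization U X \<Longrightarrow> \<exists>V. openin (realization_space U X) V \<and> x \<in> V \<and> \<Lambda> ` V \<in> block_sphere m r"
  proof (rule labelling_exists [of r m "realization_space U X" F ?act \<iota>])
    fix \<Lambda> assume "\<And>x. x \<in> topspace (realization_space U X) \<Longrightarrow> \<Lambda> (?act x) = rot m r (\<Lambda> x)"
      "\<And>x. x \<in> topspace (realization_space U X) \<Longrightarrow>
         \<exists>V. openin (realization_space U X) V \<and> x \<in> V \<and> \<Lambda> ` V \<in> block_sphere m r"
    then show thesis by (intro that [of \<Lambda>]) simp_all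
  qed (use r cont apart act \<iota> in simp_all)
  show thesis
  proof (rule chain_map_from_labelling [of X U "block_sphere m r" \<Lambda> "row_unshift r" "row_shift r" "rot m r" L])
    show "down_closed X" "finite U" using S by (auto simp: X_def U_def down_closed_rook)
    show "{} \<in> block_sphere m r" using r by (auto simp: block_sphere_iff)
    show "u = row_unshift r v \<longleftrightarrow> row_shift r u = v" if "u \<in> U" for u v
    proof (rule row_unshift_iff)
      show "fst u < r" using that by (auto simp: U_def)
    qed
    fix \<phi> :: "(nat \<times> 'c) list \<Rightarrow> (nat list \<Rightarrow>\<^sub>0 int)"
    assume "\<phi> [] = frag_of []"
      "\<And>w. set w \<in> X \<Longrightarrow> length w \<le> L \<Longrightarrow> Poly_Mapping.keys (\<phi> w) \<subseteq> simps (block_sphere m r) (length w)"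
      "\<And>w. set w \<in> X \<Longrightarrow> length w \<le> L \<Longrightarrow> bd (\<phi> w) = frag_extend \<phi> (bdl w)"
      "\<And>w. set w \<in> X \<Longrightarrow> length w \<le> L \<Longrightarrow> \<phi> (map (row_shift r) w) = lmap (rot m r) (\<phi> w)"
    then show thesis by (rule that [of \<phi>])
  qed (use sub down_closed_sphere \<Lambda> in auto)
qed

section \<open>Large chessboards in place of missing columns\<close>

definition flag_columns :: "nat \<Rightarrow> nat \<Rightarrow> nat set" where
  "flag_columns m r = {y. y \<le> m * r \<and> y mod r \<noteq> r - 1}"

definition prepend :: "'a list \<Rightarrow> ('a list \<Rightarrow>\<^sub>0 int) \<Rightarrow> ('a list \<Rightarrow>\<^sub>0 int)" where
  "prepend a = frag_extend (\<lambda>w. frag_of (a @ w))"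

lemma frag_extend_swap:
  "frag_extend (\<lambda>w. frag_extend (\<lambda>u. f u w) d) c = frag_extend (\<lambda>u. frag_extend (f u) c) d"
  by (rule frag_induction [of c UNIV]) (auto simp: frag_extend_diff frag_extend_fun_diff frag_extend_eq_0)

text \<open>\<open>bdl_append_frag\<close> extended linearly in the second factor of the
  join.\<close>

lemma bd_prepend:
  "bd (prepend a c) = frag_extend (\<lambda>u. prepend u c) (bdl a) + frag_cmul ((-1) ^ length a) (prepend a (bd c))"
proof -
  have "bd (prepend a c) = frag_extend (\<lambda>w. bdl (a @ w)) c"
    by (simp add: prepend_def bd_def frag_extend_extend)
  also have "\<dots> = frag_extend (\<lambda>w. frag_extend (\<lambda>u. frag_of (u @ w)) (bdl a)) c
      + frag_cmul ((-1) ^ length a) (frag_extend (\<lambda>w. frag_extend (\<lambda>u. frag_of (a @ u)) (bdl w)) c)"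
    by (simp add: bdl_append_frag frag_extend_fun_add frag_extend_fun_cmul)
  finally show ?thesis
    unfolding frag_extend_swap [of "\<lambda>u w. frag_of (u @ w)"]
    by (simp add: prepend_def bd_def frag_extend_extend)
qed

lemma sorted_filter_split:
  assumes "sorted_wrt (<) (map g u)" "\<And>p q. p \<in> set u \<Longrightarrow> q \<in> set u \<Longrightarrow> g p < g q \<Longrightarrow> low q \<Longrightarrow> low p"
  shows "u = filter low u @ filter (\<lambda>p. \<not> low p) u"
  using assms
proof (induction u)
  case (Cons p u)
  show ?case
  proof (cases "low p")
    case True
    have "u = filter low u @ filter (\<lambda>p. \<not> low p) u"
    proof (rule Cons.IH)
      show "sorted_wrt (<) (map g u)" using Cons.prems(1) by simp
      show "low p" if "p \<in> set u" "q \<in> set u" "g p < g q" "low q" for p q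
        by (rule Cons.prems(2) [OF _ _ that(3,4)]) (use that in auto)
    qed
    then show ?thesis using True by simp
  next
    case False
    have "\<not> low q" if "q \<in> set u" for q using Cons.prems that False by auto
    then have "filter low u = []" "filter (\<lambda>p. \<not> low p) u = u" by (auto simp: filter_empty_conv filter_id_conv)
    then show ?thesis using False by simp
  qed
qed simp

text \<open>The columns satisfying \<open>low\<close> are realized by actual columns \<open>e y\<close>. The remaining ones, at most
  \<open>card B * r\<close> many, are simulated by the chessboards of \<open>Sb\<close>, whose join is connected enough to
  receive an equivariant chain map \<open>\<Psi>\<close> from all lists of at most \<open>card B * r\<close> rows.\<close>

theorem equivariant_coincidence:
  fixes F :: "(nat \<times> 'c \<Rightarrow> real) \<Rightarrow> nat \<Rightarrow> nat \<Rightarrow> real" and \<kappa> :: "'c \<Rightarrow> 'b" and S Sb :: "'c set"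
    and r m :: nat and e :: "nat \<Rightarrow> 'c" and low :: "nat \<Rightarrow> bool"
  defines "X \<equiv> rook \<kappa> (\<lambda>_. {..<r}) S" and "U \<equiv> {..<r} \<times> S"
  assumes r: "prime r" and m: "m > 0" and S: "finite S"
    and cont: "\<And>i j. i < r \<Longrightarrow> j < m \<Longrightarrow> continuous_map (realization_space U X) euclideanreal (\<lambda>x. F x i j)"
    and act: "\<And>x i j. x \<in> realization U X \<Longrightarrow> i < r \<Longrightarrow> j < m \<Longrightarrow> F (\<lambda>v. x (row_unshift r v)) (Suc i mod r) j = F x i j"
    and low: "\<And>y y'. y \<in> flag_columns m r \<Longrightarrow> y' \<in> flag_columns m r \<Longrightarrow> y < y' \<Longrightarrow> low y' \<Longrightarrow> low y"
    and e_in: "\<And>y. y \<in> flag_columns m r \<Longrightarrow> low y \<Longrightarrow> e y \<in> S"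
    and e_inj: "\<And>y y'. y \<in> flag_columns m r \<Longrightarrow> y' \<in> flag_columns m r \<Longrightarrow> low y \<Longrightarrow> low y' \<Longrightarrow> e y = e y' \<Longrightarrow> y = y'"
    and e_color: "\<And>y y'. y \<in> flag_columns m r \<Longrightarrow> y' \<in> flag_columns m r \<Longrightarrow> low y \<Longrightarrow> low y' \<Longrightarrow> \<kappa> (e y) = \<kappa> (e y') \<Longrightarrow> y div r = y' div r"
    and e_Sb: "\<And>y c. y \<in> flag_columns m r \<Longrightarrow> low y \<Longrightarrow> c \<in> Sb \<Longrightarrow> \<kappa> (e y) \<noteq> \<kappa> c"
    and Sb: "Sb \<subseteq> S" "ample \<kappa> B (\<lambda>_. {..<r}) Sb (\<lambda>_. r)"
    and high: "card {y \<in> flag_columns m r. \<not> low y} \<le> card B * r"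
  shows "\<exists>x\<in>realization U X. \<forall>j<m. \<forall>a<r. \<forall>b<r. F x a j = F x b j"
proof (rule ccontr)
  assume "\<not> (\<exists>x\<in>realization U X. \<forall>j<m. \<forall>a<r. \<forall>b<r. F x a j = F x b j)"
  then have apart: "\<exists>j<m. \<exists>a<r. \<exists>b<r. F x a j \<noteq> F x b j" if "x \<in> realization U X" for x
    using that by blast
  have r0: "r > 0" using r prime_gt_0_nat by blast
  define L where "L = card (flag_columns m r)"
  have fin_cols: "finite (flag_columns m r)" by (rule finite_subset [of _ "{..m * r}"]) (auto simp: flag_columns_def)
  obtain \<phi> where \<phi>0: "\<phi> [] = frag_of []"
    and \<phi>_keys: "\<And>w. set w \<in> X \<Longrightarrow> length w \<le> L \<Longrightarrow> Poly_Mapping.keys (\<phi> w) \<subseteq> simps (block_sphere m r) (length w)"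
    and \<phi>_bd: "\<And>w. set w \<in> X \<Longrightarrow> length w \<le> L \<Longrightarrow> bd (\<phi> w) = frag_extend \<phi> (bdl w)"
    and \<phi>_shift: "\<And>w. set w \<in> X \<Longrightarrow> length w \<le> L \<Longrightarrow> \<phi> (map (row_shift r) w) = lmap (rot m r) (\<phi> w)"
  proof (rule equivariant_chain_map_exists [where r = r and S = S and \<kappa> = \<kappa> and m = m and F = F and L = L])
    fix \<phi> :: "(nat \<times> 'c) list \<Rightarrow> (nat list \<Rightarrow>\<^sub>0 int)"
    assume "\<phi> [] = frag_of []"
      "\<And>w. set w \<in> rook \<kappa> (\<lambda>_. {..<r}) S \<Longrightarrow> length w \<le> L \<Longrightarrow> Poly_Mapping.keys (\<phi> w) \<subseteq> simps (block_sphere m r) (length w)"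
      "\<And>w. set w \<in> rook \<kappa> (\<lambda>_. {..<r}) S \<Longrightarrow> length w \<le> L \<Longrightarrow> bd (\<phi> w) = frag_extend \<phi> (bdl w)"
      "\<And>w. set w \<in> rook \<kappa> (\<lambda>_. {..<r}) S \<Longrightarrow> length w \<le> L \<Longrightarrow> \<phi> (map (row_shift r) w) = lmap (rot m r) (\<phi> w)"
    then show thesis by (intro that [of \<phi>]) (simp_all add: X_def)
  qed (use r0 S cont act apart in \<open>simp_all add: X_def U_def\<close>)
  let ?T = "row_shift r :: nat \<times> 'c \<Rightarrow> nat \<times> 'c"
  define P where "P = rook \<kappa> (\<lambda>_. {..<r}) Sb"
  define n where "n = card B * r"
  \<comment> \<open>The source records only rows and has no conflicts between them. Shifting rows is
    free on nonempty lists, and the boards of \<open>Sb\<close> are acyclic below \<open>n\<close>,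
    so the extension reaches all lists of length up to \<open>n\<close>.\<close>
  have "\<exists>h. h [] = frag_of [] \<and> (\<forall>u\<in>{u. set u \<subseteq> {..<r}}. length u \<le> n \<longrightarrow>
     Poly_Mapping.keys (h u) \<subseteq> simps P (length u + 0) \<and> h (map (\<lambda>i. Suc i mod r) u) = lmap ?T (h u) \<and>
     bd (h u) = 0 + frag_cmul 1 (frag_extend h (bdl u)))"
  proof (rule equivariant_extension [where r = r and m = n and \<rho> = "\<lambda>i. i" and \<alpha> = "\<lambda>_. 0"])
    show "map (\<lambda>i. Suc i mod r) u \<in> {u. set u \<subseteq> {..<r}} \<and> Poly_Mapping.keys (bdl u) \<subseteq> {u. set u \<subseteq> {..<r}}"
      if u: "u \<in> {u. set u \<subseteq> {..<r}}" for u
    proof -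
      have "set v \<subseteq> {..<r}" if "v \<in> Poly_Mapping.keys (bdl u)" for v using keys_bdl_set [OF that] u by blast
      then show ?thesis using r0 by auto
    qed
    show "v < r \<and> Suc v mod r = Suc v mod r \<and> ((\<lambda>i. Suc i mod r) ^^ r) v = v" if "u \<in> {u. set u \<subseteq> {..<r}}" "v \<in> set u" for u v
    proof -
      have v: "v < r" using that by auto
      have "((\<lambda>i. Suc i mod r) ^^ i) v = (v + i) mod r" for i
        using v by (induction i) (auto simp: mod_Suc_eq)
      then show ?thesis using v by simp
    qed
    show "down_closed P" by (simp add: P_def down_closed_rook)
    show "\<And>A. A \<in> P \<Longrightarrow> ?T ` A \<in> P" unfolding P_def by (rule rook_row_shift [OF r0])
    show "(?T ^^ r) v = v" if "A \<in> P" "v \<in> A" for A v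
    proof -
      have "fst v < r" using that by (auto simp: P_def rook_def)
      then show ?thesis using row_shift_pow [of v r r] by simp
    qed
    show "acyc P n" using acyc_rook [OF Sb(2)] by (simp add: P_def n_def)
    show "Poly_Mapping.keys (frag_of []) \<subseteq> simps P 0" by (simp add: simps_def P_def rook_def)
  qed (use r0 in \<open>auto simp: frag_extend_eq_0\<close>)
  then obtain \<Psi> where \<Psi>0: "\<Psi> [] = frag_of []"
    and \<Psi>: "\<And>u. set u \<subseteq> {..<r} \<Longrightarrow> length u \<le> n \<Longrightarrow> Poly_Mapping.keys (\<Psi> u) \<subseteq> simps P (length u) \<and>
     \<Psi> (map (\<lambda>i. Suc i mod r) u) = lmap ?T (\<Psi> u) \<and> bd (\<Psi> u) = frag_extend \<Psi> (bdl u)"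
    by auto
  define E where "E p = (fst p, e (snd p))" for p :: "nat \<times> nat"
  define lo where "lo p \<longleftrightarrow> low (snd p)" for p :: "nat \<times> nat"
  \<comment> \<open>Low squares keep their columns, high ones are replaced through
    \<open>\<Psi>\<close> by chains on \<open>Sb\<close>. Columns increase along \<open>u\<close>
    and the low ones come first, so \<open>u\<close> is a concatenation and the boundary follows
    from the Leibniz rule.\<close>
  define \<psi> where "\<psi> u = prepend (map E (filter lo u)) (\<Psi> (map fst (filter (\<lambda>p. \<not> lo p) u)))" for u
  define \<Phi> where "\<Phi> u = frag_extend \<phi> (\<psi> u)" for u
  have cols_in: "snd p \<in> flag_columns m r" "fst p < r" if "u \<in> flags m r" "p \<in> set u" for u p
    using that by (auto simp: flags_def flag_columns_def)
  have dist: "distinct (map snd u)" if "u \<in> flags m r" for u :: "(nat \<times> nat) list"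
    using that strict_sorted_iff by (auto simp: flags_def)
  have split: "u = filter lo u @ filter (\<lambda>p. \<not> lo p) u" if u: "u \<in> flags m r" for u
  proof (rule sorted_filter_split [where g = snd])
    show "sorted_wrt (<) (map snd u)" using u by (simp add: flags_def)
    show "\<And>p q. p \<in> set u \<Longrightarrow> q \<in> set u \<Longrightarrow> snd p < snd q \<Longrightarrow> lo q \<Longrightarrow> lo p"
      unfolding lo_def using low cols_in [OF u] by blast
  qed
  have high_len: "length (filter (\<lambda>p. \<not> lo p) u) \<le> n" "set (map fst (filter (\<lambda>p. \<not> lo p) u)) \<subseteq> {..<r}"
    if u: "u \<in> flags m r" for u
  proof -
    have "distinct (map snd (filter (\<lambda>p. \<not> lo p) u))" using dist [OF u] by (rule distinct_map_filter)
    then have "length (filter (\<lambda>p. \<not> lo p) u) = card (set (map snd (filter (\<lambda>p. \<not> lo p) u)))"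
      by (metis distinct_card length_map)
    also have "\<dots> \<le> card {y \<in> flag_columns m r. \<not> low y}"
      using fin_cols cols_in [OF u] by (intro card_mono) (auto simp: lo_def)
    finally show "length (filter (\<lambda>p. \<not> lo p) u) \<le> n" using high by (simp add: n_def)
    show "set (map fst (filter (\<lambda>p. \<not> lo p) u)) \<subseteq> {..<r}" using cols_in(2) [OF u] by auto
  qed
  have len_L: "length u \<le> L" if u: "u \<in> flags m r" for u
  proof -
    have "length u = card (set (map snd u))" using distinct_card [OF dist [OF u]] by simp
    also have "\<dots> \<le> L" unfolding L_def using fin_cols cols_in(1) [OF u] by (intro card_mono) auto
    finally show ?thesis .
  qed
  have \<psi>_keys: "Poly_Mapping.keys (\<psi> u) \<subseteq> simps X (length u)" if u: "u \<in> flags m r" for u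
    unfolding \<psi>_def prepend_def
  proof (rule keys_frag_extend_subset)
    fix w assume "w \<in> Poly_Mapping.keys (\<Psi> (map fst (filter (\<lambda>p. \<not> lo p) u)))"
    then have w: "set w \<in> P" "length w = length (filter (\<lambda>p. \<not> lo p) u)"
      using \<Psi> [OF high_len(2) [OF u]] high_len(1) [OF u] by (auto simp: simps_def)
    have wP: "snd p \<in> Sb" "fst p < r" if "p \<in> set w" for p
      using w(1) that by (auto simp: P_def rook_def)
    have wP': "p = q" if "p \<in> set w" "q \<in> set w" "snd p = snd q \<or> fst p = fst q \<and> \<kappa> (snd p) = \<kappa> (snd q)" for p q
      using w(1) that unfolding P_def rook_def by blast
    have lows: "\<exists>y. snd p = e y \<and> low y \<and> y \<in> flag_columns m r \<and> (fst p, y) \<in> set u" if "p \<in> set (map E (filter lo u))" for p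
      using that cols_in(1) [OF u] by (auto simp: E_def lo_def)
    have cross: "snd p \<noteq> snd q \<and> \<kappa> (snd p) \<noteq> \<kappa> (snd q)" if "p \<in> set (map E (filter lo u))" "q \<in> set w" for p q
      using lows [OF that(1)] wP(1) [OF that(2)] e_Sb by metis
    have lowlow: "p = q" if p: "p \<in> set (map E (filter lo u))" and q: "q \<in> set (map E (filter lo u))"
      and at: "snd p = snd q \<or> fst p = fst q \<and> \<kappa> (snd p) = \<kappa> (snd q)" for p q
    proof -
      obtain y where y: "snd p = e y" "low y" "y \<in> flag_columns m r" "(fst p, y) \<in> set u" using lows [OF p] by blast
      obtain y' where y': "snd q = e y'" "low y'" "y' \<in> flag_columns m r" "(fst q, y') \<in> set u" using lows [OF q] by blast
      have "(fst p, y) = (fst q, y')"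
      proof (cases "snd p = snd q")
        case True
        then have "y = y'" using e_inj y y' by metis
        have "inj_on snd (set u)" using dist [OF u] by (simp add: distinct_map)
        then show ?thesis by (rule inj_onD) (use y(4) y'(4) \<open>y = y'\<close> in simp_all)
      next
        case False
        then have "fst p = fst q" "y div r = y' div r" using at e_color y y' by metis+
        then show ?thesis using u y(4) y'(4) unfolding flags_def by fastforce
      qed
      then show ?thesis using y(1) y'(1) by (simp add: prod_eq_iff)
    qed
    have "set (map E (filter lo u) @ w) \<in> X"
      unfolding X_def rook_def
    proof (intro CollectI conjI ballI impI)
      fix p assume p: "p \<in> set (map E (filter lo u) @ w)"
      show "snd p \<in> S"
        using p lows e_in wP(1) Sb(1) by (metis Un_iff set_append subsetD)
      show "fst p \<in> {..<r}"
      proof (cases "p \<in> set w")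
        case True
        then show ?thesis using wP(2) by simp
      next
        case False
        then have "p \<in> set (map E (filter lo u))" using p by simp
        then have "\<exists>y. (fst p, y) \<in> set u" using lows by blast
        then show ?thesis using cols_in(2) [OF u] by fastforce
      qed
      fix q assume q: "q \<in> set (map E (filter lo u) @ w)"
        and at: "snd p = snd q \<or> fst p = fst q \<and> \<kappa> (snd p) = \<kappa> (snd q)"
      show "p = q"
        using p q at lowlow wP' cross by (metis Un_iff set_append)
    qed
    moreover have "length (map E (filter lo u) @ w) = length u"
      using w(2) split [OF u] by (metis length_append length_map)
    ultimately show "Poly_Mapping.keys (frag_of (map E (filter lo u) @ w)) \<subseteq> simps X (length u)"
      by (simp add: simps_def)
  qed
  have \<psi>_bd: "bd (\<psi> u) = frag_extend \<psi> (bdl u)" if u: "u \<in> flags m r" for u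
  proof -
    define a where "a = filter lo u"
    define b where "b = filter (\<lambda>p. \<not> lo p) u"
    have ab: "u = a @ b" using split [OF u] by (simp add: a_def b_def)
    have a: "\<forall>p\<in>set a. lo p" and b: "\<forall>p\<in>set b. \<not> lo p" by (auto simp: a_def b_def)
    have \<psi>_app: "\<psi> (a' @ b') = prepend (map E a') (\<Psi> (map fst b'))"
      if "\<forall>p\<in>set a'. lo p" "\<forall>p\<in>set b'. \<not> lo p" for a' b'
    proof -
      have "filter lo (a' @ b') = a'" "filter (\<lambda>p. \<not> lo p) (a' @ b') = b'" using that by (simp_all add: filter_empty_conv filter_id_conv)
      then show ?thesis by (simp only: \<psi>_def)
    qed
    have "frag_extend \<psi> (bdl u) = frag_extend (\<lambda>v. \<psi> (v @ b)) (bdl a)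
        + frag_cmul ((-1) ^ length a) (frag_extend (\<lambda>v. \<psi> (a @ v)) (bdl b))"
      by (simp add: ab bdl_append_frag frag_extend_add frag_extend_cmul frag_extend_extend)
    also have "frag_extend (\<lambda>v. \<psi> (v @ b)) (bdl a) = frag_extend (\<lambda>v. prepend (map E v) (\<Psi> (map fst b))) (bdl a)"
    proof (rule frag_extend_eq)
      fix v assume "v \<in> Poly_Mapping.keys (bdl a)"
      then have "\<forall>p\<in>set v. lo p" using keys_bdl_set a by blast
      then show "\<psi> (v @ b) = prepend (map E v) (\<Psi> (map fst b))" using \<psi>_app b by blast
    qed
    also have "\<dots> = frag_extend (\<lambda>v. prepend v (\<Psi> (map fst b))) (bdl (map E a))"
      by (simp add: bdl_map frag_extend_lmap)
    also have "frag_extend (\<lambda>v. \<psi> (a @ v)) (bdl b) = frag_extend (\<lambda>v. prepend (map E a) (\<Psi> (map fst v))) (bdl b)"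
    proof (rule frag_extend_eq)
      fix v assume "v \<in> Poly_Mapping.keys (bdl b)"
      then have "\<forall>p\<in>set v. \<not> lo p" using keys_bdl_set b by blast
      then show "\<psi> (a @ v) = prepend (map E a) (\<Psi> (map fst v))" using \<psi>_app a by blast
    qed
    also have "\<dots> = prepend (map E a) (frag_extend \<Psi> (bdl (map fst b)))"
      by (simp add: bdl_map frag_extend_lmap prepend_def frag_extend_extend)
    also have "frag_extend \<Psi> (bdl (map fst b)) = bd (\<Psi> (map fst b))"
      using \<Psi> [OF high_len(2) [OF u]] high_len(1) [OF u] by (simp add: b_def)
    finally have "frag_extend \<psi> (bdl u) = bd (prepend (map E a) (\<Psi> (map fst b)))"
      by (simp add: bd_prepend)
    then show ?thesis using \<psi>_app a b ab by metis
  qed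
  have \<psi>_shift: "\<psi> (map (row_shift r) u) = lmap ?T (\<psi> u)" if u: "u \<in> flags m r" for u
  proof -
    have lo: "lo (row_shift r p) = lo p" for p by (simp add: lo_def row_shift_def)
    have f1: "filter lo (map (row_shift r) u) = map (row_shift r) (filter lo u)"
      "filter (\<lambda>p. \<not> lo p) (map (row_shift r) u) = map (row_shift r) (filter (\<lambda>p. \<not> lo p) u)"
      by (simp_all add: filter_map o_def lo)
    have f2: "map E (map (row_shift r) a) = map ?T (map E a)" "map fst (map (row_shift r) a) = map (\<lambda>i. Suc i mod r) (map fst a)"
      for a :: "(nat \<times> nat) list"
      by (simp_all add: E_def row_shift_def)
    have "\<Psi> (map (\<lambda>i. Suc i mod r) (map fst (filter (\<lambda>p. \<not> lo p) u))) = lmap ?T (\<Psi> (map fst (filter (\<lambda>p. \<not> lo p) u)))"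
      using \<Psi> [OF high_len(2) [OF u]] high_len(1) [OF u] by simp
    then show ?thesis
      unfolding \<psi>_def f1 f2 by (simp add: prepend_def lmap_frag_extend frag_extend_lmap)
  qed
  have \<psi>_X: "set w \<in> X" "length w \<le> L" if "u \<in> flags m r" "w \<in> Poly_Mapping.keys (\<psi> u)" for u w
    using \<psi>_keys [OF that(1)] that(2) len_L [OF that(1)] by (auto simp: simps_def)
  show False
  proof (rule no_equivariant_chain_map [OF r m, of \<Phi>])
    show "\<Phi> [] = frag_of []" by (simp add: \<Phi>_def \<psi>_def \<Psi>0 \<phi>0 prepend_def)
    fix u assume u: "u \<in> flags m r"
    show "Poly_Mapping.keys (\<Phi> u) \<subseteq> simps (block_sphere m r) (length u)"
      unfolding \<Phi>_def
    proof (rule keys_frag_extend_subset)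
      fix w assume w: "w \<in> Poly_Mapping.keys (\<psi> u)"
      then have "length w = length u" using \<psi>_keys [OF u] by (auto simp: simps_def)
      then show "Poly_Mapping.keys (\<phi> w) \<subseteq> simps (block_sphere m r) (length u)" using \<phi>_keys \<psi>_X [OF u w] by metis
    qed
    have "bd (\<Phi> u) = frag_extend (\<lambda>w. frag_extend \<phi> (bdl w)) (\<psi> u)"
      unfolding \<Phi>_def by (rule bd_frag_extend) (use \<phi>_bd \<psi>_X [OF u] in blast)
    also have "\<dots> = frag_extend \<phi> (frag_extend \<psi> (bdl u))"
      using \<psi>_bd [OF u] by (metis frag_extend_bd)
    also have "\<dots> = frag_extend \<Phi> (bdl u)" by (simp add: frag_extend_extend \<Phi>_def [abs_def])
    finally show "bd (\<Phi> u) = frag_extend \<Phi> (bdl u)" .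
    have "\<Phi> (map (row_shift r) u) = frag_extend (\<lambda>w. \<phi> (map ?T w)) (\<psi> u)"
      unfolding \<Phi>_def \<psi>_shift [OF u] by (rule frag_extend_lmap)
    also have "\<dots> = frag_extend (\<lambda>w. lmap (rot m r) (\<phi> w)) (\<psi> u)"
      by (rule frag_extend_eq) (use \<phi>_shift \<psi>_X [OF u] in blast)
    finally show "\<Phi> (map (row_shift r) u) = lmap (rot m r) (\<Phi> u)"
      by (simp add: \<Phi>_def lmap_frag_extend)
  qed
qed

section \<open>The colored Tverberg theorem\<close>

text \<open>Pushes a point of the cone over \<open>\<Delta>\<^sub>N\<close> into \<open>\<Delta>\<^sub>N\<close>, and rescales it when its mass is \<open>1 / r\<close>. So
  \<open>f\<close> can be evaluated without dividing by a mass that may vanish.\<close>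

definition stretch :: "nat \<Rightarrow> nat \<Rightarrow> (nat \<Rightarrow> real) \<Rightarrow> nat \<Rightarrow> real" where
  "stretch N r w = (\<lambda>v. if v \<le> N
     then (w v + (if v = 0 then max 0 (1 / real r - (\<Sum>u\<le>N. w u)) else 0)) / max (\<Sum>u\<le>N. w u) (1 / real r)
     else 0)"

text \<open>The deficit placed on vertex \<open>0\<close> raises the mass \<open>s\<close> to
  \<open>max s (1 / real r)\<close>, which is positive and is the number divided by.\<close>

lemma stretch_in_simplex:
  assumes r: "r > 0" and w: "\<And>v. v \<le> N \<Longrightarrow> 0 \<le> w v"
  shows "stretch N r w \<in> standard_simplex N"
proof -
  define s where "s = (\<Sum>u\<le>N. w u)"
  define a where "a = max s (1 / real r)"
  define b where "b = max 0 (1 / real r - s)"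
  have "0 < 1 / real r" using r by simp
  then have a: "a > 0" "s + b = a" unfolding a_def b_def by linarith+
  have eq: "stretch N r w v = (if v \<le> N then (w v + (if v = 0 then b else 0)) / a else 0)" for v
    by (simp add: stretch_def s_def a_def b_def)
  have nonneg: "0 \<le> stretch N r w v" for v
    using w [of v] a by (simp add: eq b_def)
  have "(\<Sum>v\<le>N. stretch N r w v) = (\<Sum>v\<le>N. w v + (if v = 0 then b else 0)) / a"
    unfolding sum_divide_distrib by (rule sum.cong) (auto simp: eq)
  also have "\<dots> = (s + b) / a" by (simp add: sum.distrib s_def)
  also have "\<dots> = 1" using a by simp
  finally have sum1: "(\<Sum>v\<le>N. stretch N r w v) = 1" .
  have "stretch N r w v \<le> 1" for v
  proof (cases "v \<le> N")
    case True
    then have "stretch N r w v \<le> (\<Sum>v\<le>N. stretch N r w v)"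
      using nonneg by (intro member_le_sum) auto
    then show ?thesis using sum1 by simp
  qed (simp add: eq)
  then show ?thesis using nonneg sum1 by (auto simp: standard_simplex_def eq)
qed

lemma stretch_scale:
  assumes "r > 0" "(\<Sum>u\<le>N. w u) = 1 / real r" "v \<le> N"
  shows "stretch N r w v = real r * w v"
  using assms by (simp add: stretch_def)

lemma continuous_map_stretch:
  assumes r: "r > 0" and w: "\<And>x v. x \<in> topspace Y \<Longrightarrow> v \<le> N \<Longrightarrow> 0 \<le> w x v"
    and cont: "\<And>v. v \<le> N \<Longrightarrow> continuous_map Y euclideanreal (\<lambda>x. w x v)"
  shows "continuous_map Y (simplex_space N) (\<lambda>x. stretch N r (w x))"
  unfolding simplex_space_def continuous_map_in_subtopology continuous_map_componentwise_UNIV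
proof (intro conjI allI)
  have s: "continuous_map Y euclideanreal (\<lambda>x. \<Sum>u\<le>N. w x u)" by (rule continuous_map_sum) (use cont in auto)
  show "continuous_map Y euclideanreal (\<lambda>x. stretch N r (w x) v)" for v
  proof (cases "v \<le> N")
    case True
    have "continuous_map Y euclideanreal (\<lambda>x. (w x v + (if v = 0 then max 0 (1 / real r - (\<Sum>u\<le>N. w x u)) else 0))
        / max (\<Sum>u\<le>N. w x u) (1 / real r))"
    proof (rule continuous_map_real_divide)
      show "continuous_map Y euclideanreal (\<lambda>x. w x v + (if v = 0 then max 0 (1 / real r - (\<Sum>u\<le>N. w x u)) else 0))"
        using cont [OF True] s by (cases "v = 0") (auto intro!: continuous_intros)
      show "continuous_map Y euclideanreal (\<lambda>x. max (\<Sum>u\<le>N. w x u) (1 / real r))"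
        using s by (intro continuous_map_real_max) auto
      have "0 < 1 / real r" using r by simp
      then show "max (\<Sum>u\<le>N. w x u) (1 / real r) \<noteq> 0" for x by linarith
    qed
    then show ?thesis using True by (simp add: stretch_def)
  qed (simp add: stretch_def)
  show "(\<lambda>x. stretch N r (w x)) \<in> topspace Y \<rightarrow> standard_simplex N"
    using stretch_in_simplex [OF r] w by blast
qed

text \<open>\<open>column_rank\<close> enumerates the columns consecutively, skipping the unused position of each block.\<close>

definition column_rank :: "nat \<Rightarrow> nat \<Rightarrow> nat" where
  "column_rank r y = y - y div r"

lemma rank_code:
  assumes "r > 0" "q < r" shows "column_rank r (j * r + q) = j * (r - 1) + q"
proof -
  have "j * r = j * (r - 1) + j" using assms by (metis Suc_pred' add.commute mult_Suc_right)
  then show ?thesis using block_code(1) [OF assms(2), of j] by (simp add: column_rank_def)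
qed

lemma rank_mono: "r > 0 \<Longrightarrow> y \<le> y' \<Longrightarrow> column_rank r y \<le> column_rank r y'"
proof -
  assume r: "r > 0" and "y \<le> y'"
  then obtain k where k: "y' = y + k" using le_Suc_ex by blast
  have "(y + k) div r \<le> (y + k * r) div r" using r by (intro div_le_mono) simp
  then have "(y + k) div r \<le> y div r + k" using r by simp
  moreover have "y div r \<le> y" by simp
  ultimately show ?thesis by (simp add: column_rank_def k)
qed

text \<open>\<open>Original v\<close> is a vertex of the simplex, \<open>Filler j q\<close> fills
  the small class \<open>j\<close>, and \<open>Single v\<close> is a color class of its own for a
  vertex \<open>v\<close> of a small class.\<close>

datatype column = Original nat | Filler nat nat | Single nat

theorem theorem9p2:
  fixes r d l k N :: nat
    and C :: "nat \<Rightarrow> nat set"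
    and f :: "(nat \<Rightarrow> real) \<Rightarrow> (nat \<Rightarrow> real)"
  assumes "prime r" and "r \<ge> 2" and "d \<ge> 1"
    and "vertex_coloring N (l + k) C"
    and "\<And>j. j < l \<Longrightarrow> card (C j) \<le> r - 1"
    and "\<And>j. l \<le> j \<Longrightarrow> j < l + k \<Longrightarrow> card (C j) \<ge> 2 * r - 1"
    and "(\<Sum>j<l. int (card (C j))) > (int r - 1) * (int d - int k + 1) - int k"
    and "continuous_map (simplex_space N) (Euclidean_space d) f"
  shows "\<exists>\<sigma> :: nat \<Rightarrow> nat set.
           (\<forall>i<r. rainbow_face N (l + k) C (\<sigma> i)) \<and>
           (\<forall>i<r. \<forall>j<r. i \<noteq> j \<longrightarrow> \<sigma> i \<inter> \<sigma> j = {}) \<and>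
           (\<Inter>i<r. f ` simplex_face N (\<sigma> i)) \<noteq> {}"
proof -
  have r0: "r > 0" using assms(2) by simp
  \<comment> \<open>One coordinate for the mass of a row, \<open>d\<close> for \<open>f\<close>, and
    one for each group of new columns.\<close>
  define m where "m = d + 1 + l"
  have CN: "C j \<subseteq> {..N}" if "j < l + k" for j
    using assms(4) that unfolding vertex_coloring_def by blast
  have C_disj: "C i \<inter> C j = {}" if "i < l + k" "j < l + k" "i \<noteq> j" for i j
    using assms(4) that unfolding vertex_coloring_def disjoint_family_on_def by blast
  have finC: "finite (C j)" if "j < l + k" for j using CN [OF that] finite_subset by blast
  define color where "color v = (THE j. j < l + k \<and> v \<in> C j)" for v
  have color: "color v = j" if "j < l + k" "v \<in> C j" for v j
    unfolding color_def using C_disj that by (intro the_equality) blast+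
  define V0 where "V0 = (\<Union>j<l. C j)"
  define s where "s = card V0"
  have finV0: "finite V0" unfolding V0_def using finC by simp
  have s_sum: "s = (\<Sum>j<l. card (C j))"
    unfolding s_def V0_def using finC C_disj by (intro card_UN_disjoint) auto
  \<comment> \<open>This is the comparison of required and available columns with
    \<open>l * (r - 1)\<close> cancelled from both sides.\<close>
  have count: "(d + 1) * (r - 1) + 1 \<le> s + k * r"
  proof -
    have "int s > (int r - 1) * (int d - int k + 1) - int k" using assms(7) by (simp add: s_sum)
    moreover have "(int r - 1) * (int d - int k + 1) - int k = (int d + 1) * (int r - 1) - int k * int r"
      by (simp add: algebra_simps)
    moreover have "int (r - 1) = int r - 1" using r0 by (simp add: of_nat_diff)
    then have "int ((d + 1) * (r - 1) + 1) = (int d + 1) * (int r - 1) + 1"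
      by (simp only: of_nat_add of_nat_mult of_nat_1)
    moreover have "int (s + k * r) = int s + int k * int r" by simp
    ultimately have "int ((d + 1) * (r - 1) + 1) \<le> int (s + k * r)" by linarith
    then show ?thesis by (simp only: of_nat_le_iff)
  qed
  \<comment> \<open>The group has \<open>r - 1\<close> columns, too few to meet all \<open>r\<close>
    rows. Besides filling class \<open>g\<close>, it spends the rest of its columns on classes of
    size one.\<close>
  define added where "added g = Filler g ` {..<r - 1 - card (C g)} \<union> Single ` C g" for g
  define S where "S = Original ` {..N} \<union> (\<Union>g<l. added g)"
  define \<kappa> where "\<kappa> c = (case c of Original v \<Rightarrow> color v | Filler j q \<Rightarrow> j | Single v \<Rightarrow> l + k + v)" for c
  define Sb where "Sb = Original ` (\<Union>j\<in>{l..<l + k}. C j)"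
  define X where "X = rook \<kappa> (\<lambda>_. {..<r}) S"
  define U where "U = {..<r} \<times> S"
  have fin_added: "finite (added g)" if "g < l" for g using finC that by (simp add: added_def)
  have finS: "finite S" using fin_added by (simp add: S_def)
  have "\<exists>h. bij_betw h {0..<card (C j)} (C j)" if "j < l" for j
    using ex_bij_betw_nat_finite [OF finC] that by simp
  then obtain en where en: "\<And>j. j < l \<Longrightarrow> bij_betw (en j) {0..<card (C j)} (C j)" by metis
  obtain enV where enV: "bij_betw enV {0..<s} V0" using ex_bij_betw_nat_finite [OF finV0] unfolding s_def by blast
  \<comment> \<open>The first \<open>l\<close> blocks and the next \<open>s\<close> columns have
    actual counterparts; the others are left to the large classes.\<close>
  define low where "low y \<longleftrightarrow> column_rank r y < l * (r - 1) + s" for y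
  define e where "e y = (if y div r < l
      then if y mod r < card (C (y div r)) then Original (en (y div r) (y mod r))
        else Filler (y div r) (y mod r - card (C (y div r)))
      else Single (enV (column_rank r y - l * (r - 1))))" for y
  \<comment> \<open>Equal mass in every row is itself one of the coincidences asked for; it replaces
    any normalization of the rows.\<close>
  define F where "F x i j = (if j = 0 then \<Sum>v\<le>N. x (i, Original v)
      else if j \<le> d then f (stretch N r (\<lambda>v. x (i, Original v))) (j - 1)
      else \<Sum>c\<in>added (j - d - 1). x (i, c))" for x :: "nat \<times> column \<Rightarrow> real" and i j
  let ?cols = "flag_columns m r"
  have col_decode: "y = y div r * r + y mod r" "y mod r < r - 1" "column_rank r y = y div r * (r - 1) + y mod r"
    if "y \<in> ?cols" for y
  proof -
    show 1: "y = y div r * r + y mod r" by simp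
    have "y mod r < r" "y mod r \<noteq> r - 1" using that r0 by (auto simp: flag_columns_def)
    then show "y mod r < r - 1" by linarith
    show "column_rank r y = y div r * (r - 1) + y mod r" using rank_code [OF r0, of "y mod r" "y div r"] r0 by simp
  qed
  have rank_inj: "y = y'" if y: "y \<in> ?cols" and y': "y' \<in> ?cols" and eq: "column_rank r y = column_rank r y'" for y y'
  proof -
    have "y div r = column_rank r y div (r - 1)" "y mod r = column_rank r y mod (r - 1)"
      using block_code [OF col_decode(2) [OF y], of "y div r"] col_decode(3) [OF y] by simp_all
    moreover have "y' div r = column_rank r y' div (r - 1)" "y' mod r = column_rank r y' mod (r - 1)"
      using block_code [OF col_decode(2) [OF y'], of "y' div r"] col_decode(3) [OF y'] by simp_all
    ultimately show ?thesis using eq by (metis div_mult_mod_eq)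
  qed
  have large: "l * (r - 1) \<le> column_rank r y" if "y \<in> ?cols" "\<not> y div r < l" for y
  proof -
    have "l * (r - 1) \<le> y div r * (r - 1)" using that by (intro mult_le_mono1) simp
    then show ?thesis unfolding col_decode(3) [OF that(1)] by (rule trans_le_add1)
  qed
  have en_in: "en j q \<in> C j" if "j < l" "q < card (C j)" for j q
    using en [OF that(1)] that(2) by (auto simp: bij_betw_def)
  have enV_in: "enV (column_rank r y - l * (r - 1)) \<in> V0" if "y \<in> ?cols" "low y" "\<not> y div r < l" for y
  proof -
    have "column_rank r y - l * (r - 1) < s" using large that by (force simp: low_def)
    then show ?thesis using enV by (auto simp: bij_betw_def)
  qed
  have \<kappa>_low: "\<kappa> (e y) = y div r" if "y div r < l" for y
    using that color [of "y div r"] en_in by (simp add: e_def \<kappa>_def)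
  have \<kappa>_high: "\<kappa> (e y) = l + k + enV (column_rank r y - l * (r - 1))" if "\<not> y div r < l" for y
    using that by (simp add: e_def \<kappa>_def)
  have e_color: "y div r = y' div r" and e_inj: "e y = e y' \<Longrightarrow> y = y'"
    if y: "y \<in> ?cols" "low y" and y': "y' \<in> ?cols" "low y'" and eq: "\<kappa> (e y) = \<kappa> (e y')" for y y'
  proof -
    have both: "y div r < l \<longleftrightarrow> y' div r < l"
      using eq \<kappa>_low [of y] \<kappa>_low [of y'] \<kappa>_high [of y] \<kappa>_high [of y'] by linarith
    have high_eq: "y = y'" if h: "\<not> y div r < l"
    proof -
      have h': "\<not> y' div r < l" using both h by simp
      have "enV (column_rank r y - l * (r - 1)) = enV (column_rank r y' - l * (r - 1))"
        using eq \<kappa>_high [OF h] \<kappa>_high [OF h'] by simp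
      moreover have "column_rank r y - l * (r - 1) < s" "column_rank r y' - l * (r - 1) < s"
        using large [OF y(1) h] large [OF y'(1) h'] y(2) y'(2) by (auto simp: low_def)
      ultimately have "column_rank r y - l * (r - 1) = column_rank r y' - l * (r - 1)"
        using enV by (auto simp: bij_betw_def dest: inj_onD)
      then have "column_rank r y = column_rank r y'" using large [OF y(1) h] large [OF y'(1) h'] by linarith
      then show ?thesis using rank_inj y(1) y'(1) by blast
    qed
    show div_eq: "y div r = y' div r"
    proof (cases "y div r < l")
      case True
      then show ?thesis using eq \<kappa>_low both by simp
    qed (use high_eq in simp)
    show "y = y'" if ee: "e y = e y'"
    proof (cases "y div r < l")
      case True
      define j where "j = y div r"
      have j: "y div r = j" "y' div r = j" "j < l" using True div_eq by (auto simp: j_def)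
      have "inj_on (en j) {0..<card (C j)}" using en [OF j(3)] by (simp add: bij_betw_def)
      then have "y mod r = y' mod r"
        using ee j unfolding e_def by (auto split: if_splits dest: inj_onD)
      then show ?thesis using div_eq by (metis div_mult_mod_eq)
    qed (use high_eq in simp)
  qed
  have card_added: "card (added g) < r" if g: "g < l" for g
  proof -
    have "card (added g) \<le> card (Filler g ` {..<r - 1 - card (C g)}) + card (Single ` C g)"
      unfolding added_def by (rule card_Un_le)
    also have "\<dots> \<le> (r - 1 - card (C g)) + card (C g)"
      using card_image_le [of "{..<r - 1 - card (C g)}" "Filler g"] card_image_le [of "C g" Single] finC g
      by (intro add_mono) auto
    finally show ?thesis using assms(5) [OF g] r0 by linarith
  qed
  have proj: "continuous_map (realization_space U X) euclideanreal (\<lambda>x. x v)" for v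
    unfolding realization_space_def
    by (intro continuous_map_from_subtopology continuous_map_product_projection) simp
  have cont: "continuous_map (realization_space U X) euclideanreal (\<lambda>x. F x i j)" if "i < r" "j < m" for i j
  proof -
    consider "j = 0" | "j \<noteq> 0" "j \<le> d" | "j > d" by linarith
    then show ?thesis
    proof cases
      case 1
      then show ?thesis unfolding F_def by (simp add: continuous_map_sum proj)
    next
      case 2
      have "continuous_map (realization_space U X) (simplex_space N) (\<lambda>x. stretch N r (\<lambda>v. x (i, Original v)))"
        by (rule continuous_map_stretch [OF r0]) (auto simp: proj realization_def)
      then have "continuous_map (realization_space U X) (Euclidean_space d) (f \<circ> (\<lambda>x. stretch N r (\<lambda>v. x (i, Original v))))"
        by (rule continuous_map_compose) (rule assms(8))
      then have "continuous_map (realization_space U X) euclideanreal (\<lambda>x. (f \<circ> (\<lambda>x. stretch N r (\<lambda>v. x (i, Original v)))) x (j - 1))"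
        unfolding Euclidean_space_def continuous_map_in_subtopology continuous_map_componentwise_UNIV by blast
      then show ?thesis using 2 by (simp add: F_def)
    next
      case 3
      then have "j - d - 1 < l" using that by (simp add: m_def)
      then show ?thesis using 3 fin_added unfolding F_def by (simp add: continuous_map_sum proj)
    qed
  qed
  have "\<exists>x\<in>realization U X. \<forall>j<m. \<forall>a<r. \<forall>b<r. F x a j = F x b j"
    unfolding U_def X_def
  proof (rule equivariant_coincidence [where e = e and low = low and Sb = Sb and B = "{l..<l + k}"])
    show "m > 0" by (simp add: m_def)
    show "F (\<lambda>v. x (row_unshift r v)) (Suc i mod r) j = F x i j" if "i < r" for x i j
      using that by (simp add: F_def row_unshift_Suc)
    show "low y" if "y < y'" "low y'" for y y'
      using rank_mono [OF r0, of y y'] that by (simp add: low_def)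
    show "e y \<in> S" if y: "y \<in> ?cols" "low y" for y
    proof (cases "y div r < l")
      case True
      show ?thesis
      proof (cases "y mod r < card (C (y div r))")
        case t: True
        then have "en (y div r) (y mod r) \<in> {..N}" using en_in [OF True] CN [of "y div r"] True by auto
        then show ?thesis using True t by (simp add: e_def S_def)
      next
        case False
        then have "y mod r - card (C (y div r)) < r - 1 - card (C (y div r))"
          using col_decode(2) [OF y(1)] by linarith
        then have "e y \<in> added (y div r)" using True False by (simp add: e_def added_def)
        then show ?thesis using True unfolding S_def by blast
      qed
    next
      case False
      then obtain g where "g < l" "enV (column_rank r y - l * (r - 1)) \<in> C g"
        using enV_in [OF y] by (auto simp: V0_def)
      then have "e y \<in> added g" using False by (simp add: e_def added_def)
      then show ?thesis using \<open>g < l\<close> unfolding S_def by blast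
    qed
    show "\<And>y y'. y \<in> ?cols \<Longrightarrow> y' \<in> ?cols \<Longrightarrow> low y \<Longrightarrow> low y' \<Longrightarrow> e y = e y' \<Longrightarrow> y = y'"
      using e_inj by metis
    show "\<And>y y'. y \<in> ?cols \<Longrightarrow> y' \<in> ?cols \<Longrightarrow> low y \<Longrightarrow> low y' \<Longrightarrow> \<kappa> (e y) = \<kappa> (e y') \<Longrightarrow> y div r = y' div r"
      using e_color by metis
    have \<kappa>_Sb: "l \<le> \<kappa> c \<and> \<kappa> c < l + k" if "c \<in> Sb" for c
      using that color by (auto simp: Sb_def \<kappa>_def)
    show "\<kappa> (e y) \<noteq> \<kappa> c" if "c \<in> Sb" for y c
      using \<kappa>_Sb [OF that] \<kappa>_low [of y] \<kappa>_high [of y] by linarith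
    show "Sb \<subseteq> S" using CN unfolding Sb_def S_def by force
    show "ample \<kappa> {l..<l + k} (\<lambda>_. {..<r}) Sb (\<lambda>_. r)"
      unfolding ample_def
    proof (intro conjI ballI)
      show "finite Sb" using finC by (simp add: Sb_def)
      fix b assume b: "b \<in> {l..<l + k}"
      have "Original ` C b \<subseteq> board \<kappa> Sb b"
      proof (rule image_subsetI)
        fix v assume v: "v \<in> C b"
        then have "Original v \<in> Sb" unfolding Sb_def using b by blast
        moreover have "\<kappa> (Original v) = b" using color [of b v] b v by (simp add: \<kappa>_def)
        ultimately show "Original v \<in> board \<kappa> Sb b" by (simp add: board_def)
      qed
      then have "card (Original ` C b) \<le> card (board \<kappa> Sb b)"
        using \<open>finite Sb\<close> by (intro card_mono finite_board)
      moreover have "card (Original ` C b) = card (C b)" by (rule card_image) (simp add: inj_on_def)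
      moreover have "card (C b) \<ge> 2 * r - 1" using assms(6) b by simp
      ultimately show "2 * r \<le> Suc (card (board \<kappa> Sb b))" by linarith
    qed simp_all
    \<comment> \<open>The upper end \<open>m * (r - 1)\<close> is attained by the extra column
      \<open>m * r\<close>, and it accounts for the \<open>+ 1\<close> in
      \<open>count\<close>.\<close>
    have "card {y \<in> ?cols. \<not> low y} \<le> card {l * (r - 1) + s..m * (r - 1)}"
    proof (rule card_inj_on_le [where f = "column_rank r"])
      show "inj_on (column_rank r) {y \<in> ?cols. \<not> low y}" using rank_inj by (auto simp: inj_on_def)
      show "column_rank r ` {y \<in> ?cols. \<not> low y} \<subseteq> {l * (r - 1) + s..m * (r - 1)}"
      proof (rule image_subsetI)
        fix y assume y: "y \<in> {y \<in> ?cols. \<not> low y}"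
        then have "y \<le> m * r" by (simp add: flag_columns_def)
        then have "column_rank r y \<le> column_rank r (m * r + 0)" using rank_mono [OF r0] by simp
        then have "column_rank r y \<le> m * (r - 1)" using rank_code [OF r0 r0, of m] by simp
        then show "column_rank r y \<in> {l * (r - 1) + s..m * (r - 1)}" using y by (simp add: low_def)
      qed
    qed simp
    also have "\<dots> = Suc (m * (r - 1)) - (l * (r - 1) + s)" by simp
    also have "\<dots> \<le> k * r"
    proof -
      have "m * (r - 1) = (d + 1) * (r - 1) + l * (r - 1)" by (simp add: m_def distrib_right)
      then show ?thesis using count by linarith
    qed
    finally show "card {y \<in> ?cols. \<not> low y} \<le> card {l..<l + k} * r" by simp
  qed (use assms(1) finS cont in \<open>simp_all add: U_def X_def\<close>)
  then obtain x where x: "x \<in> realization U X" and coin: "\<And>j a b. j < m \<Longrightarrow> a < r \<Longrightarrow> b < r \<Longrightarrow> F x a j = F x b j"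
    by blast
  have x0: "0 \<le> x v" and supp: "{v. x v \<noteq> 0} \<in> X" and sum1: "sum x U = 1" for v
    using x unfolding realization_def by blast+
  have same_col: "a = b" if "x (a, c) \<noteq> 0" "x (b, c) \<noteq> 0" for a b c
  proof -
    have "\<forall>p\<in>{v. x v \<noteq> 0}. \<forall>q\<in>{v. x v \<noteq> 0}. snd p = snd q \<longrightarrow> p = q"
      using supp unfolding X_def rook_def by blast
    moreover have "(a, c) \<in> {v. x v \<noteq> 0}" "(b, c) \<in> {v. x v \<noteq> 0}" using that by simp_all
    ultimately have "snd (a, c) = snd (b, c) \<longrightarrow> (a, c) = (b, c)" by blast
    then show ?thesis by simp
  qed
  have same_row: "c = c'" if "x (a, c) \<noteq> 0" "x (a, c') \<noteq> 0" "\<kappa> c = \<kappa> c'" for a c c'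
  proof -
    have "\<forall>p\<in>{v. x v \<noteq> 0}. \<forall>q\<in>{v. x v \<noteq> 0}. fst p = fst q \<and> \<kappa> (snd p) = \<kappa> (snd q) \<longrightarrow> p = q"
      using supp unfolding X_def rook_def by blast
    moreover have "(a, c) \<in> {v. x v \<noteq> 0}" "(a, c') \<in> {v. x v \<noteq> 0}" using that by simp_all
    ultimately have "fst (a, c) = fst (a, c') \<and> \<kappa> (snd (a, c)) = \<kappa> (snd (a, c')) \<longrightarrow> (a, c) = (a, c')" by blast
    then show ?thesis using that(3) by simp
  qed
  \<comment> \<open>If every row had a nonzero entry in the group, these entries would lie in
    \<open>r\<close> different columns. So some row has sum zero, hence all rows do, and the entries
    are nonnegative.\<close>
  have added_0: "x (i, c) = 0" if "i < r" "g < l" "c \<in> added g" for i g c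
  proof -
    have F: "F x i (d + 1 + g) = (\<Sum>c\<in>added g. x (i, c))" for i by (simp add: F_def)
    have "\<exists>i<r. F x i (d + 1 + g) = 0"
    proof (rule ccontr)
      assume "\<not> (\<exists>i<r. F x i (d + 1 + g) = 0)"
      then have "\<exists>c\<in>added g. x (i, c) \<noteq> 0" if "i < r" for i
        using that F sum.neutral by metis
      then obtain h where h: "\<And>i. i < r \<Longrightarrow> h i \<in> added g \<and> x (i, h i) \<noteq> 0" by metis
      have "inj_on h {..<r}" using h same_col by (metis inj_onI lessThan_iff)
      then have "card {..<r} \<le> card (added g)"
        using h fin_added [OF that(2)] by (intro card_inj_on_le) auto
      then show False using card_added [OF that(2)] by simp
    qed
    then obtain a where a: "a < r" "F x a (d + 1 + g) = 0" by blast
    have "d + 1 + g < m" using that(2) by (simp add: m_def)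
    then have "F x i (d + 1 + g) = F x a (d + 1 + g)" using that(1) a(1) by (rule coin)
    then have "(\<Sum>c\<in>added g. x (i, c)) = 0" using a(2) F by simp
    then have "\<forall>c\<in>added g. x (i, c) = 0"
      by (subst (asm) sum_nonneg_eq_0_iff [OF fin_added [OF that(2)] x0])
    then show ?thesis using that(3) by blast
  qed
  \<comment> \<open>The new columns carry nothing, so the total mass \<open>1\<close> sits on
    original columns and is shared equally by \<open>r\<close> rows. At mass
    \<open>1 / real r\<close> the map \<open>stretch\<close> is plain scaling and preserves
    supports.\<close>
  have mass: "F x i 0 = 1 / real r" if i: "i < r" for i
  proof -
    have row_sum: "(\<Sum>c\<in>S. x (a, c)) = F x a 0" if "a < r" for a
    proof -
      have "(\<Sum>c\<in>S. x (a, c)) = (\<Sum>c\<in>Original ` {..N}. x (a, c))"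
        by (rule sum.mono_neutral_right) (use finS added_0 [OF that] in \<open>auto simp: S_def\<close>)
      also have "\<dots> = (\<Sum>v\<le>N. x (a, Original v))" by (subst sum.reindex) (auto simp: inj_on_def)
      finally show ?thesis by (simp add: F_def)
    qed
    have m0: "0 < m" by (simp add: m_def)
    have "sum x U = (\<Sum>a<r. \<Sum>c\<in>S. x (a, c))"
      unfolding U_def sum.cartesian_product by (simp add: case_prod_unfold)
    also have "\<dots> = (\<Sum>a<r. F x i 0)"
    proof (rule sum.cong [OF refl])
      fix a assume "a \<in> {..<r}"
      then have a: "a < r" by simp
      show "(\<Sum>c\<in>S. x (a, c)) = F x i 0" unfolding row_sum [OF a] by (rule coin [OF m0 a i])
    qed
    also have "\<dots> = real r * F x i 0" by simp
    finally have "real r * F x i 0 = 1" using sum1 by simp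
    then show ?thesis using r0 by (simp add: field_simps)
  qed
  define \<sigma> where "\<sigma> i = {v. v \<le> N \<and> x (i, Original v) \<noteq> 0}" for i
  define p where "p i = stretch N r (\<lambda>v. x (i, Original v))" for i
  have p_face: "p i \<in> simplex_face N (\<sigma> i)" if i: "i < r" for i
  proof -
    have "p i v = 0" if "v \<notin> \<sigma> i" for v
    proof (cases "v \<le> N")
      case True
      have "p i v = real r * x (i, Original v)"
        unfolding p_def by (rule stretch_scale [OF r0 _ True]) (use mass [OF i] in \<open>simp add: F_def\<close>)
      then show ?thesis using that True by (simp add: \<sigma>_def)
    qed (simp add: p_def stretch_def)
    moreover have "p i \<in> standard_simplex N" unfolding p_def by (rule stretch_in_simplex [OF r0]) (rule x0)
    ultimately show ?thesis by (simp add: simplex_face_def)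
  qed
  have f_eq: "f (p i) = f (p 0)" if i: "i < r" for i
  proof
    fix n
    show "f (p i) n = f (p 0) n"
    proof (cases "n < d")
      case True
      then have "F x i (Suc n) = f (p i) n" "F x 0 (Suc n) = f (p 0) n" by (simp_all add: F_def p_def)
      then show ?thesis using coin [of "Suc n" i 0] True i r0 by (simp add: m_def)
    next
      case False
      have "f (p a) n = 0" if "a < r" for a
      proof -
        have "p a \<in> topspace (simplex_space N)" using p_face [OF that] by (simp add: simplex_space_def simplex_face_def)
        then have "f (p a) \<in> topspace (Euclidean_space d)" using assms(8) by (auto simp: continuous_map_def)
        then show ?thesis using False by (simp add: topspace_Euclidean_space)
      qed
      then show ?thesis using i r0 by simp
    qed
  qed
  show ?thesis
  proof (intro exI [of _ \<sigma>] conjI allI impI)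
    show "rainbow_face N (l + k) C (\<sigma> i)" if "i < r" for i
      unfolding rainbow_face_def
    proof (intro conjI allI impI)
      show "\<sigma> i \<subseteq> {..N}" by (auto simp: \<sigma>_def)
      fix j assume j: "j < l + k"
      have "v = v'" if "v \<in> \<sigma> i \<inter> C j" "v' \<in> \<sigma> i \<inter> C j" for v v'
      proof -
        have "Original v = Original v'"
          by (rule same_row [of i]) (use that color j in \<open>auto simp: \<sigma>_def \<kappa>_def\<close>)
        then show ?thesis by simp
      qed
      then show "card (\<sigma> i \<inter> C j) \<le> 1"
        using finC [OF j] by (simp add: card_le_Suc0_iff_eq)
    qed
    show "\<sigma> i \<inter> \<sigma> j = {}" if "i < r" "j < r" "i \<noteq> j" for i j
      using same_col that(3) by (auto simp: \<sigma>_def)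
    have "f (p 0) \<in> (\<Inter>i<r. f ` simplex_face N (\<sigma> i))" using p_face f_eq by (metis INT_I image_eqI lessThan_iff)
    then show "(\<Inter>i<r. f ` simplex_face N (\<sigma> i)) \<noteq> {}" by blast
  qed
qed

end
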